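(* All of the following identities hold (where a line contains $\pm,\mp$, it holds both with all upper signs and with all lower signs). Level 8: (L8-1) $\dfrac{\Pi_q^2}{\Pi_{q^2}\Pi_{q^4}}-\dfrac{\Pi_{q^2}^2}{\Pi_{q^4}^2}=4$. Level 12: (L12-1) $\Pi_{q^2}^2+2\Pi_{q^2}\Pi_{q^6}=\Pi_q\Pi_{q^3}+3\Pi_{q^6}^2$; (L12-2) $\dfrac{\Pi_{q^2}\Pi_{q^3}^2}{\Pi_{q^6}\Pi_{q}^2}=\dfrac{\Pi_{q^2}-\Pi_{q^6}}{\Pi_{q^2}+3\Pi_{q^6}}$; (L12-3) $\sqrt{\Pi_{q^2}\Pi_{q^6}}\,(\Pi_q^2-3\Pi_{q^3}^2)=\sqrt{\Pi_q\Pi_{q^3}}\,(\Pi_{q^2}^2+3\Pi_{q^6}^2)$; (L12-4) $\Pi_{q^2}\Pi_{q^3}^4=\Pi_{q^6}(\Pi_{q^2}-\Pi_{q^6})^3(\Pi_{q^2}+3\Pi_{q^6})$; (L12-5) $\Pi_{q^6}\Pi_q^4=\Pi_{q^2}(\Pi_{q^2}-\Pi_{q^6})(\Pi_{q^2}+3\Pi_{q^6})^3$; (L12-6) $\Pi_q\Pi_{q^3}(\Pi_{q}^2\pm 4\Pi_{q^2}^2)^2=\Pi_{q^2}^2(\Pi_q\mp \Pi_{q^3})(\Pi_q\pm 3\Pi_{q^3})^3$; (L12-7) $\Pi_q\Pi_{q^3}(\Pi_{q^3}^2\pm 4\Pi_{q^6}^2)^2=\Pi_{q^6}^2(\Pi_q\mp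 \Pi_{q^3})^3(\Pi_q\pm 3\Pi_{q^3})$; (L12-8) $\Pi_{q^2}^2(\Pi_q^4+18\Pi_q^2\Pi_{q^3}^2-27\Pi_{q^3}^4)=\Pi_q\Pi_{q^3}(\Pi_q^4+16\Pi_{q^2}^4)$; (L12-9) $\Pi_{q^6}^2(\Pi_q^4-6\Pi_q^2\Pi_{q^3}^2-3\Pi_{q^3}^4)=\Pi_q\Pi_{q^3}(\Pi_{q^3}^4+16\Pi_{q^6}^4)$; (L12-10) $(\Pi_{q}^2-\Pi_{q^3}^2)^4\Pi_{q^3}\Pi_{q^2}^3\Pi_{q^6}=(\Pi_{q^2}^2-\Pi_{q^6}^2)^2\Pi_{q}^3(4\Pi_{q^6}^2+\Pi_q\Pi_{q^3})^3$; (L12-11) $\Pi_{q^3}\Pi_{q^6}^4(\Pi_q^2-\Pi_{q^3}^2)^4=(\Pi_{q^2}^2-\Pi_{q^6}^2)^2(\Pi_{q^3}^3+4\Pi_q\Pi_{q^6}^2)^3$; (L12-12) $(\Pi_q^2-\Pi_{q^3}^2)(\Pi_{q^2}-\Pi_{q^6})^3\Pi_{q^6}=\Pi_{q^3}^2(\Pi_{q^2}^2-\Pi_{q^6}^2)^2$; (L12-13) $\Pi_{q^2}\Pi_{q^3}^3=\Pi_q\Pi_{q^6}(\Pi_{q^2}-\Pi_{q^6})^2$; (L12-14) $\Pi_q^3\Pi_{q^6}=\Pi_{q^2}\Pi_{q^3}(\Pi_{q^2}+3\Pi_{q^6})^2$. Level 16: (L16-1) $\Pi_q^2\Pi_{q^8}=\Pi_{q^2}(\Pi_{q^4}+2\Pi_{q^8})^2$;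 (L16-2) $\Pi_q^4\Pi_{q^4}\Pi_{q^8}(\Pi_{q^4}^2+4\Pi_{q^8}^2)=\Pi_{q^2}^4(\Pi_{q^4}+2\Pi_{q^8})^4$. Level 18: (L18-1) $\Pi_{q^3}^2+3\Pi_q\Pi_{q^9}=\sqrt{\Pi_q\Pi_{q^9}}\,(\Pi_q+3\Pi_{q^9})$; (L18-2) $\sqrt{\Pi_{q^9}}\,(\sqrt{\Pi_{q}}-\sqrt{\Pi_{q^9}})^3=\Pi_{q^3}^2-\Pi_{q^9}^2$; (L18-3) $\Pi_{q^9}^2(\Pi_q^2-\Pi_{q^3}^2)^3=(\Pi_{q^3}^2-\Pi_{q^9}^2)(\Pi_{q^3}^2+3\Pi_q\Pi_{q^9})^3$; (L18-4) $\Pi_{q^9}(\Pi_q^2-\Pi_{q^3}^2)^6=\Pi_q^3(\Pi_{q^3}^2-\Pi_{q^9}^2)^2(\Pi_q+3\Pi_{q^9})^6$; (L18-5) $6\dfrac{\Pi_q}{\Pi_{q^3}}+3\dfrac{\Pi_{q^3}}{\Pi_{q}}-\dfrac{\Pi_q^3}{\Pi_{q^3}^3}=27\dfrac{\Pi_{q^9}^3}{\Pi_{q^3}^3}-18\dfrac{\Pi_{q^9}}{\Pi_{q^3}}-\dfrac{\Pi_{q^3}}{\Pi_{q^9}}$. Level 20: (L20-1) $\Pi_{q^2}\Pi_{q^5}^4(16\Pi_{q^{10}}^4-\Pi_{q^5}^4)=\Pi_{q^{10}}^3(5\Pi_{q^{10}}-\Pi_{q^2})(\Pi_{q^2}-\Pi_{q^{10}})^5$;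 (L20-2) $\Pi_{q^{10}}\Pi_q^4(16\Pi_{q^2}^4-\Pi_q^4)=\Pi_{q^2}^3(5\Pi_{q^{10}}-\Pi_{q^2})^5(\Pi_{q^2}-\Pi_{q^{10}})$; (L20-3) $\Pi_q\Pi_{q^5}(16\Pi_{q^2}^4-\Pi_q^4)^2=\Pi_{q^2}^4(5\Pi_{q^5}-\Pi_q)^5(\Pi_{q^5}-\Pi_q)$; (L20-4) $\Pi_q\Pi_{q^5}(16\Pi_{q^{10}}^4-\Pi_{q^5}^4)^2=\Pi_{q^{10}}^4(5\Pi_{q^5}-\Pi_q)(\Pi_{q^5}-\Pi_q)^5$; (L20-5) $\Pi_{q^2}\Pi_{q^{10}}(\Pi_{q^5}-\Pi_q)(5\Pi_{q^5}-\Pi_q)=(\Pi_q\Pi_{q^{10}}-\Pi_{q^2}\Pi_{q^5})^2$.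
   Context: Let $q=e^{2\pi i z}$ with $\mathrm{Im}\, z>0$, and for rational $r$ put $q^{r}:=e^{2\pi i r z}$. Write $(a;q)_\infty=\prod_{n=0}^\infty(1-aq^n)$. Define $$\Pi_q:=q^{1/4}\frac{(q^2;q^2)_\infty^2}{(q;q^2)_\infty^2}=q^{1/4}\psi(q)^2,\qquad \psi(q)=\sum_{n=0}^\infty q^{n(n+1)/2},$$ and for a positive integer $n$ let $\Pi_{q^n}$ denote the function obtained by replacing $q$ by $q^n$ (equivalently $z$ by $nz$), i.e. $\Pi_{q^n}=q^{n/4}\psi(q^n)^2$. Square roots are interpreted as $\sqrt{\Pi_{q^n}}=q^{n/8}\psi(q^n)$ and $\sqrt{\Pi_{q^a}\Pi_{q^b}}=\sqrt{\Pi_{q^a}}\sqrt{\Pi_{q^b}}$ (for $0<q<1$ these are the positive square roots). The identities are identities of meromorphic functions of $z$ on the upper half plane. The labels (L$N$-$n$) are only names for the identities. *)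

theory Defs
  imports "HOL-Analysis.Analysis"
begin

text \<open>The power \<open>q\<^sup>r\<close> with \<open>q = exp (2 \<pi> i z)\<close>. For fractional \<open>r\<close> it depends on \<open>z\<close>
  and not only on \<open>q\<close>, so it is a function of \<open>z\<close>; the nome is \<open>qpow 1 z\<close>.\<close>

definition qpow :: "real \<Rightarrow> complex \<Rightarrow> complex" where
  "qpow r z = exp (2 * of_real pi * \<i> * of_real r * z)"

definition qpoch :: "complex \<Rightarrow> complex \<Rightarrow> complex" where
  "qpoch a q = (\<Prod>n. 1 - a * q ^ n)"

definition psi :: "complex \<Rightarrow> complex" where
  "psi q = (\<Sum>n. q ^ (n * (n + 1) div 2))"

definition PiQ_base :: "complex \<Rightarrow> complex" where
  "PiQ_base z = (let q = qpow 1 z in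
     qpow (1/4) z * (qpoch (q^2) (q^2))^2 / (qpoch q (q^2))^2)"

text \<open>\<open>PiQ n\<close> is \<open>\<Pi>\<close> with \<open>q\<close> replaced by \<open>q\<^sup>n\<close>, i.e. \<open>z\<close> by \<open>n z\<close>.\<close>

definition PiQ :: "nat \<Rightarrow> complex \<Rightarrow> complex" where
  "PiQ n z = PiQ_base (of_nat n * z)"

text \<open>The branch of the square root of \<open>PiQ n\<close> that is holomorphic on the upper half plane and
  positive for \<open>0 < q < 1\<close>; in general it is not the principal root \<open>csqrt (PiQ n z)\<close>.\<close>

definition sqrt_PiQ :: "nat \<Rightarrow> complex \<Rightarrow> complex" where
  "sqrt_PiQ n z = qpow (real n / 8) z * psi (qpow 1 z ^ n)"

end

theory Submission
  imports Defs "HOL-Complex_Analysis.Complex_Analysis"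
begin

text \<open>
  With \<open>t = q\<^sup>1\<^sup>/\<^sup>8\<close> the square roots are \<open>S n = t ^ n * psi (q ^ n)\<close>, and every identity is an algebraic
  consequence of a few identities for theta series. The Jacobi triple product turns \<open>psi\<close>,
  \<open>phi q = \<Sum> q ^ n\<^sup>2\<close> and theta series over residue classes into quotients of Euler products.

  Levels 8 and 16 come from splitting \<open>phi\<close> by parity. For level 18, split \<open>psi q\<close> by exponents modulo 3
  and multiply over the three cube roots of \<open>q\<^sup>3\<close>: the product of the three values of \<open>psi\<close> is again a
  quotient of Euler products. The same argument for \<open>phi\<close>, together with the level 18 relation at \<open>q\<close> and
  \<open>q\<^sup>2\<close>, determines \<open>\<Pi>\<^sub>2 - \<Pi>\<^sub>6\<close> at level 12 up to finitely many branches; the right one is selected by the value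
  at \<open>q = 0\<close> and the identity theorem. Level 20 rests on three identities between products of two theta series,
  obtained by multiplication with \<open>2 + \<i>\<close> in the Gaussian integers and with \<open>1 + \<surd>-5\<close> in \<open>\<int>[\<surd>-5]\<close>.
\<close>

subsection \<open>Infinite products and the Jacobi triple product\<close>

text \<open>Fractional powers of the nome depend on z and not on q. The series are therefore
  evaluated at a root \<open>w\<close> of \<open>q\<close>, whose order is chosen to make all
  exponents squares: 8 for triangular numbers, 24 for pentagonal ones, with a further factor 5 or a
  smaller multiple where degree five needs it. Any root will do, since \<open>w\<close> survives
  only in a common power that cancels.

  Level 12 is the only place where algebra does not suffice. The relations obtained from cube roots
  contain the unknown quotient \<open>p\<close> only through its cube once everything else is
  eliminated, so a cube root has to be selected, and that choice is analytic. In level 18 the middle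
  term of the dissection is simply eliminated. In level 20 the differences \<Pi>_1 - \<Pi>_5 and
  \<Pi>_1 - 5 \<Pi>_5 are themselves quotients of Euler products, so most identities there amount to
  comparing exponents; the coefficient 5 arises from completing a square, not from a
  dissection.\<close>

lemma has_prod_qpoch:
  assumes "norm q < 1"
  shows "(\<lambda>n. 1 - a * q ^ n) has_prod qpoch a q"
proof -
  have "summable (\<lambda>n. norm (1 - a * q ^ n - 1))"
    using assms by (simp add: norm_mult norm_power summable_mult summable_geometric)
  then have "abs_convergent_prod (\<lambda>n. 1 - a * q ^ n)"
    by (simp add: abs_convergent_prod_conv_summable)
  then show ?thesis
    unfolding qpoch_def
    by (intro convergent_prod_has_prod abs_convergent_prod_imp_convergent_prod)
qed

lemma qpoch_LIMSEQ:
  assumes "norm q < 1"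
  shows "(\<lambda>N. \<Prod>k<N. 1 - a * q ^ k) \<longlonglongrightarrow> qpoch a q"
  using has_prod_imp_tendsto'[OF has_prod_qpoch[OF assms]] .

lemma qpoch_nonzero:
  assumes "norm q < 1" "\<And>k. a * q ^ k \<noteq> 1"
  shows "qpoch a q \<noteq> 0"
  using has_prod_eq_0_iff[OF has_prod_qpoch[OF assms(1), of a]] assms(2)
  by (auto simp: image_iff)

lemma qpoch_nonzero':
  assumes "norm q < 1" "norm a < 1"
  shows "qpoch a q \<noteq> 0"
proof (rule qpoch_nonzero[OF assms(1)])
  fix k
  have "norm (a * q ^ k) \<le> norm a * 1"
    unfolding norm_mult norm_power using assms
    by (intro mult_left_mono power_le_one) auto
  then show "a * q ^ k \<noteq> 1" using assms(2) by (metis mult.right_neutral norm_one not_less)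
qed

text \<open>Sorting the factors by the exponent modulo \<open>m\<close> is exact on partial products
  with \<open>N * m\<close> factors, and these form a subsequence. This splitting is the main device
  for turning products over residue classes into Euler products.\<close>

lemma qpoch_split:
  assumes "norm q < 1" "m > 0"
  shows "qpoch a q = (\<Prod>j<m. qpoch (a * q ^ j) (q ^ m))"
proof (rule LIMSEQ_unique)
  have qm: "norm (q ^ m) < 1"
    using assms by (simp add: norm_power power_less_one_iff)
  show "(\<lambda>N. \<Prod>j<m. \<Prod>i<N. 1 - (a * q ^ j) * (q ^ m) ^ i)
          \<longlonglongrightarrow> (\<Prod>j<m. qpoch (a * q ^ j) (q ^ m))"
    by (intro tendsto_prod qpoch_LIMSEQ qm)
  have "filterlim (\<lambda>N. N * m) sequentially sequentially"
    using assms(2) by (intro filterlim_subseq) (auto simp: strict_mono_def)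
  from filterlim_compose[OF qpoch_LIMSEQ[OF assms(1), of a] this]
  have lim: "(\<lambda>N. \<Prod>k<N * m. 1 - a * q ^ k) \<longlonglongrightarrow> qpoch a q" .
  have "(\<Prod>k<N * m. 1 - a * q ^ k) = (\<Prod>j<m. \<Prod>i<N. 1 - (a * q ^ j) * (q ^ m) ^ i)" for N
  proof -
    have "(\<Prod>k<N * m. 1 - a * q ^ k) = (\<Prod>i<N. \<Prod>k\<in>{i*m..<i*m+m}. 1 - a * q ^ k)"
      by (rule prod.nat_group[symmetric])
    also have "\<dots> = (\<Prod>i<N. \<Prod>j<m. 1 - (a * q ^ j) * (q ^ m) ^ i)"
    proof (rule prod.cong[OF refl])
      fix i
      have "(\<Prod>k\<in>{0+i*m..<m+i*m}. 1 - a * q ^ k) = (\<Prod>j\<in>{0..<m}. 1 - a * q ^ (j + i * m))"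
        by (rule prod.shift_bounds_nat_ivl)
      also have "\<dots> = (\<Prod>j<m. 1 - (a * q ^ j) * (q ^ m) ^ i)"
        by (intro prod.cong) (auto simp: power_add power_mult[symmetric] mult_ac)
      finally show "(\<Prod>k\<in>{i*m..<i*m+m}. 1 - a * q ^ k) = (\<Prod>j<m. 1 - (a * q ^ j) * (q ^ m) ^ i)"
        by (simp add: add.commute)
    qed
    also have "\<dots> = (\<Prod>j<m. \<Prod>i<N. 1 - (a * q ^ j) * (q ^ m) ^ i)"
      by (rule prod.swap)
    finally show ?thesis .
  qed
  with lim show "(\<lambda>N. \<Prod>j<m. \<Prod>i<N. 1 - (a * q ^ j) * (q ^ m) ^ i) \<longlonglongrightarrow> qpoch a q"
    by simp
qed

lemma qpoch_mult_neg:
  assumes "norm q < 1"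
  shows "qpoch a q * qpoch (- a) q = qpoch (a ^ 2) (q ^ 2)"
proof (rule LIMSEQ_unique)
  show "(\<lambda>N. (\<Prod>k<N. 1 - a * q ^ k) * (\<Prod>k<N. 1 - (-a) * q ^ k)) \<longlonglongrightarrow> qpoch a q * qpoch (- a) q"
    by (intro tendsto_mult qpoch_LIMSEQ assms)
  have "(1 - a * q ^ k) * (1 - (-a) * q ^ k) = 1 - a ^ 2 * (q ^ 2) ^ k" for k
    by (simp add: algebra_simps power2_eq_square power_mult_distrib)
  then have "(\<Prod>k<N. 1 - a * q ^ k) * (\<Prod>k<N. 1 - (-a) * q ^ k) = (\<Prod>k<N. 1 - a ^ 2 * (q ^ 2) ^ k)" for N
    by (simp only: prod.distrib[symmetric])
  moreover have "norm (q ^ 2) < 1"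
    using assms by (simp add: norm_power power_less_one_iff)
  ultimately show "(\<lambda>N. (\<Prod>k<N. 1 - a * q ^ k) * (\<Prod>k<N. 1 - (-a) * q ^ k)) \<longlonglongrightarrow> qpoch (a ^ 2) (q ^ 2)"
    using qpoch_LIMSEQ by simp
qed

text \<open>The linear factors of \<open>1 - x ^ 3\<close> are multiplied together index by index;
  \<open>euler_cube_roots\<close> rests on it.\<close>

lemma qpoch_mult_cube:
  assumes "norm q < 1" "\<omega> ^ 2 + \<omega> + 1 = 0"
  shows "qpoch a q * qpoch (\<omega> * a) q * qpoch (\<omega> ^ 2 * a) q = qpoch (a ^ 3) (q ^ 3)"
proof (rule LIMSEQ_unique)
  show "(\<lambda>N. (\<Prod>k<N. 1 - a * q ^ k) * (\<Prod>k<N. 1 - (\<omega>*a) * q ^ k) * (\<Prod>k<N. 1 - (\<omega>^2*a) * q ^ k)) \<longlonglongrightarrow>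
      qpoch a q * qpoch (\<omega> * a) q * qpoch (\<omega> ^ 2 * a) q"
    by (intro tendsto_mult qpoch_LIMSEQ assms)
  have w: "\<omega> ^ 2 = - \<omega> - 1" using assms(2) by algebra
  have "(1 - a * q ^ k) * (1 - (\<omega>*a) * q ^ k) * (1 - (\<omega>^2*a) * q ^ k) = 1 - a ^ 3 * (q ^ 3) ^ k" for k
  proof -
    have "(1 - a * x) * (1 - (\<omega>*a) * x) * (1 - (\<omega>^2*a) * x) = 1 - a ^ 3 * x ^ 3" for x
      using assms(2) by algebra
    from this[of "q ^ k"] show ?thesis
      by (simp only: power_commuting_commutes power_mult[symmetric] mult.commute[of k 3])
  qed
  then have "(\<Prod>k<N. 1 - a * q ^ k) * (\<Prod>k<N. 1 - (\<omega>*a) * q ^ k) * (\<Prod>k<N. 1 - (\<omega>^2*a) * q ^ k)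
     = (\<Prod>k<N. 1 - a ^ 3 * (q ^ 3) ^ k)" for N
    by (simp only: prod.distrib[symmetric])
  moreover have "norm (q ^ 3) < 1"
    using assms by (simp add: norm_power power_less_one_iff)
  ultimately show "(\<lambda>N. (\<Prod>k<N. 1 - a * q ^ k) * (\<Prod>k<N. 1 - (\<omega>*a) * q ^ k) * (\<Prod>k<N. 1 - (\<omega>^2*a) * q ^ k))
      \<longlonglongrightarrow> qpoch (a ^ 3) (q ^ 3)"
    using qpoch_LIMSEQ by simp
qed

section \<open>Gaussian binomial coefficients\<close>

fun gauss_binomial :: "complex \<Rightarrow> nat \<Rightarrow> nat \<Rightarrow> complex" where
  "gauss_binomial r n 0 = 1"
| "gauss_binomial r 0 (Suc k) = 0"
| "gauss_binomial r (Suc n) (Suc k) = gauss_binomial r n (Suc k) + r ^ (n - k) * gauss_binomial r n k"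

lemma gauss_binomial_eq_0: "n < k \<Longrightarrow> gauss_binomial r n k = 0"
  by (induction r n k rule: gauss_binomial.induct) auto

lemma gauss_binomial_self: "gauss_binomial r n n = 1"
  by (induction n) (auto simp: gauss_binomial_eq_0)

lemma choose_two_Suc: "Suc k choose 2 = k + (k choose 2)"
  by (simp add: numeral_2_eq_2)

text \<open>Rothe's q-binomial theorem. The recursion of \<open>gauss_binomial\<close> is the Pascal
  rule that belongs to appending the last factor \<open>1 + x * r ^ n\<close>: in
  \<open>r ^ n = r ^ (n - k) * r ^ k\<close> the second power completes \<open>k choose 2\<close> to
  \<open>Suc k choose 2\<close>. Being free of division, the recursion puts no condition on
  \<open>r\<close>; the truncated \<open>n - k\<close> is harmless because the coefficient vanishes
  for \<open>k > n\<close>.\<close>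

lemma gauss_binomial_theorem:
  "(\<Prod>i<n. 1 + x * r ^ i) = (\<Sum>k\<le>n. gauss_binomial r n k * r ^ (k choose 2) * x ^ k)"
proof (induction n)
  case (Suc n)
  let ?g = "gauss_binomial r" and ?c = "\<lambda>k. r ^ (k choose 2)"
  have "(\<Sum>k\<le>Suc n. ?g (Suc n) k * ?c k * x ^ k) = 1 + (\<Sum>k\<le>n. ?g (Suc n) (Suc k) * ?c (Suc k) * x ^ Suc k)"
    by (subst sum.atMost_Suc_shift) (simp add: numeral_2_eq_2)
  also have "(\<Sum>k\<le>n. ?g (Suc n) (Suc k) * ?c (Suc k) * x ^ Suc k) =
     (\<Sum>k\<le>n. ?g n (Suc k) * ?c (Suc k) * x ^ Suc k) + (\<Sum>k\<le>n. x * r ^ n * (?g n k * ?c k * x ^ k))"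
  proof (subst sum.distrib[symmetric], rule sum.cong[OF refl])
    fix k assume "k \<in> {..n}"
    then have "r ^ n = r ^ (n - k) * r ^ k" by (simp add: power_add[symmetric])
    then show "?g (Suc n) (Suc k) * ?c (Suc k) * x ^ Suc k =
       ?g n (Suc k) * ?c (Suc k) * x ^ Suc k + x * r ^ n * (?g n k * ?c k * x ^ k)"
      by (simp add: choose_two_Suc power_add algebra_simps)
  qed
  also have "1 + ((\<Sum>k\<le>n. ?g n (Suc k) * ?c (Suc k) * x ^ Suc k) + (\<Sum>k\<le>n. x * r ^ n * (?g n k * ?c k * x ^ k)))
     = (\<Sum>k\<le>Suc n. ?g n k * ?c k * x ^ k) + x * r ^ n * (\<Sum>k\<le>n. ?g n k * ?c k * x ^ k)"
    by (subst sum.atMost_Suc_shift[of "\<lambda>k. ?g n k * ?c k * x ^ k"]) (simp add: numeral_2_eq_2 sum_distrib_left)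
  also have "(\<Sum>k\<le>Suc n. ?g n k * ?c k * x ^ k) = (\<Sum>k\<le>n. ?g n k * ?c k * x ^ k)"
    by (simp add: gauss_binomial_eq_0)
  finally show ?case
    by (simp add: Suc.IH algebra_simps)
qed (auto simp: numeral_2_eq_2)

text \<open>The factorial formula, cleared of denominators so that roots of unity need no exception.
  With \<open>n = Suc k + d\<close> the induction step is the decomposition of
  \<open>1 - r ^ Suc k * r ^ Suc d\<close> as
  \<open>(1 - r ^ Suc d) + r ^ Suc d * (1 - r ^ Suc k)\<close>.\<close>

lemma gauss_binomial_mult:
  assumes "k \<le> n"
  shows "gauss_binomial r n k * (\<Prod>i<k. 1 - r ^ Suc i) * (\<Prod>i<n-k. 1 - r ^ Suc i) = (\<Prod>i<n. 1 - r ^ Suc i)"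
  using assms
proof (induction r n k rule: gauss_binomial.induct)
  case (3 r n k)
  let ?Q = "\<lambda>k. \<Prod>i<k. 1 - r ^ Suc i"
  show ?case
  proof (cases "k = n")
    case True
    then show ?thesis by (simp add: gauss_binomial_self gauss_binomial_eq_0 del: prod.lessThan_Suc)
  next
    case False
    then have k: "Suc k \<le> n" "k \<le> n" using 3 by auto
    obtain d where d: "n = Suc k + d" using k(1) le_Suc_ex by blast
    have 1: "gauss_binomial r n (Suc k) * ?Q (Suc k) * ?Q d = ?Q n"
      using 3 k d by auto
    have 2: "gauss_binomial r n k * ?Q k * ?Q (Suc d) = ?Q n"
      using 3 k d by auto
    have s: "?Q (Suc k) = ?Q k * (1 - r ^ Suc k)" "?Q (Suc d) = ?Q d * (1 - r ^ Suc d)"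
      "?Q (Suc n) = ?Q n * (1 - r ^ Suc k * r ^ Suc d)"
      using d by (simp_all add: power_add)
    have rec: "gauss_binomial r (Suc n) (Suc k) = gauss_binomial r n (Suc k) + r ^ Suc d * gauss_binomial r n k"
      using d by (simp del: power_Suc)
    have "gauss_binomial r (Suc n) (Suc k) * ?Q (Suc k) * ?Q (Suc d) =
      (gauss_binomial r n (Suc k) * ?Q (Suc k) * ?Q d) * (1 - r ^ Suc d)
      + r ^ Suc d * (1 - r ^ Suc k) * (gauss_binomial r n k * ?Q k * ?Q (Suc d))"
      unfolding rec s(1,2) by (simp add: algebra_simps del: prod.lessThan_Suc gauss_binomial.simps power_Suc)
    also have "\<dots> = ?Q (Suc n)"
      unfolding 1 2 unfolding s(3) by (simp add: algebra_simps del: prod.lessThan_Suc)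
    finally show ?thesis using d by (simp del: prod.lessThan_Suc gauss_binomial.simps power_Suc)
  qed
qed auto

lemma qpoch_self_LIMSEQ:
  assumes "norm r < 1"
  shows "(\<lambda>n. \<Prod>i<n. 1 - r ^ Suc i) \<longlonglongrightarrow> qpoch r r"
  using qpoch_LIMSEQ[OF assms, of r] by simp

lemma gauss_binomial_eq:
  assumes "norm r < 1" "k \<le> n"
  shows "gauss_binomial r n k = (\<Prod>i<n. 1 - r ^ Suc i) / ((\<Prod>i<k. 1 - r ^ Suc i) * (\<Prod>i<n-k. 1 - r ^ Suc i))"
proof -
  have "1 - r ^ Suc i \<noteq> 0" for i
    using power_less_one_iff[of "norm r" "Suc i"] assms(1)
    by (metis norm_ge_zero norm_one norm_power not_less order_refl right_minus_eq zero_less_Suc)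
  then have "(\<Prod>i<m. 1 - r ^ Suc i) \<noteq> 0" for m by simp
  with gauss_binomial_mult[OF assms(2), of r] show ?thesis
    by (simp add: field_simps del: power_Suc)
qed

text \<open>A bound uniform in both indices supplies the dominating series for the passage to the
  limit. It exists because the partial products have a nonzero limit, so that they and their
  inverses are bounded.\<close>

lemma gauss_binomial_bounded:
  assumes "norm r < 1"
  obtains C where "\<And>n k. norm (gauss_binomial r n k) \<le> C"
proof -
  let ?Q = "\<lambda>n. \<Prod>i<n. 1 - r ^ Suc i"
  have nz: "1 - r ^ Suc i \<noteq> 0" for i
    using power_less_one_iff[of "norm r" "Suc i"] assms(1)
    by (metis norm_ge_zero norm_one norm_power not_less order_refl right_minus_eq zero_less_Suc)
  have lim: "?Q \<longlonglongrightarrow> qpoch r r" by (rule qpoch_self_LIMSEQ[OF assms])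
  have E: "qpoch r r \<noteq> 0" by (rule qpoch_nonzero'[OF assms assms])
  have "Bseq ?Q" using lim convergentI convergent_imp_Bseq by blast
  then obtain A where A: "A > 0" "\<And>n. norm (?Q n) \<le> A" unfolding Bseq_def by auto
  have "(\<lambda>n. inverse (?Q n)) \<longlonglongrightarrow> inverse (qpoch r r)"
    by (rule tendsto_inverse[OF lim E])
  then have "Bseq (\<lambda>n. inverse (?Q n))" using convergentI convergent_imp_Bseq by blast
  then obtain B where B: "B > 0" "\<And>n. norm (inverse (?Q n)) \<le> B" unfolding Bseq_def by blast
  show thesis
  proof (rule that)
    fix n k
    show "norm (gauss_binomial r n k) \<le> A * B * B"
    proof (cases "k \<le> n")
      case True
      have "norm (gauss_binomial r n k) = norm (?Q n) * norm (inverse (?Q k)) * norm (inverse (?Q (n - k)))"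
        unfolding gauss_binomial_eq[OF assms True]
        by (simp only: norm_mult norm_divide norm_inverse divide_inverse inverse_mult_distrib mult.assoc)
      also have "\<dots> \<le> A * B * B"
        using A B by (intro mult_mono mult_nonneg_nonneg norm_ge_zero) (auto intro: less_imp_le)
      finally show ?thesis .
    qed (use A B in \<open>simp add: gauss_binomial_eq_0\<close>)
  qed
qed

text \<open>All three factorials in the quotient tend to \<open>qpoch r r\<close>, one above and two
  below; for this both the lower index and its complement must tend to infinity.\<close>

lemma gauss_binomial_LIMSEQ:
  assumes "norm r < 1" "filterlim f sequentially sequentially" "filterlim (\<lambda>n. g n - f n) sequentially sequentially"
    "eventually (\<lambda>n. f n \<le> g n) sequentially"
  shows "(\<lambda>n. gauss_binomial r (g n) (f n)) \<longlonglongrightarrow> 1 / qpoch r r"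
proof -
  let ?Q = "\<lambda>n. \<Prod>i<n. 1 - r ^ Suc i"
  have E: "qpoch r r \<noteq> 0" by (rule qpoch_nonzero'[OF assms(1,1)])
  note lim = filterlim_compose[OF qpoch_self_LIMSEQ[OF assms(1)]]
  have g: "filterlim g sequentially sequentially"
    by (rule filterlim_at_top_mono[OF assms(2,4)])
  have "(\<lambda>n. ?Q (g n) / (?Q (f n) * ?Q (g n - f n))) \<longlonglongrightarrow> qpoch r r / (qpoch r r * qpoch r r)"
    by (intro tendsto_intros lim g assms) (use E in auto)
  moreover have "eventually (\<lambda>n. ?Q (g n) / (?Q (f n) * ?Q (g n - f n)) = gauss_binomial r (g n) (f n)) sequentially"
    using assms(4) by eventually_elim (simp only: gauss_binomial_eq[OF assms(1)])
  ultimately show ?thesis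
    using E by (auto dest: Lim_transform_eventually)
qed

section \<open>From the finite to the infinite triple product\<close>

lemma summable_square_powers:
  fixes p A :: real
  assumes "0 \<le> p" "p < 1" "A \<ge> 0"
  shows "summable (\<lambda>k. p ^ (k\<^sup>2) * A ^ k)"
proof (rule summable_comparison_test_ev)
  have "(\<lambda>k. p ^ k * A) \<longlonglongrightarrow> 0 * A"
    by (intro tendsto_intros LIMSEQ_realpow_zero assms)
  then have "eventually (\<lambda>k. p ^ k * A < 1/2) sequentially"
    by (rule order_tendstoD) auto
  then show "eventually (\<lambda>k. norm (p ^ (k\<^sup>2) * A ^ k) \<le> (1/2) ^ k) sequentially"
  proof eventually_elim
    case (elim k)
    have "norm (p ^ (k\<^sup>2) * A ^ k) = (p ^ k * A) ^ k"
      using assms by (simp add: power2_eq_square power_mult power_mult_distrib)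
    also have "\<dots> \<le> (1/2) ^ k"
      by (intro power_mono) (use elim assms in auto)
    finally show ?case .
  qed
  show "summable (\<lambda>k. (1/2::real) ^ k)" by (rule summable_geometric) auto
qed

lemma has_sum_int:
  fixes f :: "int \<Rightarrow> 'a :: banach"
  assumes "summable (\<lambda>k. norm (f (int k)))" "summable (\<lambda>k. norm (f (- 1 - int k)))"
  shows "(f has_sum ((\<Sum>k. f (int k)) + (\<Sum>k. f (- 1 - int k)))) UNIV"
proof -
  have "bij_betw int UNIV {0..}"
    by (rule bij_betwI[where g = nat]) auto
  moreover have "((\<lambda>k. f (int k)) has_sum (\<Sum>k. f (int k))) UNIV"
    by (intro norm_summable_imp_has_sum assms(1) summable_sums summable_norm_cancel[OF assms(1)])
  ultimately have 1: "(f has_sum (\<Sum>k. f (int k))) {0..}"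
    by (simp add: has_sum_reindex_bij_betw[of int])
  have "bij_betw (\<lambda>k. - 1 - int k) UNIV {..<0}"
    by (rule bij_betwI[where g = "\<lambda>j. nat (- 1 - j)"]) auto
  moreover have "((\<lambda>k. f (- 1 - int k)) has_sum (\<Sum>k. f (- 1 - int k))) UNIV"
    by (intro norm_summable_imp_has_sum assms(2) summable_sums summable_norm_cancel[OF assms(2)])
  ultimately have 2: "(f has_sum (\<Sum>k. f (- 1 - int k))) {..<0}"
    by (simp add: has_sum_reindex_bij_betw[of "\<lambda>k. - 1 - int k"])
  have "{0..} \<union> {..<0} = (UNIV :: int set)" by auto
  moreover have "{0..} \<inter> {..<0} = ({} :: int set)" by auto
  ultimately show ?thesis using has_sum_Un_disjoint[OF 1 2] by simp
qed

text \<open>The q-binomial theorem with base \<open>p\<^sup>2\<close>, \<open>2 * n\<close> factors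
  and the shift \<open>x = z * p powi (1 - 2 * int n)\<close>. The shift makes the exponents run
  symmetrically through the odd numbers: the upper half of the factors is
  \<open>1 + z * p ^ (2 * i + 1)\<close>, and the lower half, read downwards, gives the factors in
  \<open>1 / z\<close> up to monomials.\<close>

lemma finite_jacobi_triple_product:
  assumes "p \<noteq> 0" "z \<noteq> 0"
  shows "(\<Prod>i<n. 1 + z * p ^ (2 * i + 1)) * (\<Prod>i<n. 1 + p ^ (2 * i + 1) / z) =
    (\<Sum>k\<le>2*n. gauss_binomial (p\<^sup>2) (2 * n) k * p powi ((int k - int n)\<^sup>2) * z powi (int k - int n))"
proof -
  define x where "x = z * p powi (1 - 2 * int n)"
  have pa: "p powi (a + b) = p powi a * p powi b" for a b
    using assms by (simp add: power_int_add)
  have hi: "1 + x * (p\<^sup>2) ^ (n + i) = 1 + z * p ^ (2 * i + 1)" for i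
  proof -
    have "p powi (1 - 2 * int n) * (p\<^sup>2) ^ (n + i) = p powi (1 - 2 * int n) * p powi int (2 * (n + i))"
      by (simp only: power_int_of_nat power_mult)
    also have "\<dots> = p powi (1 - 2 * int n + int (2 * (n + i)))"
      by (simp only: pa)
    also have "1 - 2 * int n + int (2 * (n + i)) = int (2 * i + 1)" by simp
    finally show ?thesis by (simp only: x_def mult.assoc power_int_of_nat)
  qed
  have lo: "1 + x * (p\<^sup>2) ^ (n - Suc i) = z * p powi (- int (2 * i + 1)) * (1 + p ^ (2 * i + 1) / z)" if "i < n" for i
  proof -
    have "p powi (1 - 2 * int n) * (p\<^sup>2) ^ (n - Suc i) = p powi (1 - 2 * int n) * p powi int (2 * (n - Suc i))"
      by (simp only: power_int_of_nat power_mult)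
    also have "\<dots> = p powi (1 - 2 * int n + int (2 * (n - Suc i)))"
      by (simp only: pa)
    also have "1 - 2 * int n + int (2 * (n - Suc i)) = - int (2 * i + 1)" using that by simp
    finally have "1 + x * (p\<^sup>2) ^ (n - Suc i) = 1 + z * p powi (- int (2 * i + 1))"
      by (simp only: x_def mult.assoc)
    also have "\<dots> = z * p powi (- int (2 * i + 1)) * (1 + p ^ (2 * i + 1) / z)"
      using assms by (simp only: power_int_minus power_int_of_nat) (simp add: field_simps)
    finally show ?thesis .
  qed
  have "(\<Prod>i<2*n. 1 + x * (p\<^sup>2) ^ i) = (\<Prod>i<n. 1 + x * (p\<^sup>2) ^ i) * (\<Prod>i<n. 1 + x * (p\<^sup>2) ^ (n + i))"
  proof -
    have "(\<Prod>i<2*n. 1 + x * (p\<^sup>2) ^ i) = (\<Prod>i<n. 1 + x * (p\<^sup>2) ^ i) * (\<Prod>i=0+n..<n+n. 1 + x * (p\<^sup>2) ^ i)"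
      using prod.atLeastLessThan_concat[of 0 n "n + n" "\<lambda>i. 1 + x * (p\<^sup>2) ^ i"]
      by (simp only: lessThan_atLeast0 mult_2 le0 le_add1 add_0)
    also have "(\<Prod>i=0+n..<n+n. 1 + x * (p\<^sup>2) ^ i) = (\<Prod>i<n. 1 + x * (p\<^sup>2) ^ (n + i))"
      by (subst prod.shift_bounds_nat_ivl) (simp add: add.commute lessThan_atLeast0)
    finally show ?thesis by simp
  qed
  also have "(\<Prod>i<n. 1 + x * (p\<^sup>2) ^ i) = (\<Prod>i<n. 1 + x * (p\<^sup>2) ^ (n - Suc i))"
    by (rule prod.nat_diff_reindex[symmetric])
  also have "\<dots> = (\<Prod>i<n. z * p powi (- int (2 * i + 1))) * (\<Prod>i<n. 1 + p ^ (2 * i + 1) / z)"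
    by (subst prod.distrib[symmetric], rule prod.cong) (use lo in auto)
  \<comment> \<open>The first \<open>n\<close> odd numbers add up to the square of
    \<open>n\<close>.\<close>
  also have "(\<Prod>i<n. z * p powi (- int (2 * i + 1))) = z ^ n * p powi (- (int n)\<^sup>2)"
  proof (induction n)
    case (Suc n)
    have "p powi (- (int (Suc n))\<^sup>2) = p powi (- (int n)\<^sup>2 + (- int (2 * n + 1)))"
      by (rule arg_cong[of _ _ "\<lambda>k. p powi k"]) (simp add: power2_eq_square algebra_simps)
    also have "\<dots> = p powi (- (int n)\<^sup>2) * p powi (- int (2 * n + 1))"
      by (simp only: pa)
    finally show ?case by (simp only: prod.lessThan_Suc Suc) simp
  qed simp
  finally have "(\<Prod>i<n. 1 + z * p ^ (2 * i + 1)) * (\<Prod>i<n. 1 + p ^ (2 * i + 1) / z) =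
      z powi (- int n) * p powi ((int n)\<^sup>2) * (\<Prod>i<2*n. 1 + x * (p\<^sup>2) ^ i)"
    using assms by (simp only: hi power_int_minus) (simp add: field_simps)
  also have "(\<Prod>i<2*n. 1 + x * (p\<^sup>2) ^ i) = (\<Sum>k\<le>2*n. gauss_binomial (p\<^sup>2) (2*n) k * (p\<^sup>2) ^ (k choose 2) * x ^ k)"
    by (rule gauss_binomial_theorem)
  also have "z powi (- int n) * p powi ((int n)\<^sup>2) * \<dots> = 
     (\<Sum>k\<le>2*n. gauss_binomial (p\<^sup>2) (2 * n) k * p powi ((int k - int n)\<^sup>2) * z powi (int k - int n))"
    unfolding sum_distrib_left
  proof (rule sum.cong[OF refl])
    fix k
    have ch: "2 * int (k choose 2) = int k * (int k - 1)"
      by (induction k) (simp_all add: choose_two_Suc algebra_simps numeral_2_eq_2)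
    have zz: "z powi (int k - int n) = z powi (- int n) * z ^ k"
      using assms power_int_add[of z "- int n" "int k"] by simp
    \<comment> \<open>Completing the square:
      \<open>n\<^sup>2 + k * (k - 1) + (1 - 2 * n) * k = (k - n)\<^sup>2\<close>.\<close>
    have "p powi ((int k - int n)\<^sup>2) = p powi ((int n)\<^sup>2 + (2 * int (k choose 2) + (1 - 2 * int n) * int k))"
      by (rule arg_cong[of _ _ "\<lambda>k. p powi k"]) (simp add: ch power2_eq_square algebra_simps)
    also have "\<dots> = p powi ((int n)\<^sup>2) * (p powi (2 * int (k choose 2)) * p powi ((1 - 2 * int n) * int k))"
      by (simp only: pa)
    also have "p powi (2 * int (k choose 2)) = (p\<^sup>2) ^ (k choose 2)"
      by (simp add: power_int_mult)
    also have "p powi ((1 - 2 * int n) * int k) = (p powi (1 - 2 * int n)) ^ k"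
      by (simp only: power_int_mult power_int_of_nat)
    finally show "z powi (- int n) * p powi ((int n)\<^sup>2) * (gauss_binomial (p\<^sup>2) (2*n) k * (p\<^sup>2) ^ (k choose 2) * x ^ k)
      = gauss_binomial (p\<^sup>2) (2 * n) k * p powi ((int k - int n)\<^sup>2) * z powi (int k - int n)"
      by (simp only: zz x_def power_mult_distrib mult_ac)
  qed
  finally show ?thesis .
qed

lemma jacobi_series_abs_summable:
  fixes p z :: complex
  assumes "norm p < 1" "z \<noteq> 0"
  shows "summable (\<lambda>k. norm (p powi ((int k)\<^sup>2) * z powi (int k)))"
    and "summable (\<lambda>k. norm (p powi ((- 1 - int k)\<^sup>2) * z powi (- 1 - int k)))"
proof -
  have nat2: "p powi ((int k)\<^sup>2) = p ^ (k\<^sup>2)" for k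
    using power_int_of_nat[of p "k\<^sup>2"] by simp
  have neg: "(- 1 - int k)\<^sup>2 = (int (Suc k))\<^sup>2" for k by (simp add: power2_eq_square algebra_simps)
  have neg': "z powi (- 1 - int k) = inverse z ^ Suc k" for k
  proof -
    have "- 1 - int k = - int (Suc k)" by simp
    then show ?thesis by (simp only: power_int_minus power_int_of_nat power_inverse)
  qed
  show "summable (\<lambda>k. norm (p powi ((int k)\<^sup>2) * z powi (int k)))"
    using summable_square_powers[of "norm p" "norm z"] assms by (simp add: nat2 norm_mult norm_power)
  have "summable (\<lambda>k. norm p ^ ((Suc k)\<^sup>2) * norm (inverse z) ^ Suc k)"
    using summable_square_powers[of "norm p" "norm (inverse z)"] assms
    by (subst summable_Suc_iff) auto
  then show "summable (\<lambda>k. norm (p powi ((- 1 - int k)\<^sup>2) * z powi (- 1 - int k)))"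
    by (simp only: neg neg' nat2 norm_mult norm_power)
qed

text \<open>Tannery's theorem applied to the finite form: each coefficient tends to
  \<open>1 / qpoch (p\<^sup>2) (p\<^sup>2)\<close> and is bounded by \<open>C\<close>, so
  \<open>C * norm (h j)\<close> dominates. The nonnegative and the negative integers are treated as
  two separate series.\<close>

theorem jacobi_triple_product:
  fixes p z :: complex
  assumes p: "norm p < 1" "p \<noteq> 0" and z: "z \<noteq> 0"
  shows "((\<lambda>n::int. p powi (n\<^sup>2) * z powi n) has_sum
    (qpoch (p\<^sup>2) (p\<^sup>2) * qpoch (- z * p) (p\<^sup>2) * qpoch (- p / z) (p\<^sup>2))) UNIV"
proof -
  define h where "h j = p powi (j\<^sup>2) * z powi j" for j :: int
  \<comment> \<open>The cut-off below \<open>- int n\<close> matters: \<open>nat\<close> would send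
    such arguments to index 0, where the coefficient is 1. Above \<open>int n\<close> the
    coefficient vanishes by itself.\<close>
  define g where "g n j = (if j \<ge> - int n then gauss_binomial (p\<^sup>2) (2 * n) (nat (int n + j)) else 0)" for n j
  have r: "norm (p\<^sup>2) < 1" using p by (simp add: norm_power power_less_one_iff)
  obtain C where C: "\<And>n k. norm (gauss_binomial (p\<^sup>2) n k) \<le> C"
    using gauss_binomial_bounded[OF r] by blast
  have C0: "C \<ge> 0" using order_trans[OF norm_ge_zero C] by blast
  have gC: "norm (g n j) \<le> C" for n j using C C0 by (simp add: g_def)
  have glim: "(\<lambda>n. g n j) \<longlonglongrightarrow> 1 / qpoch (p\<^sup>2) (p\<^sup>2)" for j
  proof (rule Lim_transform_eventually)
    show "(\<lambda>n. gauss_binomial (p\<^sup>2) (2 * n) (nat (int n + j))) \<longlonglongrightarrow> 1 / qpoch (p\<^sup>2) (p\<^sup>2)"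
    proof (rule gauss_binomial_LIMSEQ[OF r])
      show "filterlim (\<lambda>n. nat (int n + j)) at_top sequentially"
        unfolding filterlim_at_top
      proof
        fix Z
        show "\<forall>\<^sub>F x in sequentially. Z \<le> nat (int x + j)"
          using eventually_ge_at_top[of "Z + nat \<bar>j\<bar>"] by eventually_elim linarith
      qed
      show "filterlim (\<lambda>n. 2 * n - nat (int n + j)) at_top sequentially"
        unfolding filterlim_at_top
      proof
        fix Z
        show "\<forall>\<^sub>F x in sequentially. Z \<le> 2 * x - nat (int x + j)"
          using eventually_ge_at_top[of "Z + nat \<bar>j\<bar>"] by eventually_elim linarith
      qed
      show "\<forall>\<^sub>F n in sequentially. nat (int n + j) \<le> 2 * n"
        using eventually_ge_at_top[of "nat \<bar>j\<bar>"] by eventually_elim linarith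
    qed
    show "\<forall>\<^sub>F n in sequentially. gauss_binomial (p\<^sup>2) (2 * n) (nat (int n + j)) = g n j"
      using eventually_ge_at_top[of "nat \<bar>j\<bar>"] by eventually_elim (auto simp: g_def)
  qed
  note sm = jacobi_series_abs_summable[OF p(1) z, folded h_def]
  have lim: "(\<lambda>n. \<Sum>k. g n (u k) * h (u k)) \<longlonglongrightarrow> (\<Sum>k. 1 / qpoch (p\<^sup>2) (p\<^sup>2) * h (u k))"
    if "summable (\<lambda>k. norm (h (u k)))" for u
  proof -
    have "(\<lambda>n. g n (u k) * h (u k)) \<longlonglongrightarrow> 1 / qpoch (p\<^sup>2) (p\<^sup>2) * h (u k)" for k
      by (intro tendsto_intros glim)
    moreover have "eventually (\<lambda>(k,n). norm (g n (u k) * h (u k)) \<le> C * norm (h (u k))) (at_top \<times>\<^sub>F at_top)"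
      by (rule always_eventually) (auto simp: norm_mult intro!: mult_right_mono gC)
    moreover have "summable (\<lambda>k. C * norm (h (u k)))" by (intro summable_mult that)
    ultimately show ?thesis
      using tannerys_theorem[of "\<lambda>k n. g n (u k) * h (u k)" "\<lambda>k. 1 / qpoch (p\<^sup>2) (p\<^sup>2) * h (u k)" sequentially "\<lambda>k. C * norm (h (u k))"]
      by simp
  qed
  have fin: "(\<Prod>i<n. 1 + z * p ^ (2 * i + 1)) * (\<Prod>i<n. 1 + p ^ (2 * i + 1) / z) =
     (\<Sum>k. g n (int k) * h (int k)) + (\<Sum>k. g n (- 1 - int k) * h (- 1 - int k))" for n
  proof -
    let ?t = "\<lambda>k. gauss_binomial (p\<^sup>2) (2 * n) k * h (int k - int n)"
    have "(\<Prod>i<n. 1 + z * p ^ (2 * i + 1)) * (\<Prod>i<n. 1 + p ^ (2 * i + 1) / z) = (\<Sum>k\<le>2*n. ?t k)"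
      unfolding finite_jacobi_triple_product[OF p(2) z] h_def by (simp only: mult.assoc)
    also have "\<dots> = (\<Sum>k<n. ?t k) + (\<Sum>k=0+n..<Suc n+n. ?t k)"
    proof -
      have "{..2*n} = {0..<Suc n + n}" by auto
      then show ?thesis
        using sum.atLeastLessThan_concat[of 0 n "Suc n + n" ?t] by (simp add: lessThan_atLeast0)
    qed
    also have "(\<Sum>k<n. ?t k) = (\<Sum>k<n. ?t (n - Suc k))"
      by (rule sum.nat_diff_reindex[symmetric])
    also have "\<dots> = (\<Sum>k<n. g n (- 1 - int k) * h (- 1 - int k))"
    proof (rule sum.cong[OF refl])
      fix k assume "k \<in> {..<n}"
      then have "int (n - Suc k) - int n = - 1 - int k" "n - Suc k = nat (int n + (- 1 - int k))" "- 1 - int k \<ge> - int n" by auto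
      then show "?t (n - Suc k) = g n (- 1 - int k) * h (- 1 - int k)"
        by (simp add: g_def)
    qed
    also have "\<dots> = (\<Sum>k. g n (- 1 - int k) * h (- 1 - int k))"
      by (rule suminf_finite[symmetric]) (auto simp: g_def)
    also have "(\<Sum>k=0+n..<Suc n+n. ?t k) = (\<Sum>k=0..<Suc n. g n (int k) * h (int k))"
      by (subst sum.shift_bounds_nat_ivl, rule sum.cong) (auto simp: g_def nat_add_distrib add.commute)
    also have "\<dots> = (\<Sum>k. g n (int k) * h (int k))"
      by (rule suminf_finite[symmetric]) (auto simp: g_def nat_add_distrib gauss_binomial_eq_0)
    finally show ?thesis by (simp only: add.commute)
  qed
  have "(\<lambda>n. \<Prod>i<n. 1 - (- z * p) * (p\<^sup>2) ^ i) \<longlonglongrightarrow> qpoch (- z * p) (p\<^sup>2)"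
    by (rule qpoch_LIMSEQ[OF r])
  then have l1: "(\<lambda>n. \<Prod>i<n. 1 + z * p ^ (2 * i + 1)) \<longlonglongrightarrow> qpoch (- z * p) (p\<^sup>2)"
    by (simp add: power_mult[symmetric] mult.assoc)
  have "(\<lambda>n. \<Prod>i<n. 1 - (- p / z) * (p\<^sup>2) ^ i) \<longlonglongrightarrow> qpoch (- p / z) (p\<^sup>2)"
    by (rule qpoch_LIMSEQ[OF r])
  then have l2: "(\<lambda>n. \<Prod>i<n. 1 + p ^ (2 * i + 1) / z) \<longlonglongrightarrow> qpoch (- p / z) (p\<^sup>2)"
    by (simp add: power_mult[symmetric])
  have "qpoch (- z * p) (p\<^sup>2) * qpoch (- p / z) (p\<^sup>2) =
     (\<Sum>k. 1 / qpoch (p\<^sup>2) (p\<^sup>2) * h (int k)) + (\<Sum>k. 1 / qpoch (p\<^sup>2) (p\<^sup>2) * h (- 1 - int k))"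
    using tendsto_add[OF lim[OF sm(1)] lim[OF sm(2)]] tendsto_mult[OF l1 l2]
    unfolding fin by (rule LIMSEQ_unique[rotated])
  also have "\<dots> = ((\<Sum>k. h (int k)) + (\<Sum>k. h (- 1 - int k))) / qpoch (p\<^sup>2) (p\<^sup>2)"
    using summable_norm_cancel[OF sm(1)] summable_norm_cancel[OF sm(2)]
    by (simp add: suminf_divide add_divide_distrib)
  finally have eq: "(\<Sum>k. h (int k)) + (\<Sum>k. h (- 1 - int k)) = 
      qpoch (p\<^sup>2) (p\<^sup>2) * qpoch (- z * p) (p\<^sup>2) * qpoch (- p / z) (p\<^sup>2)"
    using qpoch_nonzero'[OF r r] by (simp add: field_simps)
  show ?thesis
    using has_sum_int[OF sm, unfolded eq] unfolding h_def .
qed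

subsection \<open>Theta series over residue classes\<close>

definition theta :: "complex \<Rightarrow> int set \<Rightarrow> complex" where
  "theta w A = (\<Sum>\<^sub>\<infinity>n\<in>A. w powi (n\<^sup>2))"

text \<open>The class is named by its reduced representative: for \<open>m > 0\<close> it is empty
  unless \<open>a < m\<close>, so later index maps are written with \<open>mod\<close>. The set of
  all integers is \<open>residue_class 0 1\<close>.\<close>

definition residue_class :: "nat \<Rightarrow> nat \<Rightarrow> int set" where
  "residue_class a m = {n. n mod int m = int a}"

lemma theta_abs_summable:
  fixes w :: complex
  assumes "norm w < 1"
  shows "(\<lambda>n. norm (w powi (n\<^sup>2))) summable_on A"
proof -
  have "(\<lambda>n. norm (w powi (n\<^sup>2))) summable_on UNIV"
    by (rule has_sum_imp_summable[OF has_sum_int])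
       (use jacobi_series_abs_summable[OF assms, of 1] in auto)
  then show ?thesis
    using summable_on_subset_banach by blast
qed

lemma theta_summable:
  fixes w :: complex
  assumes "norm w < 1"
  shows "(\<lambda>n. w powi (n\<^sup>2)) summable_on A"
  using theta_abs_summable[OF assms] by (rule abs_summable_summable)

lemma has_sum_theta:
  assumes "norm w < 1"
  shows "((\<lambda>n. w powi (n\<^sup>2)) has_sum theta w A) A"
  unfolding theta_def using theta_summable[OF assms] by (rule has_sum_infsum)

lemma theta_Un:
  assumes "norm w < 1" "A \<inter> B = {}"
  shows "theta w (A \<union> B) = theta w A + theta w B"
  unfolding theta_def using assms theta_summable[OF assms(1)] by (intro infsum_Un_disjoint)

lemma theta_uminus: "theta w (uminus ` A) = theta w A"
  unfolding theta_def by (subst infsum_reindex) (auto simp: o_def)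

lemma theta_scale: "theta w ((*) (int c) ` A) = theta (w ^ (c\<^sup>2)) A" if "c > 0"
proof -
  have "w powi ((int c * n)\<^sup>2) = (w ^ c\<^sup>2) powi (n\<^sup>2)" for n
    by (simp add: power_mult_distrib power_int_mult power_int_of_nat[symmetric])
  then show ?thesis
    unfolding theta_def using that by (subst infsum_reindex) (auto simp: o_def inj_on_def)
qed

text \<open>Since \<open>(m * n + a)\<^sup>2 = m\<^sup>2 * n\<^sup>2 + 2 * a * m * n +
  a\<^sup>2\<close>, this is the triple product at \<open>p = w ^ (m\<^sup>2)\<close> and
  \<open>z = w ^ (2 * a * m)\<close>. The bound \<open>2 * a \<le> m\<close> turns
  \<open>p / z\<close> into a power with a natural exponent.\<close>

lemma theta_jacobi:
  assumes w: "norm w < 1" "w \<noteq> 0" and a: "2 * a \<le> m" "m > 0"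
  shows "theta w (residue_class a m) = w ^ (a\<^sup>2) * qpoch (w ^ (2 * m\<^sup>2)) (w ^ (2 * m\<^sup>2)) *
     qpoch (- (w ^ (m\<^sup>2 + 2 * a * m))) (w ^ (2 * m\<^sup>2)) * qpoch (- (w ^ (m\<^sup>2 - 2 * a * m))) (w ^ (2 * m\<^sup>2))"
proof -
  define p where "p = w ^ (m\<^sup>2)"
  define z where "z = w ^ (2 * a * m)"
  have p: "norm p < 1" "p \<noteq> 0" and z: "z \<noteq> 0"
    using w a unfolding p_def z_def by (auto simp: norm_power power_less_one_iff)
  have le: "2 * a * m \<le> m\<^sup>2" using a by (simp add: power2_eq_square)
  have p2: "p\<^sup>2 = w ^ (2 * m\<^sup>2)" by (simp add: p_def power_mult[symmetric] mult.commute)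
  have zp: "- z * p = - (w ^ (m\<^sup>2 + 2 * a * m))" by (simp add: p_def z_def power_add)
  have pz: "- p / z = - (w ^ (m\<^sup>2 - 2 * a * m))"
    using le w by (simp add: p_def z_def power_diff)
  let ?P = "qpoch (w ^ (2 * m\<^sup>2)) (w ^ (2 * m\<^sup>2)) *
     qpoch (- (w ^ (m\<^sup>2 + 2 * a * m))) (w ^ (2 * m\<^sup>2)) * qpoch (- (w ^ (m\<^sup>2 - 2 * a * m))) (w ^ (2 * m\<^sup>2))"
  have "((\<lambda>n::int. p powi (n\<^sup>2) * z powi n) has_sum ?P) UNIV"
    using jacobi_triple_product[OF p z] unfolding p2 zp pz .
  then have "((\<lambda>n::int. w ^ (a\<^sup>2) * (p powi (n\<^sup>2) * z powi n)) has_sum (w ^ (a\<^sup>2) * ?P)) UNIV"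
    by (rule has_sum_cmult_right)
  moreover have "w ^ (a\<^sup>2) * (p powi (n\<^sup>2) * z powi n) = w powi ((int m * n + int a)\<^sup>2)" for n
  proof -
    have "p powi (n\<^sup>2) = w powi (int (m\<^sup>2) * n\<^sup>2)" "z powi n = w powi (int (2 * a * m) * n)"
      "w ^ (a\<^sup>2) = w powi int (a\<^sup>2)"
      by (simp_all only: p_def z_def power_int_mult power_int_of_nat)
    then have "w ^ (a\<^sup>2) * (p powi (n\<^sup>2) * z powi n) = w powi (int (a\<^sup>2) + (int (m\<^sup>2) * n\<^sup>2 + int (2 * a * m) * n))"
      using w by (simp add: power_int_add)
    also have "int (a\<^sup>2) + (int (m\<^sup>2) * n\<^sup>2 + int (2 * a * m) * n) = (int m * n + int a)\<^sup>2"
      by (simp add: power2_eq_square algebra_simps)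
    finally show ?thesis .
  qed
  moreover have "bij_betw (\<lambda>n. int m * n + int a) UNIV (residue_class a m)"
    using a by (intro bij_betwI[where g = "\<lambda>k. k div int m"]) (auto simp: residue_class_def, metis mult_div_mod_eq)
  ultimately have "((\<lambda>n. w powi (n\<^sup>2)) has_sum (w ^ (a\<^sup>2) * ?P)) (residue_class a m)"
    by (simp add: has_sum_reindex_bij_betw[of _ UNIV "residue_class a m" "\<lambda>n. w powi (n\<^sup>2)", symmetric])
  then show ?thesis
    unfolding theta_def by (simp only: infsumI mult.assoc)
qed

text \<open>The sums of two theta series over the cosets of a sublattice: \<open>g\<close> is multiplication by an
  element of the quadratic order whose norm form appears in the exponents.\<close>

lemma theta_lattice:
  assumes w: "norm w < 1" "w \<noteq> 0" and pos: "k > 0" "l > 0" "m > 0" and C: "finite C"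
    and disj: "\<And>c d. c \<in> C \<Longrightarrow> d \<in> C \<Longrightarrow> c \<noteq> d \<Longrightarrow> P c \<inter> P d = {}"
    and bij: "bij_betw g (A \<times> B) (\<Union>c\<in>C. P c \<times> Q c)"
    and exps: "\<And>x y. x \<in> A \<Longrightarrow> y \<in> B \<Longrightarrow>
      int k * x\<^sup>2 + int l * y\<^sup>2 = (fst (g (x, y)))\<^sup>2 + int m * (snd (g (x, y)))\<^sup>2"
  shows "theta (w ^ k) A * theta (w ^ l) B = (\<Sum>c\<in>C. theta w (P c) * theta (w ^ m) (Q c))"
proof -
  \<comment> \<open>Absolute summability makes the product of two theta series a single sum over
    pairs, which can then be reindexed along \<open>g\<close>.\<close>
  have prod: "((\<lambda>(x, y). u powi (x\<^sup>2) * v powi (y\<^sup>2)) has_sum (theta u A * theta v B)) (A \<times> B)"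
    if "norm u < 1" "norm v < 1" for u v A B
  proof -
    have a: "Infinite_Set_Sum.abs_summable_on (\<lambda>n. u powi (n\<^sup>2)) A" "Infinite_Set_Sum.abs_summable_on (\<lambda>n. v powi (n\<^sup>2)) B"
      using theta_abs_summable that by (simp_all add: abs_summable_equivalent[symmetric])
    have "Infinite_Set_Sum.abs_summable_on (\<lambda>(x, y). u powi (x\<^sup>2) * v powi (y\<^sup>2)) (A \<times> B)"
      by (rule abs_summable_on_product) (use a in auto)
    then have s: "(\<lambda>(x, y). u powi (x\<^sup>2) * v powi (y\<^sup>2)) summable_on A \<times> B"
      using abs_summable_equivalent abs_summable_summable by blast
    have "((\<lambda>y. case (x, y) of (x, y) \<Rightarrow> u powi (x\<^sup>2) * v powi (y\<^sup>2)) has_sum (u powi (x\<^sup>2) * theta v B)) B" for x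
      using has_sum_cmult_right[OF has_sum_theta[OF that(2)]] by simp
    then show ?thesis
      by (rule has_sum_SigmaI[OF _ _ s]) (rule has_sum_cmult_left[OF has_sum_theta[OF that(1)]])
  qed
  have wp: "norm (w ^ j) < 1" if "j > 0" for j using w that by (simp add: norm_power power_less_one_iff)
  let ?f = "\<lambda>(x, y). w powi (x\<^sup>2) * (w ^ m) powi (y\<^sup>2)"
  have "(?f has_sum (\<Sum>c\<in>C. theta w (P c) * theta (w ^ m) (Q c))) (\<Union>c\<in>C. P c \<times> Q c)"
    by (rule sum_has_sum[OF C]) (use prod[OF w(1) wp[OF pos(3)]] disj in \<open>auto, blast\<close>)
  then have "((\<lambda>s. ?f (g s)) has_sum (\<Sum>c\<in>C. theta w (P c) * theta (w ^ m) (Q c))) (A \<times> B)"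
    by (simp only: has_sum_reindex_bij_betw[OF bij])
  moreover have "?f (g s) = (\<lambda>(x, y). (w ^ k) powi (x\<^sup>2) * (w ^ l) powi (y\<^sup>2)) s" if sAB: "s \<in> A \<times> B" for s
  proof -
    obtain x y where s: "s = (x, y)" "x \<in> A" "y \<in> B" using sAB by blast
    obtain x' y' where g: "g (x, y) = (x', y')" by fastforce
    have e: "(w ^ j) powi i = w powi (int j * i)" for j i by (simp only: power_int_mult power_int_of_nat)
    have "?f (g s) = w powi (x'\<^sup>2 + int m * y'\<^sup>2)"
      using w by (simp add: s g e power_int_add)
    also have "x'\<^sup>2 + int m * y'\<^sup>2 = int k * x\<^sup>2 + int l * y\<^sup>2"
      using exps[OF s(2,3)] by (simp add: g)
    also have "w powi \<dots> = (w ^ k) powi (x\<^sup>2) * (w ^ l) powi (y\<^sup>2)"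
      using w by (simp add: e power_int_add)
    finally show ?thesis by (simp add: s)
  qed
  ultimately have "((\<lambda>(x, y). (w ^ k) powi (x\<^sup>2) * (w ^ l) powi (y\<^sup>2)) has_sum 
      (\<Sum>c\<in>C. theta w (P c) * theta (w ^ m) (Q c))) (A \<times> B)"
    by (simp cong: has_sum_cong)
  with prod[OF wp[OF pos(1)] wp[OF pos(2)]] show ?thesis
    using has_sum_unique by blast
qed

subsection \<open>Euler products\<close>

abbreviation euler :: "complex \<Rightarrow> complex" where
  "euler q \<equiv> qpoch q q"

lemma euler_nonzero: "norm q < 1 \<Longrightarrow> euler q \<noteq> 0"
  by (rule qpoch_nonzero')

lemma norm_power_less_one:
  fixes q :: complex
  assumes "norm q < 1" "n > 0"
  shows "norm (q ^ n) < 1"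
  using assms by (simp add: norm_power power_less_one_iff)

lemma euler_power_nonzero: "norm q < 1 \<Longrightarrow> n > 0 \<Longrightarrow> euler (q ^ n) \<noteq> 0"
  by (rule euler_nonzero[OF norm_power_less_one])

lemma qpoch_odd: "norm q < 1 \<Longrightarrow> qpoch q (q\<^sup>2) * euler (q\<^sup>2) = euler q"
  using qpoch_split[of q 2 q] by (simp add: numeral_2_eq_2)

lemma qpoch_uminus: "norm q < 1 \<Longrightarrow> qpoch (- q) q = euler (q\<^sup>2) / euler q"
  using qpoch_mult_neg[of q q] euler_nonzero[of q] by (simp add: field_simps)

text \<open>From \<open>qpoch q (q\<^sup>2) * qpoch (- q) (q\<^sup>2) = qpoch (q\<^sup>2) (q ^
  4)\<close>, where \<open>qpoch_odd\<close> evaluates the first factor and the right-hand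
  side.\<close>

lemma qpoch_uminus_odd:
  assumes "norm q < 1"
  shows "qpoch (- q) (q\<^sup>2) = (euler (q ^ 2))\<^sup>2 / (euler q * euler (q ^ 4))"
proof -
  have q2: "norm (q\<^sup>2) < 1" by (rule norm_power_less_one[OF assms]) simp
  have "qpoch q (q\<^sup>2) * qpoch (- q) (q\<^sup>2) = qpoch (q\<^sup>2) (q ^ 4)"
    using qpoch_mult_neg[OF q2, of q] by (simp add: power_mult[symmetric])
  moreover have "qpoch (q\<^sup>2) (q ^ 4) * euler (q ^ 4) = euler (q\<^sup>2)"
    using qpoch_odd[OF q2] by (simp add: power_mult[symmetric])
  moreover note qpoch_odd[OF assms]
  moreover have "euler q \<noteq> 0" "euler (q ^ 2) \<noteq> 0" "euler (q ^ 4) \<noteq> 0"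
    using euler_nonzero[OF assms] euler_power_nonzero[OF assms] by auto
  moreover have "y * (a * c) = b\<^sup>2" if "x * y = z" "z * c = b" "x * b = a" for a b c x y z :: complex
    using that by (auto simp: power2_eq_square mult_ac)
  ultimately have "qpoch (- q) (q\<^sup>2) * (euler q * euler (q ^ 4)) = (euler (q ^ 2))\<^sup>2"
    by blast
  then show ?thesis using \<open>euler q \<noteq> 0\<close> \<open>euler (q ^ 4) \<noteq> 0\<close> by (simp add: field_simps)
qed

lemma qpoch_minus_one:
  assumes "norm q < 1"
  shows "qpoch (- 1) q = 2 * qpoch (- q) q"
proof (rule LIMSEQ_unique)
  show "(\<lambda>n. \<Prod>k<Suc n. 1 - (- 1) * q ^ k) \<longlonglongrightarrow> qpoch (- 1) q"
    by (rule LIMSEQ_Suc[OF qpoch_LIMSEQ[OF assms]])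
  have "(\<Prod>k<Suc n. 1 - (- 1) * q ^ k) = 2 * (\<Prod>k<n. 1 - (- q) * q ^ k)" for n
    by (subst prod.lessThan_Suc_shift) simp
  then show "(\<lambda>n. \<Prod>k<Suc n. 1 - (- 1) * q ^ k) \<longlonglongrightarrow> 2 * qpoch (- q) q"
    using tendsto_mult[OF tendsto_const qpoch_LIMSEQ[OF assms, of "- q"], of 2] by simp
qed

text \<open>Ramanujan's theta function. Treating the integers as a residue class lets the product
  formula and the scaling of classes apply to it directly.\<close>

definition phi :: "complex \<Rightarrow> complex" where
  "phi q = theta q (residue_class 0 1)"

lemma phi_product:
  assumes "norm q < 1" "q \<noteq> 0"
  shows "phi q = euler (q\<^sup>2) * (qpoch (- q) (q\<^sup>2))\<^sup>2"
  using theta_jacobi[OF assms, of 0 1] by (simp add: phi_def power2_eq_square)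

lemma phi_euler:
  assumes "norm q < 1" "q \<noteq> 0"
  shows "phi q = (euler (q ^ 2)) ^ 5 / ((euler q)\<^sup>2 * (euler (q ^ 4))\<^sup>2)"
proof -
  have "b * (b\<^sup>2 / (a * c))\<^sup>2 = b ^ 5 / (a\<^sup>2 * c\<^sup>2)" for a b c :: complex
    by (simp add: power_divide power_mult_distrib) (simp add: eval_nat_numeral)
  then show ?thesis
    by (simp only: phi_product[OF assms] qpoch_uminus_odd[OF assms(1)])
qed

lemma theta_odd_euler:
  assumes "norm w < 1" "w \<noteq> 0"
  shows "theta w (residue_class 1 2) = 2 * w * ((euler (w ^ 16))\<^sup>2 / euler (w ^ 8))"
proof -
  have w8: "norm (w ^ 8) < 1" using norm_power_less_one[OF assms(1)] by simp
  have "theta w (residue_class 1 2) = w * euler (w ^ 8) * qpoch (- (w ^ 8)) (w ^ 8) * qpoch (- 1) (w ^ 8)"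
    using theta_jacobi[OF assms, of 1 2] by simp
  also have "\<dots> = w * euler (w ^ 8) * (euler (w ^ 16) / euler (w ^ 8)) * (2 * (euler (w ^ 16) / euler (w ^ 8)))"
    by (simp add: qpoch_minus_one[OF w8] qpoch_uminus[OF w8] power_mult[symmetric])
  also have "\<dots> = 2 * w * ((euler (w ^ 16))\<^sup>2 / euler (w ^ 8))"
    using euler_nonzero[OF w8] by (simp add: field_simps power2_eq_square)
  finally show ?thesis .
qed

lemma triangular_ge: "(n::nat) \<le> n * (n + 1) div 2"
  by (cases n) auto

lemma psi_summable:
  fixes q :: complex
  assumes "norm q < 1"
  shows "summable (\<lambda>n. norm (q ^ (n * (n + 1) div 2)))"
proof (rule summable_comparison_test')
  show "summable (\<lambda>n. norm q ^ n)" using assms by (simp add: summable_geometric)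
  fix n
  show "norm (norm (q ^ (n * (n + 1) div 2))) \<le> norm q ^ n"
    using assms triangular_ge[of n] by (simp add: norm_power power_decreasing)
qed

text \<open>Eight times a triangular number plus one is an odd square. Every positive odd number
  occurs exactly once in this way, and the negative ones double the sum.\<close>

lemma theta_odd_psi:
  assumes "norm w < 1" "w \<noteq> 0"
  shows "theta w (residue_class 1 2) = 2 * w * psi (w ^ 8)"
proof -
  define A where "A = {n::int. n > 0 \<and> odd n}"
  have w8: "norm (w ^ 8) < 1" using norm_power_less_one[OF assms(1)] by simp
  have "((\<lambda>n. (w ^ 8) ^ (n * (n + 1) div 2)) has_sum psi (w ^ 8)) UNIV"
    unfolding psi_def
    by (rule norm_summable_imp_has_sum[OF psi_summable[OF w8] summable_sums[OF summable_norm_cancel[OF psi_summable[OF w8]]]])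
  then have "((\<lambda>n. w * (w ^ 8) ^ (n * (n + 1) div 2)) has_sum (w * psi (w ^ 8))) UNIV"
    by (rule has_sum_cmult_right)
  moreover have "w * (w ^ 8) ^ (n * (n + 1) div 2) = w powi ((2 * int n + 1)\<^sup>2)" for n
  proof -
    have e: "8 * (n * (n + 1) div 2) + 1 = (2 * n + 1)\<^sup>2"
    proof -
      have "2 * (n * (n + 1) div 2) = n * (n + 1)" by simp
      moreover have "(2 * n + 1)\<^sup>2 = 4 * (n * (n + 1)) + 1" by (simp add: power2_eq_square algebra_simps)
      ultimately show ?thesis by linarith
    qed
    have "w * (w ^ 8) ^ (n * (n + 1) div 2) = w ^ (8 * (n * (n + 1) div 2) + 1)"
      by (simp add: power_mult)
    also have "\<dots> = w powi (int ((2 * n + 1)\<^sup>2))" by (simp only: e power_int_of_nat)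
    finally show ?thesis by (simp add: add.commute)
  qed
  moreover have "bij_betw (\<lambda>n. 2 * int n + 1) UNIV A"
    by (rule bij_betwI[where g = "\<lambda>k. nat (k div 2)"]) (auto simp: A_def elim!: oddE)
  ultimately have "((\<lambda>n. w powi (n\<^sup>2)) has_sum (w * psi (w ^ 8))) A"
    by (simp add: has_sum_reindex_bij_betw[of _ UNIV A "\<lambda>n. w powi (n\<^sup>2)", symmetric])
  then have "theta w A = w * psi (w ^ 8)" by (simp add: theta_def infsumI)
  moreover have "residue_class 1 2 = A \<union> uminus ` A"
  proof (rule set_eqI)
    fix n :: int
    have "n \<in> uminus ` A \<longleftrightarrow> - n \<in> A" by (auto simp: image_iff intro: bexI[of _ "- n"])
    moreover have "n mod 2 = 1 \<longleftrightarrow> odd n" by presburger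
    moreover have "odd n \<Longrightarrow> n \<noteq> 0" by auto
    ultimately show "n \<in> residue_class 1 2 \<longleftrightarrow> n \<in> A \<union> uminus ` A"
      by (auto simp: A_def residue_class_def)
  qed
  moreover have "A \<inter> uminus ` A = {}" by (auto simp: A_def)
  ultimately show ?thesis
    by (simp add: theta_Un[OF assms(1)] theta_uminus)
qed

text \<open>The substitute for fractional powers of \<open>q\<close>; a nonzero root is required
  because powers of \<open>w\<close> are cancelled in the end.\<close>

lemma complex_root:
  fixes q :: complex
  assumes "norm q < 1" "q \<noteq> 0" "n > 0"
  obtains w where "w ^ n = q" "norm w < 1" "w \<noteq> 0"
proof -
  obtain w where w: "q = w ^ n" using exists_complex_root[of n q] assms by auto
  moreover have "norm w < 1"
    using assms w by (simp add: norm_power power_less_one_iff)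
  ultimately show thesis using that assms by auto
qed

lemma psi_0: "psi 0 = 1"
proof -
  have "psi 0 = (\<Sum>n. if n = 0 then 1 else 0)"
    unfolding psi_def
  proof (rule suminf_cong)
    fix n :: nat
    show "(0::complex) ^ (n * (n + 1) div 2) = (if n = 0 then 1 else 0)"
      using triangular_ge[of n] by (auto simp: power_0_left)
  qed
  also have "\<dots> = 1" by (subst suminf_finite[of "{0}"]) auto
  finally show ?thesis .
qed

text \<open>Gauss's product for \<open>psi\<close>: the theta series over the odd integers is
  evaluated in two ways at an eighth root of \<open>q\<close>.\<close>

lemma psi_euler:
  assumes "norm q < 1" "q \<noteq> 0"
  shows "psi q = (euler (q ^ 2))\<^sup>2 / euler q"
proof -
  obtain w where w: "w ^ 8 = q" "norm w < 1" "w \<noteq> 0" using complex_root[OF assms, of 8] by auto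
  then have "w ^ 16 = q ^ 2" by (simp add: power_mult[symmetric] flip: w(1))
  with theta_odd_euler[OF w(2,3)] theta_odd_psi[OF w(2,3)] w(1)
  have "2 * w * psi q = 2 * w * ((euler (q ^ 2))\<^sup>2 / euler q)" by simp
  then show ?thesis using w(3) by (simp del: times_divide_eq_right)
qed

lemma psi_nonzero:
  assumes "norm q < 1"
  shows "psi q \<noteq> 0"
  using assms euler_power_nonzero[OF assms, of 2] euler_nonzero[OF assms]
  by (cases "q = 0") (auto simp: psi_0 psi_euler)

text \<open>Both sides have the same Euler exponents. This is the bridge by which relations for
  \<open>phi\<close> become relations between values of \<open>psi\<close>.\<close>

lemma psi_square:
  assumes "norm q < 1" "q \<noteq> 0"
  shows "(psi q)\<^sup>2 = phi q * psi (q ^ 2)"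
proof -
  have "norm (q ^ 2) < 1" "q ^ 2 \<noteq> 0" using assms norm_power_less_one[of q 2] by auto
  from psi_euler[OF this] have "psi (q ^ 2) = (euler (q ^ 4))\<^sup>2 / euler (q ^ 2)"
    by (simp add: power_mult[symmetric])
  moreover have "(b\<^sup>2 / a)\<^sup>2 = b ^ 5 / (a\<^sup>2 * c\<^sup>2) * (c\<^sup>2 / b)" if "a \<noteq> 0" "b \<noteq> 0" "c \<noteq> 0" for a b c :: complex
    using that by (simp add: field_simps eval_nat_numeral)
  ultimately show ?thesis
    using euler_power_nonzero[OF assms(1)] euler_nonzero[OF assms(1)]
    by (simp only: psi_euler[OF assms] phi_euler[OF assms]) simp
qed

subsection \<open>Dissections\<close>

lemma theta_reflect:
  assumes "0 < a" "a < m"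
  shows "theta w (residue_class (m - a) m) = theta w (residue_class a m)"
proof -
  have m: "(- n) mod int m = int m - int a \<longleftrightarrow> n mod int m = int a" for n
    using assms by (auto simp: zmod_zminus1_eq_if split: if_splits)
  have "residue_class (m - a) m = uminus ` residue_class a m"
  proof (rule set_eqI)
    fix n :: int
    have "n \<in> uminus ` residue_class a m \<longleftrightarrow> - n \<in> residue_class a m"
      by (auto simp: image_iff intro: bexI[of _ "- n"])
    then show "n \<in> residue_class (m - a) m \<longleftrightarrow> n \<in> uminus ` residue_class a m"
      using m[of "- n"] assms by (simp add: residue_class_def of_nat_diff)
  qed
  then show ?thesis by (simp add: theta_uminus)
qed

lemma theta_scale_class:
  assumes "c > 0"
  shows "theta w (residue_class (c * a) (c * m)) = theta (w ^ (c\<^sup>2)) (residue_class a m)"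
proof -
  have "residue_class (c * a) (c * m) = (*) (int c) ` residue_class a m"
  proof (intro set_eqI iffI)
    fix n assume "n \<in> residue_class (c * a) (c * m)"
    then have n: "n mod (int c * int m) = int c * int a" by (simp add: residue_class_def)
    have "int c dvd n mod (int c * int m)" unfolding n by simp
    then have "int c dvd n" by (simp add: dvd_mod_iff)
    then obtain k where k: "n = int c * k" by blast
    with n assms have "k mod int m = int a" by simp
    with k show "n \<in> (*) (int c) ` residue_class a m" by (auto simp: residue_class_def)
  next
    fix n assume "n \<in> (*) (int c) ` residue_class a m"
    then show "n \<in> residue_class (c * a) (c * m)" by (auto simp: residue_class_def)
  qed
  then show ?thesis using theta_scale[OF assms] by simp
qed

text \<open>Ramanujan's f(q, q^2), the sum of q^(n(3n+1)/2) over all integers n. It is recorded as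
  an Euler quotient so that monomial relations reduce to comparing exponents.\<close>

definition psi_A :: "complex \<Rightarrow> complex" where
  "psi_A q = euler (q ^ 2) * (euler (q ^ 3))\<^sup>2 / (euler q * euler (q ^ 6))"

text \<open>Ramanujan's f(q, q^5), the sum of q^(3n^2+2n) over all integers n.\<close>

definition phi_Omega :: "complex \<Rightarrow> complex" where
  "phi_Omega q = (euler (q ^ 2))\<^sup>2 * euler (q ^ 3) * euler (q ^ 12) / (euler q * euler (q ^ 4) * euler (q ^ 6))"

text \<open>The triple product contains the classes 1 and 2 modulo 3 of the factors of
  \<open>qpoch (- q) q\<close>. The remaining class is a product of the same shape at
  \<open>q ^ 3\<close> and is divided out.\<close>

lemma theta_1_6:
  assumes "norm w < 1" "w \<noteq> 0"
  shows "theta w (residue_class 1 6) = w * psi_A (w ^ 24)"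
proof -
  define q where "q = w ^ 24"
  have q: "norm q < 1" using norm_power_less_one[OF assms(1)] by (simp add: q_def)
  have q3: "norm (q ^ 3) < 1" using norm_power_less_one[OF q] by simp
  have "theta w (residue_class 1 6) = w * (euler (q ^ 3) * qpoch (- (q ^ 2)) (q ^ 3) * qpoch (- q) (q ^ 3))"
    using theta_jacobi[OF assms, of 1 6] by (simp add: q_def power_mult[symmetric])
  moreover have "qpoch (- q) q = qpoch (- q) (q ^ 3) * qpoch (- (q ^ 2)) (q ^ 3) * qpoch (- (q ^ 3)) (q ^ 3)"
    using qpoch_split[OF q, of 3 "- q"] by (simp add: eval_nat_numeral)
  then have "euler (q ^ 2) / euler q = qpoch (- q) (q ^ 3) * qpoch (- (q ^ 2)) (q ^ 3) * (euler (q ^ 6) / euler (q ^ 3))"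
    unfolding qpoch_uminus[OF q] qpoch_uminus[OF q3] by (simp add: power_mult[symmetric])
  then have "euler (q ^ 3) * qpoch (- (q ^ 2)) (q ^ 3) * qpoch (- q) (q ^ 3) = psi_A q"
    using euler_nonzero[OF q] euler_power_nonzero[OF q]
    by (simp add: psi_A_def field_simps power2_eq_square)
  ultimately show ?thesis by (simp add: q_def)
qed

text \<open>Odd integers are sorted modulo 6: the multiples of 3 are the odd integers scaled by 3,
  and the classes 1 and 5 are mirror images. With \<open>w ^ 8 = q\<close> the leading powers
  \<open>w ^ 9\<close> and \<open>w\<close> differ by the factor \<open>q\<close>.\<close>

lemma psi_dissect3:
  assumes "norm q < 1" "q \<noteq> 0"
  shows "psi q = psi_A (q ^ 3) + q * psi (q ^ 9)"
proof -
  obtain w where w: "w ^ 8 = q" "norm w < 1" "w \<noteq> 0" using complex_root[OF assms, of 8] by auto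
  have w9: "norm (w ^ 9) < 1" "w ^ 9 \<noteq> 0" using norm_power_less_one[OF w(2), of 9] w(3) by auto
  have "residue_class 1 2 = residue_class 3 6 \<union> (residue_class 1 6 \<union> residue_class 5 6)"
    unfolding residue_class_def by auto presburger+
  then have "theta w (residue_class 1 2) = theta w (residue_class 3 6) + (theta w (residue_class 1 6) + theta w (residue_class 5 6))"
    by (simp only:) (subst theta_Un[OF w(2)], force simp: residue_class_def, subst theta_Un[OF w(2)], auto simp: residue_class_def)
  moreover have "theta w (residue_class 5 6) = theta w (residue_class 1 6)"
    using theta_reflect[of 1 6 w] by simp
  moreover have "theta w (residue_class 3 6) = theta (w ^ 9) (residue_class 1 2)"
    using theta_scale_class[of 3 w 1 2] by simp
  ultimately have "2 * w * psi (w ^ 8) = 2 * w ^ 9 * psi ((w ^ 9) ^ 8) + 2 * w * psi_A (w ^ 24)"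
    using theta_odd_psi[OF w(2,3)] theta_odd_psi[OF w9] theta_1_6[OF w(2,3)] by (simp add: algebra_simps)
  moreover have "w ^ 9 = w * q" "(w ^ 9) ^ 8 = q ^ 9" "w ^ 24 = q ^ 3"
    by (simp_all add: w(1)[symmetric] power_mult[symmetric] power_Suc[symmetric] del: power_Suc)
  ultimately have "(2 * w) * psi q = (2 * w) * (psi_A (q ^ 3) + q * psi (q ^ 9))"
    using w(1) by (simp add: algebra_simps)
  then show ?thesis using w(3) by (simp only: mult_cancel_left) simp
qed

lemma phi_power_eq: "phi (w ^ (c\<^sup>2)) = theta w (residue_class 0 c)" if "c > 0"
  using theta_scale_class[OF that, of w 0 1] by (simp add: phi_def)

lemma theta_1_3:
  assumes "norm q < 1" "q \<noteq> 0"
  shows "theta q (residue_class 1 3) = q * phi_Omega (q ^ 3)"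
proof -
  define r where "r = q ^ 3"
  have r: "norm r < 1" "norm (r ^ 2) < 1" "norm (r ^ 3) < 1"
    using norm_power_less_one[OF assms(1)] by (simp_all add: r_def power_mult[symmetric])
  have "theta q (residue_class 1 3) = q * (euler (r ^ 6) * qpoch (- (r ^ 5)) (r ^ 6) * qpoch (- r) (r ^ 6))"
    using theta_jacobi[OF assms, of 1 3] by (simp add: r_def power_mult[symmetric])
  moreover have "qpoch (- r) (r ^ 2) = qpoch (- r) (r ^ 6) * qpoch (- (r ^ 3)) (r ^ 6) * qpoch (- (r ^ 5)) (r ^ 6)"
    using qpoch_split[OF r(2), of 3 "- r"] by (simp add: eval_nat_numeral mult_ac)
  then have "(euler (r ^ 2))\<^sup>2 / (euler r * euler (r ^ 4)) =
     qpoch (- r) (r ^ 6) * ((euler (r ^ 6))\<^sup>2 / (euler (r ^ 3) * euler (r ^ 12))) * qpoch (- (r ^ 5)) (r ^ 6)"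
    using qpoch_uminus_odd[OF r(1)] qpoch_uminus_odd[OF r(3)] by (simp add: power_mult[symmetric])
  then have "euler (r ^ 6) * qpoch (- (r ^ 5)) (r ^ 6) * qpoch (- r) (r ^ 6) = phi_Omega r"
    using euler_nonzero[OF r(1)] euler_power_nonzero[OF r(1)]
    by (simp add: phi_Omega_def field_simps power2_eq_square)
  ultimately show ?thesis by (simp add: r_def)
qed

lemma phi_dissect3:
  assumes "norm q < 1" "q \<noteq> 0"
  shows "phi q = phi (q ^ 9) + 2 * q * phi_Omega (q ^ 3)"
proof -
  have "residue_class 0 1 = residue_class 0 3 \<union> (residue_class 1 3 \<union> residue_class 2 3)"
    unfolding residue_class_def by auto
  then have "phi q = theta q (residue_class 0 3) + (theta q (residue_class 1 3) + theta q (residue_class 2 3))"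
    unfolding phi_def
    by (simp only:) (subst theta_Un[OF assms(1)], force simp: residue_class_def, subst theta_Un[OF assms(1)], auto simp: residue_class_def)
  moreover have "theta q (residue_class 2 3) = theta q (residue_class 1 3)"
    using theta_reflect[of 1 3 q] by simp
  ultimately show ?thesis
    using phi_power_eq[of 3 q] theta_1_3[OF assms] by simp
qed

lemma phi_dissect2:
  assumes "norm q < 1" "q \<noteq> 0"
  shows "phi q = phi (q ^ 4) + 2 * q * psi (q ^ 8)"
proof -
  have "residue_class 0 1 = residue_class 0 2 \<union> residue_class 1 2"
    unfolding residue_class_def by auto
  moreover have disj: "residue_class 0 2 \<inter> residue_class 1 2 = {}"
    by (auto simp: residue_class_def)
  ultimately have "phi q = theta q (residue_class 0 2) + theta q (residue_class 1 2)"
    unfolding phi_def by (simp only: theta_Un[OF assms(1) disj])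
  then show ?thesis
    using phi_power_eq[of 2 q] theta_odd_psi[OF assms] by simp
qed

text \<open>The classical phi(q) phi(-q) = phi(-q^2)^2 at the point \<open>\<i> * q\<close>; the
  rotation leaves \<open>q ^ 2\<close> without a sign on the right, as \<open>phi_square\<close>
  requires.\<close>

lemma phi_square_imaginary:
  assumes "norm q < 1" "q \<noteq> 0"
  shows "phi (\<i> * q) * phi (- (\<i> * q)) = (phi (q ^ 2))\<^sup>2"
proof -
  have n: "norm (- (q ^ 2)) < 1" "norm (q ^ 2) < 1" "norm (\<i> * q) < 1" "norm (- (\<i> * q)) < 1"
    using norm_power_less_one[OF assms(1)] assms by (auto simp: norm_mult)
  have sq: "(\<i> * q)\<^sup>2 = - (q ^ 2)" "(- (\<i> * q))\<^sup>2 = - (q ^ 2)" by (simp_all add: power_mult_distrib)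
  have 1: "phi (\<i> * q) = euler (- (q ^ 2)) * (qpoch (- (\<i> * q)) (- (q ^ 2)))\<^sup>2"
    using phi_product[OF n(3)] assms(2) by (simp add: sq)
  have 2: "phi (- (\<i> * q)) = euler (- (q ^ 2)) * (qpoch (\<i> * q) (- (q ^ 2)))\<^sup>2"
    using phi_product[OF n(4)] assms(2) sq by simp
  have 3: "qpoch (\<i> * q) (- (q ^ 2)) * qpoch (- (\<i> * q)) (- (q ^ 2)) = qpoch (- (q ^ 2)) (q ^ 4)"
    using qpoch_mult_neg[OF n(1), of "\<i> * q"] by (simp add: sq power_mult[symmetric])
  have 4: "qpoch (- (q ^ 2)) (q ^ 4) * euler (q ^ 4) = euler (- (q ^ 2))"
    using qpoch_odd[OF n(1)] by (simp add: power_mult[symmetric])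
  have 5: "phi (q ^ 2) = euler (q ^ 4) * (qpoch (- (q ^ 2)) (q ^ 4))\<^sup>2"
    using phi_product[OF n(2)] assms by (simp add: power_mult[symmetric])
  show ?thesis
    unfolding 1 2 5 4[symmetric] 3[symmetric] by (simp add: power2_eq_square)
qed

text \<open>With \<open>t ^ 2 = q\<close> the parity dissections at \<open>\<i> * t\<close> and
  \<open>- (\<i> * t)\<close> share the even part and have opposite odd parts, while fourth and
  eighth powers remove the imaginary unit from the arguments. Their product is a sum of two
  squares.\<close>

lemma phi_square:
  assumes "norm q < 1" "q \<noteq> 0"
  shows "(phi q)\<^sup>2 = (phi (q ^ 2))\<^sup>2 + 4 * q * (psi (q ^ 4))\<^sup>2"
proof -
  obtain t where t: "t ^ 2 = q" "norm t < 1" "t \<noteq> 0" using complex_root[OF assms, of 2] by auto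
  have "norm (\<i> * t) < 1" "\<i> * t \<noteq> 0" "norm (- (\<i> * t)) < 1" "- (\<i> * t) \<noteq> 0"
    using t by (auto simp: norm_mult)
  note d = phi_dissect2[OF this(1,2)] phi_dissect2[OF this(3,4)]
  have "\<i> ^ 8 = (1::complex)" by (simp add: eval_nat_numeral)
  then have pw: "(\<i> * t) ^ 4 = q ^ 2" "(\<i> * t) ^ 8 = q ^ 4" "(- (\<i> * t)) ^ 4 = q ^ 2" "(- (\<i> * t)) ^ 8 = q ^ 4"
    by (simp_all add: power_mult_distrib t(1)[symmetric] power_mult[symmetric])
  have "(phi q)\<^sup>2 = phi (\<i> * t) * phi (- (\<i> * t))"
    using phi_square_imaginary[OF t(2,3)] t(1) by simp
  also have "\<dots> = (phi (q ^ 2))\<^sup>2 + 4 * t\<^sup>2 * (psi (q ^ 4))\<^sup>2"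
    unfolding d pw by (simp add: algebra_simps power2_eq_square)
  finally show ?thesis by (simp add: t(1))
qed

text \<open>Each Euler product is split by exponents modulo 3. The class 0 contributes
  \<open>euler (t ^ 3)\<close> three times. The classes 1 and 2 multiply up over the cube roots,
  squaring only permuting these roots, and together with \<open>euler (t ^ 9)\<close> they rebuild
  the fourth copy.\<close>

lemma euler_cube_roots:
  assumes t: "norm t < 1" and \<omega>: "\<omega>\<^sup>2 + \<omega> + 1 = 0"
  shows "euler t * euler (\<omega> * t) * euler (\<omega>\<^sup>2 * t) * euler (t ^ 9) = euler (t ^ 3) ^ 4"
proof -
  have w3: "\<omega> ^ 3 = 1" using \<omega> by algebra
  have w4: "\<omega> ^ 4 = \<omega>" "\<omega> ^ 6 = 1" using w3 by algebra+
  have nw: "norm \<omega> = 1"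
    using w3 by (metis norm_ge_zero norm_one norm_power power_eq_1_iff zero_neq_numeral)
  have n: "norm (\<omega> * t) < 1" "norm (\<omega>\<^sup>2 * t) < 1" "norm (t ^ 3) < 1"
    using t nw norm_power_less_one[OF t, of 3] by (simp_all add: norm_mult norm_power)
  have split: "euler x = qpoch x (x ^ 3) * qpoch (x ^ 2) (x ^ 3) * euler (x ^ 3)" if "norm x < 1" for x
    using qpoch_split[OF that, of 3 x] by (simp add: eval_nat_numeral)
  have p: "(\<omega> * t) ^ 3 = t ^ 3" "(\<omega>\<^sup>2 * t) ^ 3 = t ^ 3" "(\<omega> * t) ^ 2 = \<omega>\<^sup>2 * t\<^sup>2" "(\<omega>\<^sup>2 * t) ^ 2 = \<omega> * t\<^sup>2"
    using w3 w4 by (simp_all add: power_mult_distrib power_mult[symmetric])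
  note e = split[OF t] split[OF n(1), unfolded p] split[OF n(2), unfolded p]
  have c: "qpoch t (t ^ 3) * qpoch (\<omega> * t) (t ^ 3) * qpoch (\<omega>\<^sup>2 * t) (t ^ 3) = qpoch (t ^ 3) (t ^ 9)"
      "qpoch (t ^ 2) (t ^ 3) * qpoch (\<omega> * t ^ 2) (t ^ 3) * qpoch (\<omega>\<^sup>2 * t ^ 2) (t ^ 3) = qpoch (t ^ 6) (t ^ 9)"
    using qpoch_mult_cube[OF n(3) \<omega>, of t] qpoch_mult_cube[OF n(3) \<omega>, of "t ^ 2"] by (simp_all add: power_mult[symmetric])
  have f: "euler (t ^ 3) = qpoch (t ^ 3) (t ^ 9) * qpoch (t ^ 6) (t ^ 9) * euler (t ^ 9)"
    using split[OF n(3)] by (simp add: power_mult[symmetric])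
  have "euler t * euler (\<omega> * t) * euler (\<omega>\<^sup>2 * t) * euler (t ^ 9) =
    (qpoch t (t ^ 3) * qpoch (\<omega> * t) (t ^ 3) * qpoch (\<omega>\<^sup>2 * t) (t ^ 3)) *
    (qpoch (t ^ 2) (t ^ 3) * qpoch (\<omega> * t ^ 2) (t ^ 3) * qpoch (\<omega>\<^sup>2 * t ^ 2) (t ^ 3)) * euler (t ^ 9) * euler (t ^ 3) ^ 3"
    unfolding e by (simp add: power3_eq_cube)
  also have "\<dots> = euler (t ^ 3) * euler (t ^ 3) ^ 3" unfolding c f by simp
  finally show ?thesis by (simp add: eval_nat_numeral)
qed

lemma cube_root_of_unity: obtains \<omega> :: complex where "\<omega>\<^sup>2 + \<omega> + 1 = 0"
proof -
  have "((-1 + \<i> * sqrt 3) / 2 :: complex)\<^sup>2 + (-1 + \<i> * sqrt 3) / 2 + 1 = 0"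
    by (simp add: power2_eq_square field_simps complex_eq_iff)
  then show thesis by (rule that)
qed

text \<open>At the three cube roots of \<open>q\<close> the dissection of \<open>psi\<close> changes
  only in the coefficient of \<open>psi (q ^ 3)\<close>, so the product is the norm form
  \<open>A ^ 3 + q * B ^ 3\<close>. By \<open>euler_cube_roots\<close> the same product equals
  \<open>psi q ^ 4 / psi (q ^ 3)\<close>.\<close>

lemma psi_quartic:
  assumes "norm q < 1" "q \<noteq> 0"
  shows "psi q ^ 4 = psi (q ^ 3) * psi_A q ^ 3 + q * psi (q ^ 3) ^ 4"
proof -
  obtain t where t: "t ^ 3 = q" "norm t < 1" "t \<noteq> 0" using complex_root[OF assms, of 3] by auto
  obtain \<omega> :: complex where w: "\<omega>\<^sup>2 + \<omega> + 1 = 0" by (rule cube_root_of_unity)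
  have w3: "\<omega> ^ 3 = 1" using w by algebra
  then have w46: "\<omega> ^ 4 = \<omega>" "\<omega> ^ 6 = 1" "\<omega> ^ 9 = 1" "\<omega> ^ 18 = 1" by algebra+
  have nw: "norm \<omega> = 1"
    using w3 by (metis norm_ge_zero norm_one norm_power power_eq_1_iff zero_neq_numeral)
  have w0: "\<omega> \<noteq> 0" using nw by auto
  have n: "norm (\<omega> * t) < 1" "\<omega> * t \<noteq> 0" "norm (\<omega>\<^sup>2 * t) < 1" "\<omega>\<^sup>2 * t \<noteq> 0" "norm (t ^ 2) < 1" "norm (q ^ 3) < 1"
    using t nw w0 norm_power_less_one[OF t(2)] norm_power_less_one[OF assms(1)] by (simp_all add: norm_mult norm_power)
  have p: "(\<omega> * t) ^ 3 = q" "(\<omega>\<^sup>2 * t) ^ 3 = q" "(\<omega> * t) ^ 2 = \<omega>\<^sup>2 * t\<^sup>2" "(\<omega>\<^sup>2 * t) ^ 2 = \<omega> * t\<^sup>2"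
     "t ^ 9 = q ^ 3" "(\<omega> * t) ^ 9 = q ^ 3" "(\<omega>\<^sup>2 * t) ^ 9 = q ^ 3" "(t ^ 2) ^ 3 = q ^ 2" "(t ^ 2) ^ 9 = q ^ 6"
    using w3 w46 by (simp_all add: power_mult_distrib power_mult[symmetric] t(1)[symmetric])
  have e: "euler t * euler (\<omega> * t) * euler (\<omega>\<^sup>2 * t) * euler (q ^ 3) = euler q ^ 4"
     "euler (t ^ 2) * euler (\<omega> * t ^ 2) * euler (\<omega>\<^sup>2 * t ^ 2) * euler (q ^ 6) = euler (q ^ 2) ^ 4"
    using euler_cube_roots[OF t(2) w] euler_cube_roots[OF n(5) w] by (simp_all only: p t(1))
  have nz: "euler q \<noteq> 0" "euler (q ^ 3) \<noteq> 0" "euler (q ^ 6) \<noteq> 0" "euler t \<noteq> 0" "euler (\<omega> * t) \<noteq> 0" "euler (\<omega>\<^sup>2 * t) \<noteq> 0" "euler (q ^ 2) \<noteq> 0"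
    using euler_nonzero euler_power_nonzero[OF assms(1)] assms t n by auto
  have "psi t * psi (\<omega> * t) * psi (\<omega>\<^sup>2 * t) = (euler (t ^ 2) * euler (\<omega> * t ^ 2) * euler (\<omega>\<^sup>2 * t ^ 2))\<^sup>2 / 
      (euler t * euler (\<omega> * t) * euler (\<omega>\<^sup>2 * t))"
    unfolding psi_euler[OF t(2,3)] psi_euler[OF n(1,2)] psi_euler[OF n(3,4)] p
    by (simp add: power_mult_distrib)
  also have "\<dots> = (euler (q ^ 2) ^ 4 / euler (q ^ 6))\<^sup>2 / (euler q ^ 4 / euler (q ^ 3))"
    unfolding e[symmetric] using nz by simp
  also have "\<dots> * psi (q ^ 3) = psi q ^ 4"
  proof -
    have "psi (q ^ 3) = (euler (q ^ 6))\<^sup>2 / euler (q ^ 3)"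
      using psi_euler[OF n(6)] assms by (simp add: power_mult[symmetric])
    moreover have "(b ^ 4 / d)\<^sup>2 / (a ^ 4 / c) * (d\<^sup>2 / c) = (b\<^sup>2 / a) ^ 4"
      if "a \<noteq> 0" "c \<noteq> 0" "d \<noteq> 0" for a b c d :: complex
      using that by (simp add: power_divide power_mult[symmetric])
    ultimately show ?thesis using nz by (simp only: psi_euler[OF assms])
  qed
  finally have 1: "psi t * psi (\<omega> * t) * psi (\<omega>\<^sup>2 * t) * psi (q ^ 3) = psi q ^ 4"
    by simp
  have d: "psi t = psi_A q + t * psi (q ^ 3)" "psi (\<omega> * t) = psi_A q + \<omega> * t * psi (q ^ 3)"
     "psi (\<omega>\<^sup>2 * t) = psi_A q + \<omega>\<^sup>2 * t * psi (q ^ 3)"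
    using psi_dissect3[OF t(2,3)] psi_dissect3[OF n(1,2)] psi_dissect3[OF n(3,4)] by (simp_all only: p t(1))
  have "(A + t * B) * (A + \<omega> * t * B) * (A + \<omega>\<^sup>2 * t * B) = A ^ 3 + q * B ^ 3" for A B
    using w t(1) by algebra
  from this[of "psi_A q" "psi (q ^ 3)"] 1 show ?thesis
    unfolding d by (simp add: algebra_simps eval_nat_numeral)
qed

text \<open>The argument of \<open>psi_quartic\<close>; the coefficient 2 in the dissection of
  \<open>phi\<close> becomes 8 in the norm form. The product for \<open>phi\<close> also involves
  fourth powers of the argument, hence a third use of \<open>euler_cube_roots\<close>.\<close>

lemma phi_quartic:
  assumes "norm q < 1" "q \<noteq> 0"
  shows "phi q ^ 4 = phi (q ^ 3) ^ 4 + 8 * q * phi (q ^ 3) * phi_Omega q ^ 3"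
proof -
  obtain t where t: "t ^ 3 = q" "norm t < 1" "t \<noteq> 0" using complex_root[OF assms, of 3] by auto
  obtain \<omega> :: complex where w: "\<omega>\<^sup>2 + \<omega> + 1 = 0" by (rule cube_root_of_unity)
  have w3: "\<omega> ^ 3 = 1" using w by algebra
  then have w46: "\<omega> ^ 4 = \<omega>" "\<omega> ^ 6 = 1" "\<omega> ^ 8 = \<omega>\<^sup>2" "\<omega> ^ 9 = 1" "\<omega> ^ 18 = 1" by algebra+
  have nw: "norm \<omega> = 1"
    using w3 by (metis norm_ge_zero norm_one norm_power power_eq_1_iff zero_neq_numeral)
  have w0: "\<omega> \<noteq> 0" using nw by auto
  have n: "norm (\<omega> * t) < 1" "\<omega> * t \<noteq> 0" "norm (\<omega>\<^sup>2 * t) < 1" "\<omega>\<^sup>2 * t \<noteq> 0" "norm (t ^ 2) < 1" "norm (t ^ 4) < 1" "norm (q ^ 3) < 1"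
    using t nw w0 norm_power_less_one[OF t(2)] norm_power_less_one[OF assms(1)] by (simp_all add: norm_mult norm_power)
  have p: "(\<omega> * t) ^ 3 = q" "(\<omega>\<^sup>2 * t) ^ 3 = q" "(\<omega> * t) ^ 2 = \<omega>\<^sup>2 * t\<^sup>2" "(\<omega>\<^sup>2 * t) ^ 2 = \<omega> * t\<^sup>2"
     "(\<omega> * t) ^ 4 = \<omega> * t ^ 4" "(\<omega>\<^sup>2 * t) ^ 4 = \<omega>\<^sup>2 * t ^ 4"
     "t ^ 9 = q ^ 3" "(\<omega> * t) ^ 9 = q ^ 3" "(\<omega>\<^sup>2 * t) ^ 9 = q ^ 3" "(t ^ 2) ^ 3 = q ^ 2" "(t ^ 2) ^ 9 = q ^ 6"
     "(t ^ 4) ^ 3 = q ^ 4" "(t ^ 4) ^ 9 = q ^ 12"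
    using w3 w46 by (simp_all add: power_mult_distrib power_mult[symmetric] t(1)[symmetric])
  have e: "euler t * euler (\<omega> * t) * euler (\<omega>\<^sup>2 * t) * euler (q ^ 3) = euler q ^ 4"
     "euler (t ^ 2) * euler (\<omega> * t ^ 2) * euler (\<omega>\<^sup>2 * t ^ 2) * euler (q ^ 6) = euler (q ^ 2) ^ 4"
     "euler (t ^ 4) * euler (\<omega> * t ^ 4) * euler (\<omega>\<^sup>2 * t ^ 4) * euler (q ^ 12) = euler (q ^ 4) ^ 4"
    using euler_cube_roots[OF t(2) w] euler_cube_roots[OF n(5) w] euler_cube_roots[OF n(6) w] by (simp_all only: p t(1))
  have nz: "euler q \<noteq> 0" "euler (q ^ 3) \<noteq> 0" "euler (q ^ 6) \<noteq> 0" "euler (q ^ 12) \<noteq> 0" "euler (q ^ 2) \<noteq> 0" "euler (q ^ 4) \<noteq> 0"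
    using euler_nonzero euler_power_nonzero[OF assms(1)] assms by auto
  have "phi t * phi (\<omega> * t) * phi (\<omega>\<^sup>2 * t) = (euler (t ^ 2) * euler (\<omega> * t ^ 2) * euler (\<omega>\<^sup>2 * t ^ 2)) ^ 5 / 
      ((euler t * euler (\<omega> * t) * euler (\<omega>\<^sup>2 * t))\<^sup>2 * (euler (t ^ 4) * euler (\<omega> * t ^ 4) * euler (\<omega>\<^sup>2 * t ^ 4))\<^sup>2)"
    unfolding phi_euler[OF t(2,3)] phi_euler[OF n(1,2)] phi_euler[OF n(3,4)] p
    by (simp add: power_mult_distrib mult_ac)
  also have "\<dots> = (euler (q ^ 2) ^ 4 / euler (q ^ 6)) ^ 5 / ((euler q ^ 4 / euler (q ^ 3))\<^sup>2 * (euler (q ^ 4) ^ 4 / euler (q ^ 12))\<^sup>2)"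
    unfolding e[symmetric] using nz by simp
  also have "\<dots> * phi (q ^ 3) = phi q ^ 4"
  proof -
    have "phi (q ^ 3) = (euler (q ^ 6)) ^ 5 / ((euler (q ^ 3))\<^sup>2 * (euler (q ^ 12))\<^sup>2)"
      using phi_euler[OF n(7)] assms by (simp add: power_mult[symmetric])
    moreover have "(b ^ 4 / d) ^ 5 / ((a ^ 4 / c)\<^sup>2 * (f ^ 4 / g)\<^sup>2) * (d ^ 5 / (c\<^sup>2 * g\<^sup>2)) = (b ^ 5 / (a\<^sup>2 * f\<^sup>2)) ^ 4"
      if "a \<noteq> 0" "c \<noteq> 0" "d \<noteq> 0" "f \<noteq> 0" "g \<noteq> 0" for a b c d f g :: complex
      using that by (simp add: power_divide power_mult_distrib power_mult[symmetric])
    ultimately show ?thesis using nz by (simp only: phi_euler[OF assms])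
  qed
  finally have 1: "phi t * phi (\<omega> * t) * phi (\<omega>\<^sup>2 * t) * phi (q ^ 3) = phi q ^ 4"
    by simp
  have d: "phi t = phi (q ^ 3) + 2 * t * phi_Omega q" "phi (\<omega> * t) = phi (q ^ 3) + 2 * (\<omega> * t) * phi_Omega q"
     "phi (\<omega>\<^sup>2 * t) = phi (q ^ 3) + 2 * (\<omega>\<^sup>2 * t) * phi_Omega q"
    using phi_dissect3[OF t(2,3)] phi_dissect3[OF n(1,2)] phi_dissect3[OF n(3,4)] by (simp_all only: p t(1))
  have "(A + 2 * t * B) * (A + 2 * (\<omega> * t) * B) * (A + 2 * (\<omega>\<^sup>2 * t) * B) = A ^ 3 + 8 * q * B ^ 3" for A B
    using w t(1) by algebra
  from this[of "phi (q ^ 3)" "phi_Omega q"] 1 show ?thesis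
    unfolding d by (simp add: algebra_simps eval_nat_numeral)
qed

subsection \<open>Degree five\<close>

lemma mod_eq_obtain:
  fixes a b m :: int
  assumes "a mod m = b mod m"
  obtains k where "a = b + m * k"
  using mod_eqE[of b m a] assms by auto

text \<open>Turns a union of boxes into a congruence \<open>R\<close>, the form in which the images
  of the lattice maps can be recognised.\<close>

lemma Union_residue_class:
  assumes "\<And>u v. (\<exists>c\<in>C. u mod int m = int c \<and> v mod int m = int (f c)) \<longleftrightarrow> R u v"
  shows "(\<Union>c\<in>C. residue_class c m \<times> residue_class (f c) m) = {(u, v). R u v}"
  using assms by (auto simp: residue_class_def)

lemma residue_class_disjoint: "c \<noteq> d \<Longrightarrow> residue_class c m \<inter> residue_class d m = {}"
  by (auto simp: residue_class_def)

lemma odd_two_times_add_one: "odd (2 * n + 1 :: int)" by simp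

text \<open>Multiplication by \<open>2 + \<i>\<close> has norm 5, and its image consists of the
  pairs with v = 3 u modulo 5. For \<open>x\<close> and \<open>y\<close> odd, \<open>x - y\<close>
  is even, which sharpens this to modulo 10 with u odd; the inverse is multiplication by the
  conjugate divided by 5. Class 5 is paired with itself and gives the scaled square, and the other
  four terms coincide by reflection.\<close>

lemma theta_odd_square:
  assumes w: "norm w < 1" "w \<noteq> 0"
  shows "(theta (w ^ 5) (residue_class 1 2))\<^sup>2 = (theta (w ^ 25) (residue_class 1 2))\<^sup>2
     + 4 * theta w (residue_class 1 10) * theta w (residue_class 3 10)"
proof -
  let ?C = "{1, 3, 5, 7, 9} :: nat set"
  have U: "(\<Union>c\<in>?C. residue_class c 10 \<times> residue_class (3 * c mod 10) 10) = {(u, v). odd u \<and> v mod 10 = 3 * u mod 10}"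
  proof (rule Union_residue_class)
    fix u v :: int
    define r where "r = u mod 10"
    have "0 \<le> r" "r < 10" by (simp_all add: r_def)
    then have r: "odd r \<longleftrightarrow> r = 1 \<or> r = 3 \<or> r = 5 \<or> r = 7 \<or> r = 9" by presburger
    have "odd u \<longleftrightarrow> odd r" "3 * u mod 10 = 3 * r mod 10"
      by (simp_all add: r_def dvd_mod_iff mod_mult_right_eq)
    moreover have "(\<exists>c\<in>?C. r = int c \<and> v mod 10 = int (3 * c mod 10)) \<longleftrightarrow> odd r \<and> v mod 10 = 3 * r mod 10"
      unfolding r by auto
    ultimately show "(\<exists>c\<in>?C. u mod int 10 = int c \<and> v mod int 10 = int (3 * c mod 10)) \<longleftrightarrow> odd u \<and> v mod 10 = 3 * u mod 10"
      by (simp only: r_def of_nat_numeral)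
  qed
  have bij: "bij_betw (\<lambda>(x, y). (2 * x - y, x + 2 * y)) (residue_class 1 2 \<times> residue_class 1 2)
     (\<Union>c\<in>?C. residue_class c 10 \<times> residue_class (3 * c mod 10) 10)"
    unfolding U
  proof (rule bij_betwI[where g = "\<lambda>(u, v). ((2 * u + v) div 5, (2 * v - u) div 5)"])
    show "(\<lambda>(x, y). (2 * x - y, x + 2 * y)) \<in> residue_class 1 2 \<times> residue_class 1 2 \<rightarrow> {(u, v). odd u \<and> v mod 10 = 3 * u mod 10}"
    proof clarify
      fix x y assume xy: "x \<in> residue_class 1 2" "y \<in> residue_class 1 2"
      define i j where "i = x div 2" and "j = y div 2"
      have "x = 2 * i + 1" "y = 2 * j + 1" using xy unfolding i_def j_def residue_class_def by (simp_all, presburger+)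
      then have "3 * (2 * x - y) = x + 2 * y + 10 * (i - j)" "2 * x - y = 2 * (2 * i - j) + 1" by simp_all
      then show "odd (2 * x - y) \<and> (x + 2 * y) mod 10 = 3 * (2 * x - y) mod 10"
        by (simp only: mod_mult_self2) simp
    qed
    show "(\<lambda>(u, v). ((2 * u + v) div 5, (2 * v - u) div 5)) \<in> {(u, v). odd u \<and> v mod 10 = 3 * u mod 10} \<rightarrow> residue_class 1 2 \<times> residue_class 1 2"
    proof clarify
      fix u v :: int assume uv: "odd u" "v mod 10 = 3 * u mod 10"
      obtain k where k: "v = 3 * u + 10 * k" using mod_eq_obtain[OF uv(2)] by blast
      have "(2 * u + v) div 5 = u + 2 * k" "(2 * v - u) div 5 = u + 4 * k" unfolding k by simp_all
      then show "(2 * u + v) div 5 \<in> residue_class 1 2 \<and> (2 * v - u) div 5 \<in> residue_class 1 2"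
        using uv(1) by (simp add: residue_class_def) presburger
    qed
    fix b :: "int \<times> int" assume "b \<in> {(u, v). odd u \<and> v mod 10 = 3 * u mod 10}"
    then obtain u v where uv: "b = (u, v)" "v mod 10 = 3 * u mod 10" by auto
    from uv(2) obtain k where "v = 3 * u + 10 * k" by (rule mod_eq_obtain)
    note k = uv(1) this
    have "(2 * u + v) div 5 = u + 2 * k" "(2 * v - u) div 5 = u + 4 * k" unfolding k(2) by simp_all
    then show "(\<lambda>(x, y). (2 * x - y, x + 2 * y)) ((\<lambda>(u, v). ((2 * u + v) div 5, (2 * v - u) div 5)) b) = b"
      using k by simp
  qed auto
  have "theta (w ^ 5) (residue_class 1 2) * theta (w ^ 5) (residue_class 1 2) =
     (\<Sum>c\<in>?C. theta w (residue_class c 10) * theta (w ^ 1) (residue_class (3 * c mod 10) 10))"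
    by (rule theta_lattice[OF w _ _ _ _ _ bij])
       (auto simp: residue_class_disjoint power2_eq_square algebra_simps)
  also have "\<dots> = theta w (residue_class 1 10) * theta w (residue_class 3 10) + theta w (residue_class 3 10) * theta w (residue_class 9 10)
     + theta w (residue_class 5 10) * theta w (residue_class 5 10) + theta w (residue_class 7 10) * theta w (residue_class 1 10)
     + theta w (residue_class 9 10) * theta w (residue_class 7 10)"
    by simp
  also have "theta w (residue_class 7 10) = theta w (residue_class 3 10)" using theta_reflect[of 3 10 w] by simp
  also have "theta w (residue_class 9 10) = theta w (residue_class 1 10)" using theta_reflect[of 1 10 w] by simp
  also have "theta w (residue_class 5 10) = theta (w ^ 25) (residue_class 1 2)" using theta_scale_class[of 5 w 1 2] by simp
  finally show ?thesis by (simp add: power2_eq_square algebra_simps)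
qed

text \<open>The map of \<open>theta_odd_square\<close> on all pairs of integers, where the
  congruence holds modulo 5 only; now class 0 is paired with itself.\<close>

lemma phi_theta_square:
  assumes w: "norm w < 1" "w \<noteq> 0"
  shows "(phi (w ^ 5))\<^sup>2 = (phi (w ^ 25))\<^sup>2
     + 4 * theta w (residue_class 1 5) * theta w (residue_class 2 5)"
proof -
  let ?C = "{0, 1, 2, 3, 4} :: nat set"
  have U: "(\<Union>c\<in>?C. residue_class c 5 \<times> residue_class (3 * c mod 5) 5) = {(u, v). v mod 5 = 3 * u mod 5}"
  proof (rule Union_residue_class)
    fix u v :: int
    have "u mod 5 = 0 \<or> u mod 5 = 1 \<or> u mod 5 = 2 \<or> u mod 5 = 3 \<or> u mod 5 = 4" by presburger
    moreover have "3 * u mod 5 = 3 * (u mod 5) mod 5" by (simp add: mod_mult_right_eq)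
    ultimately show "(\<exists>c\<in>?C. u mod int 5 = int c \<and> v mod int 5 = int (3 * c mod 5)) \<longleftrightarrow> v mod 5 = 3 * u mod 5"
      by auto
  qed
  have bij: "bij_betw (\<lambda>(x, y). (2 * x - y, x + 2 * y)) (residue_class 0 1 \<times> residue_class 0 1)
     (\<Union>c\<in>?C. residue_class c 5 \<times> residue_class (3 * c mod 5) 5)"
    unfolding U
  proof (rule bij_betwI[where g = "\<lambda>(u, v). ((2 * u + v) div 5, (2 * v - u) div 5)"])
    show "(\<lambda>(x, y). (2 * x - y, x + 2 * y)) \<in> residue_class 0 1 \<times> residue_class 0 1 \<rightarrow> {(u, v). v mod 5 = 3 * u mod 5}"
    proof clarify
      fix x y :: int
      have "3 * (2 * x - y) = x + 2 * y + 5 * (x - y)" by simp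
      then show "(x + 2 * y) mod 5 = 3 * (2 * x - y) mod 5" by (simp only: mod_mult_self2)
    qed
    show "(\<lambda>(u, v). ((2 * u + v) div 5, (2 * v - u) div 5)) \<in> {(u, v). v mod 5 = 3 * u mod 5} \<rightarrow> residue_class 0 1 \<times> residue_class 0 1"
      by (auto simp: residue_class_def)
    fix b :: "int \<times> int" assume "b \<in> {(u, v). v mod 5 = 3 * u mod 5}"
    then obtain u v where uv: "b = (u, v)" "v mod 5 = 3 * u mod 5" by auto
    from uv(2) obtain k where "v = 3 * u + 5 * k" by (rule mod_eq_obtain)
    note k = uv(1) this
    have "(2 * u + v) div 5 = u + k" "(2 * v - u) div 5 = u + 2 * k" unfolding k(2) by simp_all
    then show "(\<lambda>(x, y). (2 * x - y, x + 2 * y)) ((\<lambda>(u, v). ((2 * u + v) div 5, (2 * v - u) div 5)) b) = b"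
      using k by simp
  qed auto
  have "theta (w ^ 5) (residue_class 0 1) * theta (w ^ 5) (residue_class 0 1) =
     (\<Sum>c\<in>?C. theta w (residue_class c 5) * theta (w ^ 1) (residue_class (3 * c mod 5) 5))"
    by (rule theta_lattice[OF w _ _ _ _ _ bij])
       (auto simp: residue_class_disjoint power2_eq_square algebra_simps)
  also have "\<dots> = theta w (residue_class 0 5) * theta w (residue_class 0 5) + theta w (residue_class 1 5) * theta w (residue_class 3 5)
     + theta w (residue_class 2 5) * theta w (residue_class 1 5) + theta w (residue_class 3 5) * theta w (residue_class 4 5)
     + theta w (residue_class 4 5) * theta w (residue_class 2 5)"
    by simp
  also have "theta w (residue_class 3 5) = theta w (residue_class 2 5)" using theta_reflect[of 2 5 w] by simp
  also have "theta w (residue_class 4 5) = theta w (residue_class 1 5)" using theta_reflect[of 1 5 w] by simp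
  also have "theta w (residue_class 0 5) = phi (w ^ 25)" using phi_power_eq[of 5 w] by simp
  finally show ?thesis unfolding phi_def by (simp add: power2_eq_square algebra_simps)
qed

text \<open>Multiplication of x + y sqrt(-5) by 1 + sqrt(-5), of norm 6, gives the map
  \<open>(x - 5 * y, x + y)\<close>. The two coordinates of the image differ by
  \<open>6 * y\<close>, so even \<open>y\<close> pairs equal classes modulo 12 and odd
  \<open>y\<close> pairs classes shifted by 6. In the difference of the two sums the classes 3 and 9
  cancel by reflection, and the other four terms factor.\<close>

lemma phi_psi_theta:
  assumes w: "norm w < 1" "w \<noteq> 0"
  shows "theta (w ^ 6) (residue_class 1 2) * phi (w ^ 120) - phi (w ^ 24) * theta (w ^ 30) (residue_class 1 2)
    = 2 * (theta w (residue_class 1 12) - theta w (residue_class 7 12)) *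
          (theta (w ^ 5) (residue_class 1 12) - theta (w ^ 5) (residue_class 7 12))"
proof -
  let ?C = "{1, 3, 5, 7, 9, 11} :: nat set"
  have odd: "odd u \<longleftrightarrow> u mod 12 = 1 \<or> u mod 12 = 3 \<or> u mod 12 = 5 \<or> u mod 12 = 7 \<or> u mod 12 = 9 \<or> u mod 12 = 11" for u :: int
  proof -
    define r where "r = u mod 12"
    have "0 \<le> r" "r < 12" by (simp_all add: r_def)
    then have "odd r \<longleftrightarrow> r = 1 \<or> r = 3 \<or> r = 5 \<or> r = 7 \<or> r = 9 \<or> r = 11" by presburger
    moreover have "odd u \<longleftrightarrow> odd r" by (simp add: r_def dvd_mod_iff)
    ultimately show ?thesis by (simp only: r_def)
  qed
  have U1: "(\<Union>c\<in>?C. residue_class c 12 \<times> residue_class c 12) = {(u, v). odd u \<and> v mod 12 = u mod 12}"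
    by (rule Union_residue_class[of _ _ "\<lambda>c. c"]) (unfold odd, auto)
  have U2: "(\<Union>c\<in>?C. residue_class c 12 \<times> residue_class ((c + 6) mod 12) 12) = {(u, v). odd u \<and> v mod 12 = (u + 6) mod 12}"
  proof (rule Union_residue_class)
    fix u v :: int
    have "(u + 6) mod 12 = (u mod 12 + 6) mod 12" by (simp add: mod_add_left_eq)
    moreover define r where "r = u mod 12"
    moreover have "(\<exists>c\<in>?C. r = int c \<and> v mod 12 = int ((c + 6) mod 12)) \<longleftrightarrow>
       (r = 1 \<or> r = 3 \<or> r = 5 \<or> r = 7 \<or> r = 9 \<or> r = 11) \<and> v mod 12 = (r + 6) mod 12" by auto
    ultimately show "(\<exists>c\<in>?C. u mod int 12 = int c \<and> v mod int 12 = int ((c + 6) mod 12)) \<longleftrightarrow> odd u \<and> v mod 12 = (u + 6) mod 12"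
      by (simp only: odd[of u] of_nat_numeral)
  qed
  let ?g = "\<lambda>(x, y). (x - 5 * y, x + y) :: int \<times> int" and ?h = "\<lambda>(u, v). ((u + 5 * v) div 6, (v - u) div 6) :: int \<times> int"
  have bij1: "bij_betw ?g (residue_class 1 2 \<times> residue_class 0 2) (\<Union>c\<in>?C. residue_class c 12 \<times> residue_class c 12)"
    unfolding U1
  proof (rule bij_betwI[where g = ?h])
    show "?g \<in> residue_class 1 2 \<times> residue_class 0 2 \<rightarrow> {(u, v). odd u \<and> v mod 12 = u mod 12}"
    proof clarify
      fix x y assume xy: "x \<in> residue_class 1 2" "y \<in> residue_class 0 2"
      define i j where "i = x div 2" and "j = y div 2"
      have "x = 2 * i + 1" "y = 2 * j" using xy unfolding i_def j_def residue_class_def by (simp_all, presburger+)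
      then have "x + y = x - 5 * y + 12 * j" "x - 5 * y = 2 * (i - 5 * j) + 1" by simp_all
      then show "odd (x - 5 * y) \<and> (x + y) mod 12 = (x - 5 * y) mod 12"
        by (metis mod_mult_self2 odd_two_times_add_one)
    qed
    show "?h \<in> {(u, v). odd u \<and> v mod 12 = u mod 12} \<rightarrow> residue_class 1 2 \<times> residue_class 0 2"
    proof clarify
      fix u v :: int assume uv: "odd u" "v mod 12 = u mod 12"
      obtain k where k: "v = u + 12 * k" using mod_eq_obtain[OF uv(2)] by blast
      have "(u + 5 * v) div 6 = u + 10 * k" "(v - u) div 6 = 2 * k" unfolding k by simp_all
      then show "(u + 5 * v) div 6 \<in> residue_class 1 2 \<and> (v - u) div 6 \<in> residue_class 0 2"
        using uv(1) by (simp add: residue_class_def) presburger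
    qed
    fix b :: "int \<times> int" assume "b \<in> {(u, v). odd u \<and> v mod 12 = u mod 12}"
    then obtain u v where uv: "b = (u, v)" "v mod 12 = u mod 12" by auto
    from uv(2) obtain k where "v = u + 12 * k" by (rule mod_eq_obtain)
    note k = uv(1) this
    have "(u + 5 * v) div 6 = u + 10 * k" "(v - u) div 6 = 2 * k" unfolding k(2) by simp_all
    then show "?g (?h b) = b" using k by simp
  qed auto
  have bij2: "bij_betw ?g (residue_class 0 2 \<times> residue_class 1 2) (\<Union>c\<in>?C. residue_class c 12 \<times> residue_class ((c + 6) mod 12) 12)"
    unfolding U2
  proof (rule bij_betwI[where g = ?h])
    show "?g \<in> residue_class 0 2 \<times> residue_class 1 2 \<rightarrow> {(u, v). odd u \<and> v mod 12 = (u + 6) mod 12}"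
    proof clarify
      fix x y assume xy: "x \<in> residue_class 0 2" "y \<in> residue_class 1 2"
      define i j where "i = x div 2" and "j = y div 2"
      have "x = 2 * i" "y = 2 * j + 1" using xy unfolding i_def j_def residue_class_def by (simp_all, presburger+)
      then have "x + y = x - 5 * y + 6 + 12 * j" "x - 5 * y = 2 * (i - 5 * j - 3) + 1" by simp_all
      then show "odd (x - 5 * y) \<and> (x + y) mod 12 = (x - 5 * y + 6) mod 12"
        by (metis mod_mult_self2 odd_two_times_add_one)
    qed
    show "?h \<in> {(u, v). odd u \<and> v mod 12 = (u + 6) mod 12} \<rightarrow> residue_class 0 2 \<times> residue_class 1 2"
    proof clarify
      fix u v :: int assume uv: "odd u" "v mod 12 = (u + 6) mod 12"
      obtain k where k: "v = u + 6 + 12 * k" using mod_eq_obtain[OF uv(2)] by blast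
      have "(u + 5 * v) div 6 = u + 5 + 10 * k" "(v - u) div 6 = 1 + 2 * k" unfolding k by simp_all
      then show "(u + 5 * v) div 6 \<in> residue_class 0 2 \<and> (v - u) div 6 \<in> residue_class 1 2"
        using uv(1) by (simp add: residue_class_def)
    qed
    fix b :: "int \<times> int" assume "b \<in> {(u, v). odd u \<and> v mod 12 = (u + 6) mod 12}"
    then obtain u v where uv: "b = (u, v)" "v mod 12 = (u + 6) mod 12" by auto
    from uv(2) obtain k where "v = u + 6 + 12 * k" by (rule mod_eq_obtain)
    note k = uv(1) this
    have "(u + 5 * v) div 6 = u + 5 + 10 * k" "(v - u) div 6 = 1 + 2 * k" unfolding k(2) by simp_all
    then show "?g (?h b) = b" using k by simp
  qed auto
  let ?t = "\<lambda>c. theta w (residue_class c 12)" and ?s = "\<lambda>c. theta (w ^ 5) (residue_class c 12)"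
  have p1: "theta (w ^ 6) (residue_class 1 2) * theta (w ^ 30) (residue_class 0 2) = (\<Sum>c\<in>?C. ?t c * ?s c)"
    by (rule theta_lattice[OF w _ _ _ _ _ bij1])
       (auto simp: residue_class_disjoint power2_eq_square algebra_simps)
  have p2: "theta (w ^ 6) (residue_class 0 2) * theta (w ^ 30) (residue_class 1 2) = (\<Sum>c\<in>?C. ?t c * ?s ((c + 6) mod 12))"
    by (rule theta_lattice[OF w _ _ _ _ _ bij2])
       (auto simp: residue_class_disjoint power2_eq_square algebra_simps)
  have r: "theta x (residue_class 5 12) = theta x (residue_class 7 12)"
     "theta x (residue_class 9 12) = theta x (residue_class 3 12)"
     "theta x (residue_class 11 12) = theta x (residue_class 1 12)" for x
    using theta_reflect[of 7 12 x] theta_reflect[of 3 12 x] theta_reflect[of 1 12 x] by simp_all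
  have "theta (w ^ 30) (residue_class 0 2) = phi (w ^ 120)" "theta (w ^ 6) (residue_class 0 2) = phi (w ^ 24)"
    using phi_power_eq[of 2 "w ^ 30"] phi_power_eq[of 2 "w ^ 6"] by (simp_all add: power_mult[symmetric])
  moreover have "(\<Sum>c\<in>?C. g c) = g 1 + g 3 + g 5 + g 7 + g 9 + g 11" for g :: "nat \<Rightarrow> complex"
    by simp
  note p1[unfolded this] p2[unfolded this]
  moreover have "(1 + 6) mod 12 = (7 :: nat)" "(3 + 6) mod 12 = (9 :: nat)" "(5 + 6) mod 12 = (11 :: nat)"
    "(7 + 6) mod 12 = (1 :: nat)" "(9 + 6) mod 12 = (3 :: nat)" "(11 + 6) mod 12 = (5 :: nat)"
    by simp_all
  ultimately show ?thesis
    by (simp only: r) (simp add: algebra_simps)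
qed

text \<open>The order 40 is 5 times 8, because \<open>theta_odd_psi\<close> is used at
  \<open>w ^ 5\<close>. The theta series over the classes 1 and 3 modulo 10 together contain the
  four products \<open>qpoch (- (q ^ j)) (q ^ 5)\<close> with j from 1 to 4, that is,
  \<open>qpoch (- q) q\<close> without the multiples of 5.\<close>

lemma psi_quintic:
  assumes "norm q < 1" "q \<noteq> 0"
  shows "(psi q)\<^sup>2 = q * (psi (q ^ 5))\<^sup>2 + euler (q ^ 2) * euler (q ^ 5) ^ 3 / (euler q * euler (q ^ 10))"
proof -
  obtain w where w: "w ^ 40 = q" "norm w < 1" "w \<noteq> 0" using complex_root[OF assms, of 40] by auto
  have n: "norm (w ^ 5) < 1" "w ^ 5 \<noteq> 0" "norm (w ^ 25) < 1" "w ^ 25 \<noteq> 0" "norm (q ^ 5) < 1"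
    using norm_power_less_one[OF w(2)] w(3) norm_power_less_one[OF assms(1)] by auto
  have pw: "w ^ 200 = q ^ 5" "w ^ 120 = q ^ 3" "w ^ 80 = q ^ 2" "w ^ 160 = q ^ 4"
    by (simp_all add: w(1)[symmetric] power_mult[symmetric])
  have t: "theta w (residue_class 1 10) = w * (euler (q ^ 5) * qpoch (- (q ^ 3)) (q ^ 5) * qpoch (- (q ^ 2)) (q ^ 5))"
    "theta w (residue_class 3 10) = w ^ 9 * (euler (q ^ 5) * qpoch (- (q ^ 4)) (q ^ 5) * qpoch (- q) (q ^ 5))"
    using theta_jacobi[OF w(2,3), of 1 10] theta_jacobi[OF w(2,3), of 3 10] by (simp_all add: pw w(1))
  have s: "theta (w ^ 5) (residue_class 1 2) = 2 * w ^ 5 * psi q" "theta (w ^ 25) (residue_class 1 2) = 2 * w ^ 25 * psi (q ^ 5)"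
    using theta_odd_psi[OF n(1,2)] theta_odd_psi[OF n(3,4)] by (simp_all add: power_mult[symmetric] pw w(1))
  have "qpoch (- q) q = qpoch (- q) (q ^ 5) * qpoch (- (q ^ 2)) (q ^ 5) * qpoch (- (q ^ 3)) (q ^ 5) * qpoch (- (q ^ 4)) (q ^ 5) * qpoch (- (q ^ 5)) (q ^ 5)"
    using qpoch_split[OF assms(1), of 5 "- q"] by (simp add: eval_nat_numeral)
  then have P: "qpoch (- q) (q ^ 5) * qpoch (- (q ^ 2)) (q ^ 5) * qpoch (- (q ^ 3)) (q ^ 5) * qpoch (- (q ^ 4)) (q ^ 5) = 
    euler (q ^ 2) * euler (q ^ 5) / (euler q * euler (q ^ 10))"
    unfolding qpoch_uminus[OF assms(1)] qpoch_uminus[OF n(5)]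
    using euler_nonzero[OF assms(1)] euler_power_nonzero[OF assms(1)] by (simp add: power_mult[symmetric] field_simps)
  have e: "4 * w ^ 10 * (psi q)\<^sup>2 = 4 * w ^ 50 * (psi (q ^ 5))\<^sup>2 + 4 * w ^ 10 * ((euler (q ^ 5))\<^sup>2 *
     (qpoch (- q) (q ^ 5) * qpoch (- (q ^ 2)) (q ^ 5) * qpoch (- (q ^ 3)) (q ^ 5) * qpoch (- (q ^ 4)) (q ^ 5)))"
    using theta_odd_square[OF w(2,3)] unfolding s t
    by (simp add: power_mult_distrib power_mult[symmetric] power2_eq_square power_Suc[symmetric] mult_ac del: power_Suc)
  have "w ^ 50 = w ^ 10 * q" by (simp add: w(1)[symmetric] power_add[symmetric])
  then have "4 * w ^ 10 * (psi q)\<^sup>2 = 4 * w ^ 10 * (q * (psi (q ^ 5))\<^sup>2 + (euler (q ^ 5))\<^sup>2 * (euler (q ^ 2) * euler (q ^ 5) / (euler q * euler (q ^ 10))))"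
    using e unfolding P by (simp add: algebra_simps)
  then have "(psi q)\<^sup>2 = q * (psi (q ^ 5))\<^sup>2 + (euler (q ^ 5))\<^sup>2 * (euler (q ^ 2) * euler (q ^ 5) / (euler q * euler (q ^ 10)))"
    using w(3) by (simp only: mult_cancel_left) simp
  then show ?thesis by (simp add: power2_eq_square power3_eq_cube mult_ac)
qed

text \<open>As for \<open>psi_quintic\<close>: the classes 1 and 2 modulo 5 supply all odd exponents
  prime to 5, so that \<open>qpoch (- q) (q ^ 2)\<close> divided by its part at multiples of 5
  appears.\<close>

lemma phi_quintic:
  assumes "norm q < 1" "q \<noteq> 0"
  shows "(phi q)\<^sup>2 = (phi (q ^ 5))\<^sup>2 + 4 * q * ((euler (q ^ 2))\<^sup>2 * euler (q ^ 5) * euler (q ^ 20) / (euler q * euler (q ^ 4)))"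
proof -
  obtain w where w: "w ^ 5 = q" "norm w < 1" "w \<noteq> 0" using complex_root[OF assms, of 5] by auto
  have n: "norm (q ^ 2) < 1" "norm (q ^ 5) < 1"
    using norm_power_less_one[OF assms(1)] by auto
  have pw: "w ^ 50 = q ^ 10" "w ^ 35 = q ^ 7" "w ^ 15 = q ^ 3" "w ^ 45 = q ^ 9" "w ^ 25 = q ^ 5"
    by (simp_all add: w(1)[symmetric] power_mult[symmetric])
  have t: "theta w (residue_class 1 5) = w * (euler (q ^ 10) * qpoch (- (q ^ 7)) (q ^ 10) * qpoch (- (q ^ 3)) (q ^ 10))"
    "theta w (residue_class 2 5) = w ^ 4 * (euler (q ^ 10) * qpoch (- (q ^ 9)) (q ^ 10) * qpoch (- q) (q ^ 10))"
    using theta_jacobi[OF w(2,3), of 1 5] theta_jacobi[OF w(2,3), of 2 5] by (simp_all add: pw w(1))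
  have "qpoch (- q) (q ^ 2) = qpoch (- q) (q ^ 10) * qpoch (- (q ^ 3)) (q ^ 10) * qpoch (- (q ^ 5)) (q ^ 10) * qpoch (- (q ^ 7)) (q ^ 10) * qpoch (- (q ^ 9)) (q ^ 10)"
    using qpoch_split[OF n(1), of 5 "- q"] by (simp add: eval_nat_numeral mult_ac)
  moreover have "qpoch (- (q ^ 5)) (q ^ 10) = (euler (q ^ 10))\<^sup>2 / (euler (q ^ 5) * euler (q ^ 20))"
    using qpoch_uminus_odd[OF n(2)] by (simp add: power_mult[symmetric])
  ultimately have P: "(euler (q ^ 10))\<^sup>2 * (qpoch (- q) (q ^ 10) * qpoch (- (q ^ 3)) (q ^ 10) * qpoch (- (q ^ 7)) (q ^ 10) * qpoch (- (q ^ 9)) (q ^ 10)) = 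
    (euler (q ^ 2))\<^sup>2 * euler (q ^ 5) * euler (q ^ 20) / (euler q * euler (q ^ 4))"
    unfolding qpoch_uminus_odd[OF assms(1)]
    using euler_nonzero[OF assms(1)] euler_power_nonzero[OF assms(1)] by (simp add: field_simps)
  have "(phi q)\<^sup>2 = (phi (q ^ 5))\<^sup>2 + 4 * (w * w ^ 4) * ((euler (q ^ 10))\<^sup>2 * (qpoch (- q) (q ^ 10) * qpoch (- (q ^ 3)) (q ^ 10) * qpoch (- (q ^ 7)) (q ^ 10) * qpoch (- (q ^ 9)) (q ^ 10)))"
    using phi_theta_square[OF w(2,3)] unfolding w(1) pw t
    by (simp add: power2_eq_square mult_ac)
  also have "w * w ^ 4 = q" by (simp add: w(1)[symmetric] power_Suc[symmetric] del: power_Suc)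
  finally show ?thesis unfolding P .
qed

text \<open>The pentagonal number theorem, with the sign \<open>(- 1) ^ n\<close> of the exponent \<open>(6 n + 1)\<^sup>2\<close>
  expressed through the residue modulo 12.\<close>

lemma theta_pentagonal:
  assumes w: "norm w < 1" "w \<noteq> 0"
  shows "theta w (residue_class 1 12) - theta w (residue_class 7 12) = w * euler (w ^ 24)"
proof -
  define q where "q = w ^ 24"
  have q: "norm q < 1" using norm_power_less_one[OF w(1)] by (simp add: q_def)
  \<comment> \<open>The two powers of \<open>w\<close> come from
    \<open>36 * n\<^sup>2 + 12 * n + 1 = (6 * n + 1)\<^sup>2\<close>, and the minus sign produces
    the alternating signs.\<close>
  have "((\<lambda>n. (w ^ 36) powi (n\<^sup>2) * (- (w ^ 12)) powi n) has_sum
     (qpoch ((w ^ 36)\<^sup>2) ((w ^ 36)\<^sup>2) * qpoch (- (- (w ^ 12)) * w ^ 36) ((w ^ 36)\<^sup>2) * qpoch (- (w ^ 36) / (- (w ^ 12))) ((w ^ 36)\<^sup>2))) UNIV"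
    using norm_power_less_one[OF w(1)] w by (intro jacobi_triple_product) auto
  moreover have "(w ^ 36)\<^sup>2 = q ^ 3" "- (- (w ^ 12)) * w ^ 36 = q ^ 2" "- (w ^ 36) / (- (w ^ 12)) = q"
  proof -
    show "- (w ^ 36) / (- (w ^ 12)) = q"
      using w power_diff[of w 12 36] by (simp add: q_def)
  qed (simp_all add: q_def power_mult[symmetric] power_add[symmetric])
  moreover have "euler (q ^ 3) * qpoch (q ^ 2) (q ^ 3) * qpoch q (q ^ 3) = euler q"
    using qpoch_split[OF q, of 3 q] by (simp add: eval_nat_numeral mult_ac)
  ultimately have "((\<lambda>n. (w ^ 36) powi (n\<^sup>2) * (- (w ^ 12)) powi n) has_sum euler q) UNIV" by simp
  then have "((\<lambda>n. w * ((w ^ 36) powi (n\<^sup>2) * (- (w ^ 12)) powi n)) has_sum (w * euler q)) UNIV"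
    by (rule has_sum_cmult_right)
  moreover define f where "f n = (if n mod 12 = 1 then w powi (n\<^sup>2) else - (w powi (n\<^sup>2)))" for n :: int
  have "w * ((w ^ 36) powi (n\<^sup>2) * (- (w ^ 12)) powi n) = f (6 * n + 1)" for n
  proof -
    have "(w ^ 36) powi (n\<^sup>2) = w powi (int 36 * n\<^sup>2)" "(w ^ 12) powi n = w powi (int 12 * n)"
      by (simp_all only: power_int_mult power_int_of_nat)
    then have "w * ((w ^ 36) powi (n\<^sup>2) * (w ^ 12) powi n) = w powi (1 + (int 36 * n\<^sup>2 + int 12 * n))"
      using w(2) by (simp add: power_int_add)
    also have "1 + (int 36 * n\<^sup>2 + int 12 * n) = (6 * n + 1)\<^sup>2"
      by (simp add: power2_eq_square algebra_simps)
    finally have 1: "w * ((w ^ 36) powi (n\<^sup>2) * (w ^ 12) powi n) = w powi ((6 * n + 1)\<^sup>2)" .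
    show ?thesis
    proof (cases "even n")
      case True
      then obtain k where "n = 2 * k" by blast
      then have "(6 * n + 1) mod 12 = 1" by simp
      then show ?thesis using 1 True by (simp add: f_def power_int_minus_left)
    next
      case False
      then obtain k where "n = 2 * k + 1" by (rule oddE)
      then have "6 * n + 1 = 7 + 12 * k" by simp
      then have "(6 * n + 1) mod 12 = 7" by (simp only: mod_mult_self2) simp
      then show ?thesis using 1 False by (simp add: f_def power_int_minus_left)
    qed
  qed
  moreover have bij: "bij_betw (\<lambda>n. 6 * n + 1) UNIV (residue_class 1 6)"
    by (rule bij_betwI[where g = "\<lambda>k. k div 6"]) (auto simp: residue_class_def, presburger)
  ultimately have "(f has_sum (w * euler q)) (residue_class 1 6)"
    using has_sum_reindex_bij_betw[OF bij, of f] by simp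
  moreover have "residue_class 1 6 = residue_class 1 12 \<union> residue_class 7 12"
    unfolding residue_class_def by auto presburger+
  moreover have "(f has_sum (theta w (residue_class 1 12) + - theta w (residue_class 7 12))) (residue_class 1 12 \<union> residue_class 7 12)"
  proof (rule has_sum_Un_disjoint)
    show "(f has_sum theta w (residue_class 1 12)) (residue_class 1 12)"
      using has_sum_theta[OF w(1)] by (rule has_sum_cong[THEN iffD1, rotated]) (auto simp: f_def residue_class_def)
    show "(f has_sum - theta w (residue_class 7 12)) (residue_class 7 12)"
      using has_sum_uminusI[OF has_sum_theta[OF w(1)]] by (rule has_sum_cong[THEN iffD1, rotated]) (auto simp: f_def residue_class_def)
  qed (simp add: residue_class_disjoint)
  ultimately have "w * euler q = theta w (residue_class 1 12) + - theta w (residue_class 7 12)"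
    using has_sum_unique by fastforce
  then show ?thesis by (simp add: q_def)
qed

text \<open>At a root of order 24 both differences in \<open>phi_psi_theta\<close> are pentagonal
  series, with leading powers \<open>w\<close> and \<open>w ^ 5\<close>. Their product
  \<open>w ^ 6\<close> is also common to the left-hand side and cancels.\<close>

lemma phi_psi_quintic:
  assumes "norm q < 1" "q \<noteq> 0"
  shows "phi (q ^ 5) * psi (q ^ 2) - q * phi q * psi (q ^ 10) = euler q * euler (q ^ 5)"
proof -
  obtain w where w: "w ^ 24 = q" "norm w < 1" "w \<noteq> 0" using complex_root[OF assms, of 24] by auto
  have n: "norm (w ^ 5) < 1" "w ^ 5 \<noteq> 0" "norm (w ^ 6) < 1" "w ^ 6 \<noteq> 0" "norm (w ^ 30) < 1" "w ^ 30 \<noteq> 0"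
    using norm_power_less_one[OF w(2)] w(3) by auto
  have pw: "w ^ 48 = q ^ 2" "w ^ 240 = q ^ 10" "w ^ 120 = q ^ 5"
    by (simp_all add: w(1)[symmetric] power_mult[symmetric])
  have s: "theta (w ^ 6) (residue_class 1 2) = 2 * w ^ 6 * psi (q ^ 2)" "theta (w ^ 30) (residue_class 1 2) = 2 * w ^ 30 * psi (q ^ 10)"
    using theta_odd_psi[OF n(3,4)] theta_odd_psi[OF n(5,6)] by (simp_all add: power_mult[symmetric] pw w(1))
  have t: "theta w (residue_class 1 12) - theta w (residue_class 7 12) = w * euler q"
     "theta (w ^ 5) (residue_class 1 12) - theta (w ^ 5) (residue_class 7 12) = w ^ 5 * euler (q ^ 5)"
    using theta_pentagonal[OF w(2,3)] theta_pentagonal[OF n(1,2)] by (simp_all add: power_mult[symmetric] pw w(1))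
  have w30: "w ^ 30 = w ^ 6 * q" "w * w ^ 5 = w ^ 6" by (simp_all add: w(1)[symmetric] power_add[symmetric] power_Suc[symmetric] del: power_Suc)
  have "2 * w ^ 6 * psi (q ^ 2) * phi (q ^ 5) - phi q * (2 * w ^ 30 * psi (q ^ 10)) = 2 * (w * euler q) * (w ^ 5 * euler (q ^ 5))"
    using phi_psi_theta[OF w(2,3)] unfolding s t pw w(1) .
  also have "\<dots> = 2 * (w * w ^ 5) * (euler q * euler (q ^ 5))" by (simp only: mult_ac)
  finally have "(2 * w ^ 6) * (phi (q ^ 5) * psi (q ^ 2) - q * phi q * psi (q ^ 10)) = (2 * w ^ 6) * (euler q * euler (q ^ 5))"
    unfolding w30 by (simp add: algebra_simps)
  then show ?thesis using w(3) by (simp only: mult_cancel_left) simp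
qed

subsection \<open>Degree three\<close>

lemma psi_holomorphic: "psi holomorphic_on ball 0 1"
proof (rule holomorphic_uniform_sequence)
  show "(\<lambda>q. \<Sum>i<n. q ^ (i * (i + 1) div 2)) holomorphic_on ball (0::complex) 1" for n
    by (intro holomorphic_intros)
  fix x :: complex assume x: "x \<in> ball 0 1"
  define d where "d = (1 - norm x) / 2"
  have d: "d > 0" "norm x + d < 1" using x by (auto simp: d_def field_simps)
  have "norm y \<le> norm x + d" if "y \<in> cball x d" for y
    using that norm_triangle_sub[of y x] by (simp add: dist_norm norm_minus_commute)
  note le = this
  have "uniform_limit (cball x d) (\<lambda>n q. \<Sum>i<n. q ^ (i * (i + 1) div 2)) (\<lambda>q. \<Sum>i. q ^ (i * (i + 1) div 2)) sequentially"
  proof (rule Weierstrass_m_test)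
    show "summable (\<lambda>n. (norm x + d) ^ n)" using d by (intro summable_geometric) auto
    fix n y assume y: "y \<in> cball x d"
    have "norm (y ^ (n * (n + 1) div 2)) \<le> norm y ^ n"
      using le[OF y] d triangular_ge[of n] by (simp add: norm_power power_decreasing)
    also have "\<dots> \<le> (norm x + d) ^ n" using le[OF y] by (intro power_mono) auto
    finally show "norm (y ^ (n * (n + 1) div 2)) \<le> (norm x + d) ^ n" .
  qed
  moreover have "cball x d \<subseteq> ball 0 1" using le d by force
  ultimately show "\<exists>d>0. cball x d \<subseteq> ball 0 1 \<and> uniform_limit (cball x d) (\<lambda>n q. \<Sum>i<n. q ^ (i * (i + 1) div 2)) psi sequentially"
    using d unfolding psi_def by blast
qed auto

lemma psi_power_holomorphic: "(\<lambda>q. psi (q ^ n)) holomorphic_on ball 0 1" if "n > 0"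
proof -
  have "(psi \<circ> (\<lambda>q. q ^ n)) holomorphic_on ball 0 1"
    by (rule holomorphic_on_compose_gen[OF _ psi_holomorphic])
       (use that in \<open>auto intro!: holomorphic_intros simp: norm_power power_less_one_iff\<close>)
  then show ?thesis by (simp add: o_def)
qed

text \<open>The cubic relations at \<open>q\<close> and \<open>q\<^sup>2\<close> determine the quotient \<open>p\<close> below only up to
  the two branches \<open>p\<^sup>3 = (x - q y)\<^sup>3\<close> and \<open>p\<^sup>3 = - (x + q y)\<^sup>3\<close>.\<close>

lemma psi_branches:
  assumes "norm q < 1" "q \<noteq> 0"
  defines "x \<equiv> (psi (q ^ 2))\<^sup>2" and "y \<equiv> (psi (q ^ 6))\<^sup>2"
    and "p \<equiv> psi (q ^ 2) * psi (q ^ 3) ^ 3 / (psi q * psi (q ^ 6))"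
    and "r \<equiv> psi q ^ 3 * psi (q ^ 6) / (psi (q ^ 3) * psi (q ^ 2))"
  shows "(x * r - q * p * y) * p\<^sup>2 = (x\<^sup>2 - q\<^sup>2 * y\<^sup>2)\<^sup>2"
    and "(p ^ 3 - (x - q * y) ^ 3) * (p ^ 3 + (x + q * y) ^ 3) = 0"
proof -
  have n: "norm (q ^ 2) < 1" "q ^ 2 \<noteq> 0" "norm (q ^ 3) < 1" "q ^ 3 \<noteq> 0" "norm (q ^ 6) < 1" "q ^ 6 \<noteq> 0"
    using norm_power_less_one[OF assms(1)] assms(2) by auto
  define a b c d where "a = psi q" and "b = psi (q ^ 3)" and "c = psi (q ^ 2)" and "d = psi (q ^ 6)"
  have nz: "a \<noteq> 0" "b \<noteq> 0" "c \<noteq> 0" "d \<noteq> 0"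
    using psi_nonzero n assms(1) by (auto simp: a_def b_def c_def d_def)
  define z where "z = d * psi_A (q ^ 2) ^ 3"
  have e: "euler q \<noteq> 0" "euler (q ^ 2) \<noteq> 0" "euler (q ^ 3) \<noteq> 0" "euler (q ^ 4) \<noteq> 0" "euler (q ^ 6) \<noteq> 0" "euler (q ^ 12) \<noteq> 0"
    using euler_nonzero[OF assms(1)] euler_power_nonzero[OF assms(1)] by auto
  have pe: "a = (euler (q ^ 2))\<^sup>2 / euler q" "b = (euler (q ^ 6))\<^sup>2 / euler (q ^ 3)"
     "c = (euler (q ^ 4))\<^sup>2 / euler (q ^ 2)" "d = (euler (q ^ 12))\<^sup>2 / euler (q ^ 6)"
    unfolding a_def b_def c_def d_def psi_euler[OF assms(1,2)] psi_euler[OF n(1,2)] psi_euler[OF n(3,4)] psi_euler[OF n(5,6)]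
    by (simp_all add: power_mult[symmetric])
  have Ae: "psi_A q = euler (q ^ 2) * (euler (q ^ 3))\<^sup>2 / (euler q * euler (q ^ 6))"
     "psi_A (q ^ 2) = euler (q ^ 4) * (euler (q ^ 6))\<^sup>2 / (euler (q ^ 2) * euler (q ^ 12))"
     "phi_Omega q = (euler (q ^ 2))\<^sup>2 * euler (q ^ 3) * euler (q ^ 12) / (euler q * euler (q ^ 4) * euler (q ^ 6))"
    by (simp_all add: psi_A_def phi_Omega_def power_mult[symmetric])
  have ph: "phi q = a\<^sup>2 / c" "phi (q ^ 3) = b\<^sup>2 / d"
    using psi_square[OF assms(1,2)] psi_square[OF n(3,4)] nz
    by (simp_all add: a_def b_def c_def d_def power_mult[symmetric])
  have "a ^ 4 = b * psi_A q ^ 3 + q * b ^ 4"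
    using psi_quartic[OF assms(1,2)] by (simp add: a_def b_def)
  \<comment> \<open>A comparison of Euler exponents. It trades \<open>psi_A q\<close> for the
    companion at \<open>q ^ 2\<close> inside \<open>z\<close>, which the quartic relation at
    \<open>q ^ 2\<close> evaluates.\<close>
  moreover have "b * psi_A q ^ 3 * p\<^sup>2 * (c * d) = a * b * z\<^sup>2"
    unfolding p_def z_def a_def[symmetric] b_def[symmetric] c_def[symmetric] d_def[symmetric]
    unfolding pe Ae using e by (simp add: field_simps) (simp add: eval_nat_numeral)
  ultimately have 1: "(a ^ 4 - q * b ^ 4) * p\<^sup>2 * (c * d) = a * b * z\<^sup>2" by simp
  have 2: "z = x\<^sup>2 - q\<^sup>2 * y\<^sup>2"
    using psi_quartic[OF n(1,2)]
    by (simp add: z_def x_def y_def c_def d_def power_mult[symmetric])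
  have "(a\<^sup>2 / c) ^ 4 = (b\<^sup>2 / d) ^ 4 + 8 * q * (b\<^sup>2 / d * phi_Omega q ^ 3)"
    using phi_quartic[OF assms(1,2)] by (simp add: ph)
  moreover have "b\<^sup>2 / d * phi_Omega q ^ 3 * x = z * r"
    unfolding x_def r_def z_def a_def[symmetric] b_def[symmetric] c_def[symmetric] d_def[symmetric]
    unfolding pe Ae using e by (simp add: field_simps) (simp add: eval_nat_numeral)
  moreover have "(k - l) * x = 8 * q * (z * r)" if "k = l + 8 * q * m" "m * x = z * r" for k l m
    using that by algebra
  ultimately have 3: "((a\<^sup>2 / c) ^ 4 - (b\<^sup>2 / d) ^ 4) * x = 8 * q * (z * r)" by blast
  have z0: "z \<noteq> 0" unfolding z_def Ae using nz e by simp
  have pr: "p = c * b ^ 3 / (a * d)" by (simp add: p_def a_def b_def c_def d_def)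
  have r_eq: "r = a ^ 3 * d / (b * c)" by (simp add: r_def a_def b_def c_def d_def)
  have xy: "x = c\<^sup>2" "y = d\<^sup>2" by (simp_all add: x_def y_def c_def d_def)
  have 4: "(x * r - q * p * y) * p\<^sup>2 = z\<^sup>2"
  proof -
    have "(a ^ 4 - q * b ^ 4) * (c * d) = a * b * (x * r - q * p * y)"
      unfolding pr r_eq xy using nz by (simp add: field_simps power2_eq_square power3_eq_cube eval_nat_numeral)
    then have "a * b * ((x * r - q * p * y) * p\<^sup>2) = a * b * z\<^sup>2" using 1 by algebra
    then show ?thesis using nz by simp
  qed
  have 5: "p * (r\<^sup>2 - p\<^sup>2) = 8 * q * z * y"
  proof -
    have "((a\<^sup>2 / c) ^ 4 - (b\<^sup>2 / d) ^ 4) * x * y = r * (p * (r\<^sup>2 - p\<^sup>2))"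
      unfolding pr r_eq xy using nz by (simp add: field_simps power2_eq_square power3_eq_cube eval_nat_numeral)
    then have "r * (p * (r\<^sup>2 - p\<^sup>2)) = r * (8 * q * z * y)" using arg_cong[OF 3, of "\<lambda>v. v * y"] by (simp only: mult_ac)
    moreover have "r \<noteq> 0" using nz by (simp add: r_eq)
    ultimately show ?thesis by simp
  qed
  have x0: "x \<noteq> 0" and p0: "p \<noteq> 0" using nz by (auto simp: xy pr)
  have "z * ((p ^ 3 - (x - q * y) ^ 3) * (p ^ 3 + (x + q * y) ^ 3)) = 0"
  proof -
    \<comment> \<open>Eliminating \<open>r\<close> leaves a quadratic equation in
      \<open>p ^ 3\<close> whose coefficients share the factor \<open>z\<close>; after division its
      roots are \<open>(x - q * y) ^ 3\<close> and \<open>- ((x + q * y) ^ 3)\<close>.\<close>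
    have r: "x * p\<^sup>2 * r = z\<^sup>2 + q * y * p ^ 3" using 4 by algebra
    have "p * ((x * p\<^sup>2 * r)\<^sup>2 - x\<^sup>2 * p ^ 6) = 8 * q * z * y * x\<^sup>2 * p ^ 4" using 5 by algebra
    then have "p * ((z\<^sup>2 + q * y * p ^ 3)\<^sup>2 - x\<^sup>2 * p ^ 6) = p * (8 * q * z * y * x\<^sup>2 * p ^ 3)"
      unfolding r by (simp add: eval_nat_numeral mult_ac)
    then have "(z\<^sup>2 + q * y * p ^ 3)\<^sup>2 - x\<^sup>2 * p ^ 6 = 8 * q * z * y * x\<^sup>2 * p ^ 3" using p0 by simp
    then show ?thesis using 2 by algebra
  qed
  then show "(p ^ 3 - (x - q * y) ^ 3) * (p ^ 3 + (x + q * y) ^ 3) = 0" using z0 by simp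
  show "(x * r - q * p * y) * p\<^sup>2 = (x\<^sup>2 - q\<^sup>2 * y\<^sup>2)\<^sup>2" using 4 2 by simp
qed

text \<open>\<open>D\<close> is the wanted factor of the branch product, and \<open>G\<close>
  collects the rest, including the two conjugate factors of the first cubic. At \<open>q = 0\<close>
  every value of \<open>psi\<close> is 1, so \<open>G 0 = 3 * 2\<close>. Hence \<open>D\<close>
  vanishes near 0 and, by the identity theorem, on the whole disc.\<close>

lemma psi_cubic:
  assumes "norm q < 1"
  shows "psi q * psi (q ^ 6) * ((psi (q ^ 2))\<^sup>2 - q * (psi (q ^ 6))\<^sup>2) = psi (q ^ 2) * psi (q ^ 3) ^ 3"
proof -
  define x y p where "x q = (psi (q ^ 2))\<^sup>2" and "y q = (psi (q ^ 6))\<^sup>2"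
    and "p q = psi (q ^ 2) * psi (q ^ 3) ^ 3 / (psi q * psi (q ^ 6))" for q
  define D where "D q = p q - (x q - q * y q)" for q
  define G where "G q = ((p q)\<^sup>2 + p q * (x q - q * y q) + (x q - q * y q)\<^sup>2) * (p q ^ 3 + (x q + q * y q) ^ 3)" for q
  have nz: "psi (q ^ n) \<noteq> 0" if "q \<in> ball 0 1" "n > 0" for q n
    using that norm_power_less_one[of q n] by (intro psi_nonzero) auto
  have hp: "p holomorphic_on ball 0 1" and hx: "x holomorphic_on ball 0 1" and hy: "y holomorphic_on ball 0 1"
    unfolding p_def x_def y_def using nz[of _ 1] nz
    by (auto intro!: holomorphic_intros psi_power_holomorphic psi_holomorphic)
  have hD: "D holomorphic_on ball 0 1" unfolding D_def by (intro holomorphic_intros hp hx hy)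
  have hG: "G holomorphic_on ball 0 1" unfolding G_def by (intro holomorphic_intros hp hx hy)
  have DG: "D q * G q = 0" if "q \<in> ball 0 1" "q \<noteq> 0" for q
  proof -
    have "(p q ^ 3 - (x q - q * y q) ^ 3) * (p q ^ 3 + (x q + q * y q) ^ 3) = 0"
      using psi_branches(2)[of q] that unfolding x_def y_def p_def by simp
    then show ?thesis unfolding D_def G_def by algebra
  qed
  have "G 0 \<noteq> 0" by (simp add: G_def p_def x_def y_def psi_0)
  moreover have "isCont G 0"
    using continuous_on_interior[OF holomorphic_on_imp_continuous_on[OF hG], of 0] by simp
  ultimately have "eventually (\<lambda>q. G q \<noteq> 0) (at 0)"
    unfolding isCont_def by (intro tendsto_imp_eventually_ne)
  moreover have "eventually (\<lambda>q::complex. q \<in> ball 0 1) (at 0)"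
    by (intro eventually_at_in_open') auto
  \<comment> \<open>The branch relation is available only for \<open>q \<noteq> 0\<close>; a
    punctured neighbourhood still makes 0 a limit point of the zeros of \<open>D\<close>.\<close>
  moreover have "eventually (\<lambda>q::complex. q \<noteq> 0) (at 0)"
    by (rule eventually_neq_at_within)
  ultimately have "eventually (\<lambda>q. D q = 0) (at 0)"
    by eventually_elim (use DG in auto)
  moreover have "eventually (\<lambda>q::complex. q \<in> ball 0 1) (at 0)"
    by (intro eventually_at_in_open') auto
  ultimately have ev: "eventually (\<lambda>q. q \<in> {q \<in> ball 0 1. D q = 0}) (at 0)"
    by eventually_elim auto
  have "0 islimpt {q \<in> ball 0 1. D q = 0}"
    unfolding islimpt_iff_eventually
  proof
    assume "eventually (\<lambda>q. q \<notin> {q \<in> ball 0 1. D q = 0}) (at 0)"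
    with ev have "eventually (\<lambda>_. False) (at (0::complex))" by eventually_elim auto
    then show False by simp
  qed
  then have "D q = 0"
    by (rule analytic_continuation[OF hD, rotated 4]) (use assms in auto)
  then show ?thesis
    using nz[of q 1] nz[of q 6] assms by (simp add: D_def p_def x_def y_def field_simps)
qed

text \<open>Once \<open>p = x - q * y\<close> is known, the right-hand side of the first relation in
  \<open>psi_branches\<close> is \<open>p\<^sup>2 * (x + q * y)\<^sup>2\<close>. Cancelling
  \<open>p\<^sup>2\<close> and then \<open>x\<close> leaves
  \<open>r = x + 3 * q * y\<close>.\<close>

lemma psi_cubic':
  assumes "norm q < 1" "q \<noteq> 0"
  shows "psi q ^ 3 * psi (q ^ 6) = psi (q ^ 2) * psi (q ^ 3) * ((psi (q ^ 2))\<^sup>2 + 3 * q * (psi (q ^ 6))\<^sup>2)"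
proof -
  define x y p r where "x = (psi (q ^ 2))\<^sup>2" and "y = (psi (q ^ 6))\<^sup>2"
    and "p = psi (q ^ 2) * psi (q ^ 3) ^ 3 / (psi q * psi (q ^ 6))"
    and "r = psi q ^ 3 * psi (q ^ 6) / (psi (q ^ 3) * psi (q ^ 2))"
  have nz: "psi q \<noteq> 0" "psi (q ^ 2) \<noteq> 0" "psi (q ^ 3) \<noteq> 0" "psi (q ^ 6) \<noteq> 0"
    using assms norm_power_less_one[OF assms(1)] by (auto intro!: psi_nonzero)
  have p: "p = x - q * y"
    using psi_cubic[OF assms(1)] nz by (simp add: p_def x_def y_def field_simps)
  have "p \<noteq> 0" "x \<noteq> 0" using nz by (simp_all add: p_def x_def)
  have "(x * r - q * p * y) * p\<^sup>2 = (x\<^sup>2 - q\<^sup>2 * y\<^sup>2)\<^sup>2"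
    using psi_branches(1)[OF assms] by (simp only: x_def y_def p_def r_def)
  then have "p\<^sup>2 * (x * r) = p\<^sup>2 * (x * (x + 3 * q * y))"
    unfolding p by algebra
  then have "r = x + 3 * q * y" using \<open>p \<noteq> 0\<close> \<open>x \<noteq> 0\<close> by simp
  then show ?thesis using nz by (simp add: r_def x_def y_def field_simps)
qed

section \<open>A form of Jacobi's quartic identity\<close>

lemma phi_uminus:
  assumes "norm q < 1" "q \<noteq> 0"
  shows "phi (- q) = (euler q)\<^sup>2 / euler (q ^ 2)"
proof -
  have "phi (- q) = euler (q ^ 2) * (qpoch q (q ^ 2))\<^sup>2"
    using phi_product[of "- q"] assms by simp
  then show ?thesis
    using qpoch_odd[OF assms(1)] euler_power_nonzero[OF assms(1), of 2]
    by (simp add: field_simps power2_eq_square)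
qed

text \<open>With P = phi(q^2)^2 and Q = 4 q psi(q^4)^2 one has phi(q)^2 = P + Q, phi(-q)^2 = P - Q
  and 16 q psi(q^2)^4 = 4 P Q. The difference is therefore \<open>psi (q ^ 2) ^ 4\<close> times (P +
  Q)^2 - 4 P Q = (P - Q)^2.\<close>

lemma psi_eighth:
  assumes "norm q < 1" "q \<noteq> 0"
  shows "psi q ^ 8 - 16 * q * psi (q ^ 2) ^ 8 = psi (q ^ 2) ^ 4 * (euler q ^ 8 / euler (q ^ 2) ^ 4)"
proof -
  have n: "norm (q ^ 2) < 1" "q ^ 2 \<noteq> 0" "norm (- q) < 1" "- q \<noteq> 0"
    using assms norm_power_less_one[OF assms(1)] by auto
  have 1: "(phi q)\<^sup>2 = (phi (q ^ 2))\<^sup>2 + 4 * q * (psi (q ^ 4))\<^sup>2"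
    by (rule phi_square[OF assms])
  have 2: "(phi (- q))\<^sup>2 = (phi (q ^ 2))\<^sup>2 - 4 * q * (psi (q ^ 4))\<^sup>2"
    using phi_square[OF n(3,4)] by simp
  have 3: "(psi (q ^ 2))\<^sup>2 = phi (q ^ 2) * psi (q ^ 4)"
    using psi_square[OF n(1,2)] by (simp add: power_mult[symmetric])
  have 4: "(psi q)\<^sup>2 = phi q * psi (q ^ 2)" by (rule psi_square[OF assms])
  have 5: "(phi (- q)) ^ 4 = euler q ^ 8 / euler (q ^ 2) ^ 4"
    unfolding phi_uminus[OF assms] by (simp add: power_divide power_mult[symmetric])
  have "psi q ^ 8 - 16 * q * psi (q ^ 2) ^ 8 = psi (q ^ 2) ^ 4 * (phi (- q)) ^ 4"
    using 1 2 3 4 by algebra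
  then show ?thesis by (simp only: 5)
qed

subsection \<open>Algebraic relations in levels 12, 18 and 20\<close>

text \<open>Here \<open>a\<close>, \<open>b\<close>, \<open>x\<close>, \<open>y\<close> stand for
  \<Pi>_1, \<Pi>_3, \<Pi>_2, \<Pi>_6. The auxiliary \<open>k\<close> is a square root of a b / (x y)
  through which the squares of \<open>a\<close> and \<open>b\<close> become polynomials in
  \<open>x\<close> and \<open>y\<close>; \<open>k2\<close> is the one relation that remains between
  \<open>k\<close>, \<open>x\<close> and \<open>y\<close>.\<close>

lemma level12_algebra:
  fixes a b k x y :: complex
  assumes nz: "a \<noteq> 0" "b \<noteq> 0" "k \<noteq> 0" "x \<noteq> 0" "y \<noteq> 0"
    and a2: "a\<^sup>2 = k * x * (x + 3 * y)" and b2: "b\<^sup>2 = k * y * (x - y)" and ab: "a * b = k\<^sup>2 * x * y"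
    and k2: "k\<^sup>2 * x * y = (x - y) * (x + 3 * y)"
  shows "x\<^sup>2 + 2 * x * y = a * b + 3 * y\<^sup>2"
    and "(x * b\<^sup>2) / (y * a\<^sup>2) = (x - y) / (x + 3 * y)"
    and "x * b ^ 4 = y * (x - y) ^ 3 * (x + 3 * y)"
    and "y * a ^ 4 = x * (x - y) * (x + 3 * y) ^ 3"
    and "a * b * (a\<^sup>2 + 4 * x\<^sup>2)\<^sup>2 = x\<^sup>2 * (a - b) * (a + 3 * b) ^ 3"
    and "a * b * (a\<^sup>2 - 4 * x\<^sup>2)\<^sup>2 = x\<^sup>2 * (a + b) * (a - 3 * b) ^ 3"
    and "a * b * (b\<^sup>2 + 4 * y\<^sup>2)\<^sup>2 = y\<^sup>2 * (a - b) ^ 3 * (a + 3 * b)"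
    and "a * b * (b\<^sup>2 - 4 * y\<^sup>2)\<^sup>2 = y\<^sup>2 * (a + b) ^ 3 * (a - 3 * b)"
    and "x\<^sup>2 * (a ^ 4 + 18 * a\<^sup>2 * b\<^sup>2 - 27 * b ^ 4) = a * b * (a ^ 4 + 16 * x ^ 4)"
    and "y\<^sup>2 * (a ^ 4 - 6 * a\<^sup>2 * b\<^sup>2 - 3 * b ^ 4) = a * b * (b ^ 4 + 16 * y ^ 4)"
    and "(a\<^sup>2 - b\<^sup>2) ^ 4 * b * x ^ 3 * y = (x\<^sup>2 - y\<^sup>2)\<^sup>2 * a ^ 3 * (4 * y\<^sup>2 + a * b) ^ 3"
    and "b * y ^ 4 * (a\<^sup>2 - b\<^sup>2) ^ 4 = (x\<^sup>2 - y\<^sup>2)\<^sup>2 * (b ^ 3 + 4 * a * y\<^sup>2) ^ 3"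
    and "(a\<^sup>2 - b\<^sup>2) * (x - y) ^ 3 * y = b\<^sup>2 * (x\<^sup>2 - y\<^sup>2)\<^sup>2"
    and "x * b ^ 3 = a * y * (x - y)\<^sup>2"
    and "a ^ 3 * y = x * b * (x + 3 * y)\<^sup>2"
proof -
  have a4: "a ^ 4 = k\<^sup>2 * x\<^sup>2 * (x + 3 * y)\<^sup>2" and b4: "b ^ 4 = k\<^sup>2 * y\<^sup>2 * (x - y)\<^sup>2"
    using a2 b2 by algebra+
  have "b * (a * (x - y)) = b * (k * x * b)" using b2 ab by algebra
  then have lin1: "a * (x - y) = k * x * b" using nz by simp
  have "a * (b * (x + 3 * y)) = a * (k * y * a)" using a2 ab by algebra
  then have lin2: "b * (x + 3 * y) = k * y * a" using nz by simp
  have x3y: "x + 3 * y \<noteq> 0" using a2 nz by auto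
  have ab': "a * b = (x - y) * (x + 3 * y)" using ab k2 by simp
  \<comment> \<open>These perfect squares explain the high powers in the identities that contain
    \<open>a\<^sup>2 - b\<^sup>2\<close>.\<close>
  have diff: "a\<^sup>2 - b\<^sup>2 = k * (x + y)\<^sup>2" unfolding a2 b2 by algebra
  have sum: "4 * y\<^sup>2 + a * b = (x + y)\<^sup>2" unfolding ab' by algebra
  have a3: "a ^ 3 * (x - y)\<^sup>2 = k ^ 4 * x ^ 3 * y * b"
    using a2 lin1 k2 by algebra
  have "k * (x * (b ^ 3 + 4 * a * y\<^sup>2)) = k * (y * a * (x + y)\<^sup>2)"
    using b2 lin2 k2 by algebra
  then have s3: "x * (b ^ 3 + 4 * a * y\<^sup>2) = y * a * (x + y)\<^sup>2" using nz by simp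
  show "x\<^sup>2 + 2 * x * y = a * b + 3 * y\<^sup>2" unfolding ab' by algebra
  show "(x * b\<^sup>2) / (y * a\<^sup>2) = (x - y) / (x + 3 * y)"
    unfolding a2 b2 using nz x3y by (subst frac_eq_eq) (simp, simp, algebra)
  show "x * b ^ 4 = y * (x - y) ^ 3 * (x + 3 * y)" unfolding b4 using k2 by algebra
  show "y * a ^ 4 = x * (x - y) * (x + 3 * y) ^ 3" unfolding a4 using k2 by algebra
  have q1: "k\<^sup>2 * x\<^sup>2 * (a ^ 4 + 18 * a\<^sup>2 * b\<^sup>2 - 27 * b ^ 4) = k\<^sup>2 * (a * b) * (a ^ 4 + 16 * x ^ 4)"
  proof -
    have "x\<^sup>2 * (k\<^sup>2 * x\<^sup>2 * (x + 3 * y)\<^sup>2 + 18 * (k\<^sup>2 * x * y)\<^sup>2 - 27 * (k\<^sup>2 * y\<^sup>2 * (x - y)\<^sup>2)) =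
      (k\<^sup>2 * x * y) * (k\<^sup>2 * x\<^sup>2 * (x + 3 * y)\<^sup>2 + 16 * x ^ 4)"
      using k2 by algebra
    moreover have "a\<^sup>2 * b\<^sup>2 = (k\<^sup>2 * x * y)\<^sup>2" unfolding ab[symmetric] by (simp add: power_mult_distrib)
    ultimately show ?thesis unfolding a4 b4 ab by (simp add: mult.assoc)
  qed
  then show r1: "x\<^sup>2 * (a ^ 4 + 18 * a\<^sup>2 * b\<^sup>2 - 27 * b ^ 4) = a * b * (a ^ 4 + 16 * x ^ 4)"
    using nz by (simp add: mult.assoc)
  have q2: "k\<^sup>2 * y\<^sup>2 * (a ^ 4 - 6 * a\<^sup>2 * b\<^sup>2 - 3 * b ^ 4) = k\<^sup>2 * (a * b) * (b ^ 4 + 16 * y ^ 4)"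
  proof -
    have "y\<^sup>2 * (k\<^sup>2 * x\<^sup>2 * (x + 3 * y)\<^sup>2 - 6 * (k\<^sup>2 * x * y)\<^sup>2 - 3 * (k\<^sup>2 * y\<^sup>2 * (x - y)\<^sup>2)) =
      (k\<^sup>2 * x * y) * (k\<^sup>2 * y\<^sup>2 * (x - y)\<^sup>2 + 16 * y ^ 4)"
      using k2 by algebra
    moreover have "a\<^sup>2 * b\<^sup>2 = (k\<^sup>2 * x * y)\<^sup>2" unfolding ab[symmetric] by (simp add: power_mult_distrib)
    ultimately show ?thesis unfolding a4 b4 ab by (simp add: mult.assoc)
  qed
  then show r2: "y\<^sup>2 * (a ^ 4 - 6 * a\<^sup>2 * b\<^sup>2 - 3 * b ^ 4) = a * b * (b ^ 4 + 16 * y ^ 4)"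
    using nz by (simp add: mult.assoc)
  \<comment> \<open>On expansion the terms that change with the sign agree on both sides,
    \<open>8 * a ^ 3 * b * x\<^sup>2\<close> in the first pair and
    \<open>8 * a * b ^ 3 * y\<^sup>2\<close> in the second. What remains is \<open>r1\<close> and
    \<open>r2\<close>.\<close>
  show "a * b * (a\<^sup>2 + 4 * x\<^sup>2)\<^sup>2 = x\<^sup>2 * (a - b) * (a + 3 * b) ^ 3"
    "a * b * (a\<^sup>2 - 4 * x\<^sup>2)\<^sup>2 = x\<^sup>2 * (a + b) * (a - 3 * b) ^ 3"
    "a * b * (b\<^sup>2 + 4 * y\<^sup>2)\<^sup>2 = y\<^sup>2 * (a - b) ^ 3 * (a + 3 * b)"
    "a * b * (b\<^sup>2 - 4 * y\<^sup>2)\<^sup>2 = y\<^sup>2 * (a + b) ^ 3 * (a - 3 * b)"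
    using r1 r2 by algebra+
  show "(a\<^sup>2 - b\<^sup>2) ^ 4 * b * x ^ 3 * y = (x\<^sup>2 - y\<^sup>2)\<^sup>2 * a ^ 3 * (4 * y\<^sup>2 + a * b) ^ 3"
    unfolding diff sum using a3 by algebra
  \<comment> \<open>The factor \<open>x ^ 3\<close> allows the cube on the right to be replaced by
    means of \<open>s3\<close>.\<close>
  have "x ^ 3 * (b * y ^ 4 * (a\<^sup>2 - b\<^sup>2) ^ 4) = x ^ 3 * ((x\<^sup>2 - y\<^sup>2)\<^sup>2 * (b ^ 3 + 4 * a * y\<^sup>2) ^ 3)"
    unfolding diff using a3 s3 by algebra
  then show "b * y ^ 4 * (a\<^sup>2 - b\<^sup>2) ^ 4 = (x\<^sup>2 - y\<^sup>2)\<^sup>2 * (b ^ 3 + 4 * a * y\<^sup>2) ^ 3"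
    using nz by simp
  show "(a\<^sup>2 - b\<^sup>2) * (x - y) ^ 3 * y = b\<^sup>2 * (x\<^sup>2 - y\<^sup>2)\<^sup>2"
    unfolding diff unfolding b2 by algebra
  show "x * b ^ 3 = a * y * (x - y)\<^sup>2" using b2 lin1 by algebra
  show "a ^ 3 * y = x * b * (x + 3 * y)\<^sup>2" using a2 lin2 by algebra
qed

text \<open>Here \<open>s\<close> and \<open>u\<close> are the square roots of \<Pi>_1 and \<Pi>_9,
  and \<open>b\<close> is \<Pi>_3. In the cubic relation \<open>u ^ 4\<close> cancels, so
  \<open>b\<^sup>2\<close> is a polynomial in \<open>s\<close> and \<open>u\<close>; both
  \<open>b\<^sup>2 + 3 * s\<^sup>2 * u\<^sup>2\<close> and
  \<open>(s\<^sup>2)\<^sup>2 - b\<^sup>2\<close> then factor, with common factor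
  \<open>s * (s\<^sup>2 + 3 * u\<^sup>2)\<close>.\<close>

lemma level18_algebra:
  fixes s u b :: complex
  assumes nz: "s \<noteq> 0" "u \<noteq> 0" "b \<noteq> 0"
    and cubic: "u * (s - u) ^ 3 = b\<^sup>2 - (u\<^sup>2)\<^sup>2"
  shows "b\<^sup>2 + 3 * s\<^sup>2 * u\<^sup>2 = s * u * (s\<^sup>2 + 3 * u\<^sup>2)"
    and "(u\<^sup>2)\<^sup>2 * ((s\<^sup>2)\<^sup>2 - b\<^sup>2) ^ 3 = (b\<^sup>2 - (u\<^sup>2)\<^sup>2) * (b\<^sup>2 + 3 * s\<^sup>2 * u\<^sup>2) ^ 3"
    and "u\<^sup>2 * ((s\<^sup>2)\<^sup>2 - b\<^sup>2) ^ 6 = (s\<^sup>2) ^ 3 * (b\<^sup>2 - (u\<^sup>2)\<^sup>2)\<^sup>2 * (s\<^sup>2 + 3 * u\<^sup>2) ^ 6"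
    and "6 * (s\<^sup>2 / b) + 3 * (b / s\<^sup>2) - (s\<^sup>2) ^ 3 / b ^ 3 = 27 * ((u\<^sup>2) ^ 3 / b ^ 3) - 18 * (u\<^sup>2 / b) - b / u\<^sup>2"
proof -
  show sum: "b\<^sup>2 + 3 * s\<^sup>2 * u\<^sup>2 = s * u * (s\<^sup>2 + 3 * u\<^sup>2)" using cubic by algebra
  have d1: "(s\<^sup>2)\<^sup>2 - b\<^sup>2 = s * (s - u) * (s\<^sup>2 + 3 * u\<^sup>2)" using cubic by algebra
  show "(u\<^sup>2)\<^sup>2 * ((s\<^sup>2)\<^sup>2 - b\<^sup>2) ^ 3 = (b\<^sup>2 - (u\<^sup>2)\<^sup>2) * (b\<^sup>2 + 3 * s\<^sup>2 * u\<^sup>2) ^ 3"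
    unfolding sum d1 cubic[symmetric] by (simp add: power_mult_distrib eval_nat_numeral)
  show "u\<^sup>2 * ((s\<^sup>2)\<^sup>2 - b\<^sup>2) ^ 6 = (s\<^sup>2) ^ 3 * (b\<^sup>2 - (u\<^sup>2)\<^sup>2)\<^sup>2 * (s\<^sup>2 + 3 * u\<^sup>2) ^ 6"
    unfolding d1 cubic[symmetric] by (simp add: power_mult_distrib power_mult[symmetric])
  \<comment> \<open>Over the common denominator \<open>s ^ 2 * u ^ 2 * b ^ 3\<close> the numerators
    contain only even powers of \<open>b\<close>, hence are polynomials in \<open>c\<close>,
    \<open>s\<close> and \<open>u\<close>.\<close>
  define c where "c = b\<^sup>2"
  have c: "c = u * (s - u) ^ 3 + u ^ 4" using cubic unfolding c_def by algebra
  have "s ^ 2 * u ^ 2 * (6 * s ^ 2 * c - s ^ 6) + 3 * u ^ 2 * c ^ 2 = s ^ 2 * u ^ 2 * (27 * u ^ 6 - 18 * u ^ 2 * c) - s ^ 2 * c ^ 2"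
    unfolding c by algebra
  then have "6 * s ^ 4 * u ^ 2 * b ^ 2 + 3 * u ^ 2 * b ^ 4 - s ^ 8 * u ^ 2 = 27 * u ^ 8 * s ^ 2 - 18 * u ^ 4 * s ^ 2 * b ^ 2 - s ^ 2 * b ^ 4"
    unfolding c_def by algebra
  then have "(6 * s ^ 4 * u ^ 2 * b ^ 2 + 3 * u ^ 2 * b ^ 4 - s ^ 8 * u ^ 2) / (s ^ 2 * u ^ 2 * b ^ 3) =
    (27 * u ^ 8 * s ^ 2 - 18 * u ^ 4 * s ^ 2 * b ^ 2 - s ^ 2 * b ^ 4) / (s ^ 2 * u ^ 2 * b ^ 3)"
    by simp
  moreover have "(6 * s ^ 4 * u ^ 2 * b ^ 2 + 3 * u ^ 2 * b ^ 4 - s ^ 8 * u ^ 2) / (s ^ 2 * u ^ 2 * b ^ 3) =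
     6 * (s\<^sup>2 / b) + 3 * (b / s\<^sup>2) - (s\<^sup>2) ^ 3 / b ^ 3"
    using nz by (simp add: divide_simps) (simp add: algebra_simps eval_nat_numeral)
  moreover have "(27 * u ^ 8 * s ^ 2 - 18 * u ^ 4 * s ^ 2 * b ^ 2 - s ^ 2 * b ^ 4) / (s ^ 2 * u ^ 2 * b ^ 3) =
     27 * ((u\<^sup>2) ^ 3 / b ^ 3) - 18 * (u\<^sup>2 / b) - b / u\<^sup>2"
    using nz by (simp add: divide_simps) (simp add: algebra_simps eval_nat_numeral)
  ultimately show "6 * (s\<^sup>2 / b) + 3 * (b / s\<^sup>2) - (s\<^sup>2) ^ 3 / b ^ 3 = 27 * ((u\<^sup>2) ^ 3 / b ^ 3) - 18 * (u\<^sup>2 / b) - b / u\<^sup>2"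
    by simp
qed

text \<open>The evaluation of \<open>a\<^sup>2 - 5 * q * b\<^sup>2\<close> comes from its product
  with \<open>a\<^sup>2 - q * b\<^sup>2\<close>: the second claim makes that product a square,
  \<open>phi_psi_quintic\<close> identifies the square as \<open>(e1 * e5)\<^sup>2\<close>, and
  \<open>psi_quintic\<close> evaluates the other factor.\<close>

lemma psi_quintic':
  assumes "norm q < 1" "q \<noteq> 0"
  shows "(psi q)\<^sup>2 = 5 * q * (psi (q ^ 5))\<^sup>2 + euler q ^ 3 * euler (q ^ 10) / (euler (q ^ 2) * euler (q ^ 5))"
    and "((psi q)\<^sup>2 - q * (psi (q ^ 5))\<^sup>2) * ((psi q)\<^sup>2 - 5 * q * (psi (q ^ 5))\<^sup>2) * (psi (q ^ 2))\<^sup>2 * (psi (q ^ 10))\<^sup>2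
      = ((psi (q ^ 5))\<^sup>2 * (psi (q ^ 2))\<^sup>2 - q * (psi q)\<^sup>2 * (psi (q ^ 10))\<^sup>2)\<^sup>2"
proof -
  have n: "norm (q ^ 2) < 1" "q ^ 2 \<noteq> 0" "norm (q ^ 5) < 1" "q ^ 5 \<noteq> 0"
    using norm_power_less_one[OF assms(1)] assms(2) by auto
  define a b c d where "a = psi q" and "b = psi (q ^ 5)" and "c = psi (q ^ 2)" and "d = psi (q ^ 10)"
  have nz: "c \<noteq> 0" "d \<noteq> 0"
    using norm_power_less_one[OF assms(1)] by (auto simp: c_def d_def intro!: psi_nonzero)
  define e1 e2 e4 e5 e10 e20 where "e1 = euler q" and "e2 = euler (q ^ 2)" and "e4 = euler (q ^ 4)"
    and "e5 = euler (q ^ 5)" and "e10 = euler (q ^ 10)" and "e20 = euler (q ^ 20)"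
  note e_defs = e1_def e2_def e4_def e5_def e10_def e20_def
  have e: "e1 \<noteq> 0" "e2 \<noteq> 0" "e4 \<noteq> 0" "e5 \<noteq> 0" "e10 \<noteq> 0" "e20 \<noteq> 0"
    using euler_nonzero[OF assms(1)] euler_power_nonzero[OF assms(1)] by (auto simp: e_defs)
  have f1: "a\<^sup>2 - q * b\<^sup>2 = e2 * e5 ^ 3 / (e1 * e10)"
    using psi_quintic[OF assms] by (simp add: a_def b_def e_defs)
  have f2: "c\<^sup>2 - q\<^sup>2 * d\<^sup>2 = e4 * e10 ^ 3 / (e2 * e20)"
    using psi_quintic[OF n(1,2)] by (simp add: c_def d_def e_defs power_mult[symmetric])
  have ph: "phi q = a\<^sup>2 / c" "phi (q ^ 5) = b\<^sup>2 / d"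
    using psi_square[OF assms] psi_square[OF n(3,4)] nz
    by (simp_all add: a_def b_def c_def d_def power_mult[symmetric])
  have f4: "(a\<^sup>2 / c)\<^sup>2 - (b\<^sup>2 / d)\<^sup>2 = 4 * q * (e2\<^sup>2 * e5 * e20 / (e1 * e4))"
    using phi_quintic[OF assms] by (simp add: ph e_defs)
  have "b\<^sup>2 / d * c - q * (a\<^sup>2 / c) * d = e1 * e5"
    using phi_psi_quintic[OF assms] by (simp add: ph e_defs c_def d_def)
  then have f3: "b\<^sup>2 * c\<^sup>2 - q * a\<^sup>2 * d\<^sup>2 = e1 * e5 * (c * d)"
    using nz by (simp add: field_simps power2_eq_square)
  have be: "b\<^sup>2 = (e10\<^sup>2 / e5)\<^sup>2"
    using psi_euler[OF n(3,4)] by (simp add: b_def e_defs power_mult[symmetric])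
  have "((a\<^sup>2 / c)\<^sup>2 - (b\<^sup>2 / d)\<^sup>2) * (c\<^sup>2 - q\<^sup>2 * d\<^sup>2) = 4 * q * (b\<^sup>2 * (a\<^sup>2 - q * b\<^sup>2))"
    unfolding f4 f2 f1 unfolding be using e by (simp add: field_simps eval_nat_numeral)
  moreover have "((a\<^sup>2 / c)\<^sup>2 - (b\<^sup>2 / d)\<^sup>2) * (c\<^sup>2 * d\<^sup>2) = a ^ 4 * d\<^sup>2 - b ^ 4 * c\<^sup>2"
    using nz by (simp add: field_simps)
  moreover have "w * g = v * h" if "f * g = v" "f * h = w" for f g h v w :: complex
    using that by (auto simp: mult_ac)
  ultimately have "(a ^ 4 * d\<^sup>2 - b ^ 4 * c\<^sup>2) * (c\<^sup>2 - q\<^sup>2 * d\<^sup>2) = 4 * q * (b\<^sup>2 * (a\<^sup>2 - q * b\<^sup>2)) * (c\<^sup>2 * d\<^sup>2)"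
    by blast
  \<comment> \<open>Subtracting \<open>2 * q * a\<^sup>2 * b\<^sup>2 * c\<^sup>2 * d\<^sup>2\<close>
    completes the square on one side and leaves \<open>a ^ 4 - 6 * q * a\<^sup>2 * b\<^sup>2 + 5 *
    q\<^sup>2 * b ^ 4\<close> on the other, which factors; this is the origin of the 5.\<close>
  then have key: "(a\<^sup>2 - q * b\<^sup>2) * (a\<^sup>2 - 5 * q * b\<^sup>2) * c\<^sup>2 * d\<^sup>2 = (b\<^sup>2 * c\<^sup>2 - q * a\<^sup>2 * d\<^sup>2)\<^sup>2"
    by algebra
  then show "((psi q)\<^sup>2 - q * (psi (q ^ 5))\<^sup>2) * ((psi q)\<^sup>2 - 5 * q * (psi (q ^ 5))\<^sup>2) * (psi (q ^ 2))\<^sup>2 * (psi (q ^ 10))\<^sup>2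
      = ((psi (q ^ 5))\<^sup>2 * (psi (q ^ 2))\<^sup>2 - q * (psi q)\<^sup>2 * (psi (q ^ 10))\<^sup>2)\<^sup>2"
    by (simp only: a_def b_def c_def d_def)
  have "(c * d)\<^sup>2 * ((a\<^sup>2 - q * b\<^sup>2) * (a\<^sup>2 - 5 * q * b\<^sup>2)) = (c * d)\<^sup>2 * (e1 * e5)\<^sup>2"
    using key unfolding f3 by algebra
  then have "(a\<^sup>2 - q * b\<^sup>2) * (a\<^sup>2 - 5 * q * b\<^sup>2) = (e1 * e5)\<^sup>2" using nz by simp
  moreover have "(e1 * e5)\<^sup>2 = (a\<^sup>2 - q * b\<^sup>2) * (e1 ^ 3 * e10 / (e2 * e5))"
    unfolding f1 using e by (simp add: field_simps eval_nat_numeral)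
  moreover have "a\<^sup>2 - q * b\<^sup>2 \<noteq> 0" unfolding f1 using e by simp
  ultimately have "a\<^sup>2 - 5 * q * b\<^sup>2 = e1 ^ 3 * e10 / (e2 * e5)"
    by (metis mult_left_cancel)
  then show "(psi q)\<^sup>2 = 5 * q * (psi (q ^ 5))\<^sup>2 + euler q ^ 3 * euler (q ^ 10) / (euler (q ^ 2) * euler (q ^ 5))"
    by (simp add: a_def b_def e_defs algebra_simps)
qed

text \<open>Here \<open>a\<close>, \<open>b\<close>, \<open>x\<close>, \<open>y\<close> are \<Pi>_1,
  \<Pi>_5, \<Pi>_2, \<Pi>_10, and \<open>T\<close> is the fourth root of the nome. Every factor in
  the four identities is a monomial in \<open>T\<close> and Euler products, up to sign and powers of
  \<open>x\<close> or \<open>y\<close>, so only exponents have to be compared. The sign of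
  \<open>5 * y - x\<close> or \<open>5 * b - a\<close> is restored at the end.\<close>

lemma level20_algebra:
  fixes a b x y T e1 e2 e4 e5 e10 e20 :: complex
  assumes e: "e1 \<noteq> 0" "e2 \<noteq> 0" "e4 \<noteq> 0" "e5 \<noteq> 0" "e10 \<noteq> 0" "e20 \<noteq> 0"
    and a: "a = T * (e2\<^sup>2 / e1)\<^sup>2" and x: "x = T\<^sup>2 * (e4\<^sup>2 / e2)\<^sup>2"
    and b: "b = T ^ 5 * (e10\<^sup>2 / e5)\<^sup>2" and y: "y = T ^ 10 * (e20\<^sup>2 / e10)\<^sup>2"
    and ab: "a - b = T * (e2 * e5 ^ 3 / (e1 * e10))" "a - 5 * b = T * (e1 ^ 3 * e10 / (e2 * e5))"
    and xy: "x - y = T\<^sup>2 * (e4 * e10 ^ 3 / (e2 * e20))" "x - 5 * y = T\<^sup>2 * (e2 ^ 3 * e20 / (e4 * e10))"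
    and ax: "a ^ 4 - 16 * x ^ 4 = x\<^sup>2 * (e1 ^ 8 / e2 ^ 4)" and byy: "b ^ 4 - 16 * y ^ 4 = y\<^sup>2 * (e5 ^ 8 / e10 ^ 4)"
  shows "x * b ^ 4 * (16 * y ^ 4 - b ^ 4) = y ^ 3 * (5 * y - x) * (x - y) ^ 5"
    and "y * a ^ 4 * (16 * x ^ 4 - a ^ 4) = x ^ 3 * (5 * y - x) ^ 5 * (x - y)"
    and "a * b * (16 * x ^ 4 - a ^ 4)\<^sup>2 = x ^ 4 * (5 * b - a) ^ 5 * (b - a)"
    and "a * b * (16 * y ^ 4 - b ^ 4)\<^sup>2 = y ^ 4 * (5 * b - a) * (b - a) ^ 5"
proof -
  have "x * b ^ 4 * (e5 ^ 8 / e10 ^ 4) = y * (x - 5 * y) * (x - y) ^ 5"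
    unfolding xy unfolding x b y using e
    by (simp add: field_simps power_mult_distrib power_mult[symmetric]) (simp add: eval_nat_numeral)
  then have "x * b ^ 4 * (b ^ 4 - 16 * y ^ 4) = y ^ 3 * (x - 5 * y) * (x - y) ^ 5"
    unfolding byy by algebra
  then show "x * b ^ 4 * (16 * y ^ 4 - b ^ 4) = y ^ 3 * (5 * y - x) * (x - y) ^ 5" by algebra
  have "y * a ^ 4 * (e1 ^ 8 / e2 ^ 4) = x * (x - 5 * y) ^ 5 * (x - y)"
    unfolding xy unfolding x a y using e
    by (simp add: field_simps power_mult_distrib power_mult[symmetric]) (simp add: eval_nat_numeral)
  then have "y * a ^ 4 * (a ^ 4 - 16 * x ^ 4) = x ^ 3 * (x - 5 * y) ^ 5 * (x - y)"
    unfolding ax by algebra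
  then show "y * a ^ 4 * (16 * x ^ 4 - a ^ 4) = x ^ 3 * (5 * y - x) ^ 5 * (x - y)" by algebra
  have "a * b * (e1 ^ 8 / e2 ^ 4)\<^sup>2 = (a - 5 * b) ^ 5 * (a - b)"
    unfolding ab unfolding a b using e
    by (simp add: field_simps power_mult_distrib power_mult[symmetric]) (simp add: eval_nat_numeral)
  then have "a * b * (a ^ 4 - 16 * x ^ 4)\<^sup>2 = x ^ 4 * (a - 5 * b) ^ 5 * (a - b)"
    unfolding ax by algebra
  then show "a * b * (16 * x ^ 4 - a ^ 4)\<^sup>2 = x ^ 4 * (5 * b - a) ^ 5 * (b - a)" by algebra
  have "a * b * (e5 ^ 8 / e10 ^ 4)\<^sup>2 = (a - 5 * b) * (a - b) ^ 5"
    unfolding ab unfolding a b using e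
    by (simp add: field_simps power_mult_distrib power_mult[symmetric]) (simp add: eval_nat_numeral)
  then have "a * b * (b ^ 4 - 16 * y ^ 4)\<^sup>2 = y ^ 4 * (a - 5 * b) * (a - b) ^ 5"
    unfolding byy by algebra
  then show "a * b * (16 * y ^ 4 - b ^ 4)\<^sup>2 = y ^ 4 * (5 * b - a) * (b - a) ^ 5" by algebra
qed

section \<open>From the nome to functions of z\<close>

lemma qpow_power: "qpow r z ^ n = qpow (real n * r) z"
  unfolding qpow_def exp_of_nat_mult[symmetric] by (simp add: mult_ac)

lemma qpow_of_nat_mult: "qpow r (of_nat n * z) = qpow r z ^ n"
  unfolding qpow_def exp_of_nat_mult[symmetric] by (simp add: mult_ac)

lemma norm_qpow_less_one: "Im z > 0 \<Longrightarrow> r > 0 \<Longrightarrow> norm (qpow r z) < 1"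
  by (simp add: qpow_def norm_exp_eq_Re)

text \<open>Links the product that defines \<Pi> with the series that defines its square root:
  Gauss's product for \<open>psi\<close>, rewritten through \<open>qpoch_odd\<close>.\<close>

lemma PiQ_eq:
  assumes "Im z > 0" "n > 0"
  shows "PiQ n z = (sqrt_PiQ n z)\<^sup>2"
proof -
  define r where "r = qpow 1 z ^ n"
  have q: "norm (qpow 1 z) < 1" using norm_qpow_less_one[OF assms(1)] by simp
  have r: "norm r < 1" "r \<noteq> 0"
    using norm_power_less_one[OF q assms(2)] by (simp_all add: r_def qpow_def)
  have "qpow (1/4) z ^ n = (qpow (real n / 8) z)\<^sup>2"
    by (simp add: qpow_power)
  moreover have "(psi r)\<^sup>2 = (qpoch (r\<^sup>2) (r\<^sup>2))\<^sup>2 / (qpoch r (r\<^sup>2))\<^sup>2"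
  proof -
    have "psi r = euler (r\<^sup>2) / qpoch r (r\<^sup>2)"
      using euler_power_nonzero[OF r(1), of 2]
      unfolding psi_euler[OF r] qpoch_odd[OF r(1), symmetric] by (simp add: power2_eq_square)
    then show ?thesis by (simp add: power_divide)
  qed
  ultimately show ?thesis
    by (simp add: PiQ_def PiQ_base_def sqrt_PiQ_def qpow_of_nat_mult Let_def r_def[symmetric] power_mult_distrib)
qed

theorem theorem1p2:
  fixes z :: complex
  assumes "Im z > 0"
  shows "
    ((PiQ 1 z)^2 / (PiQ 2 z * PiQ 4 z) - (PiQ 2 z)^2 / (PiQ 4 z)^2
       = 4) \<and>
    ((PiQ 2 z)^2 + 2 * PiQ 2 z * PiQ 6 z
       = PiQ 1 z * PiQ 3 z + 3 * (PiQ 6 z)^2) \<and>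
    ((PiQ 2 z * (PiQ 3 z)^2) / (PiQ 6 z * (PiQ 1 z)^2)
       = (PiQ 2 z - PiQ 6 z) / (PiQ 2 z + 3 * PiQ 6 z)) \<and>
    ((sqrt_PiQ 2 z * sqrt_PiQ 6 z) * ((PiQ 1 z)^2 - 3 * (PiQ 3 z)^2)
       = (sqrt_PiQ 1 z * sqrt_PiQ 3 z) * ((PiQ 2 z)^2 + 3 * (PiQ 6 z)^2)) \<and>
    (PiQ 2 z * (PiQ 3 z)^4
       = PiQ 6 z * (PiQ 2 z - PiQ 6 z)^3 * (PiQ 2 z + 3 * PiQ 6 z)) \<and>
    (PiQ 6 z * (PiQ 1 z)^4
       = PiQ 2 z * (PiQ 2 z - PiQ 6 z) * (PiQ 2 z + 3 * PiQ 6 z)^3) \<and>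
    (PiQ 1 z * PiQ 3 z * ((PiQ 1 z)^2 + 4 * (PiQ 2 z)^2)^2
       = (PiQ 2 z)^2 * (PiQ 1 z - PiQ 3 z) * (PiQ 1 z + 3 * PiQ 3 z)^3) \<and>
    (PiQ 1 z * PiQ 3 z * ((PiQ 1 z)^2 - 4 * (PiQ 2 z)^2)^2
       = (PiQ 2 z)^2 * (PiQ 1 z + PiQ 3 z) * (PiQ 1 z - 3 * PiQ 3 z)^3) \<and>
    (PiQ 1 z * PiQ 3 z * ((PiQ 3 z)^2 + 4 * (PiQ 6 z)^2)^2
       = (PiQ 6 z)^2 * (PiQ 1 z - PiQ 3 z)^3 * (PiQ 1 z + 3 * PiQ 3 z)) \<and>
    (PiQ 1 z * PiQ 3 z * ((PiQ 3 z)^2 - 4 * (PiQ 6 z)^2)^2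
       = (PiQ 6 z)^2 * (PiQ 1 z + PiQ 3 z)^3 * (PiQ 1 z - 3 * PiQ 3 z)) \<and>
    ((PiQ 2 z)^2 * ((PiQ 1 z)^4 + 18 * (PiQ 1 z)^2 * (PiQ 3 z)^2 - 27 * (PiQ 3 z)^4)
       = PiQ 1 z * PiQ 3 z * ((PiQ 1 z)^4 + 16 * (PiQ 2 z)^4)) \<and>
    ((PiQ 6 z)^2 * ((PiQ 1 z)^4 - 6 * (PiQ 1 z)^2 * (PiQ 3 z)^2 - 3 * (PiQ 3 z)^4)
       = PiQ 1 z * PiQ 3 z * ((PiQ 3 z)^4 + 16 * (PiQ 6 z)^4)) \<and>
    (((PiQ 1 z)^2 - (PiQ 3 z)^2)^4 * PiQ 3 z * (PiQ 2 z)^3 * PiQ 6 z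
       = ((PiQ 2 z)^2 - (PiQ 6 z)^2)^2 * (PiQ 1 z)^3 * (4 * (PiQ 6 z)^2 + PiQ 1 z * PiQ 3 z)^3) \<and>
    (PiQ 3 z * (PiQ 6 z)^4 * ((PiQ 1 z)^2 - (PiQ 3 z)^2)^4
       = ((PiQ 2 z)^2 - (PiQ 6 z)^2)^2 * ((PiQ 3 z)^3 + 4 * PiQ 1 z * (PiQ 6 z)^2)^3) \<and>
    (((PiQ 1 z)^2 - (PiQ 3 z)^2) * (PiQ 2 z - PiQ 6 z)^3 * PiQ 6 z
       = (PiQ 3 z)^2 * ((PiQ 2 z)^2 - (PiQ 6 z)^2)^2) \<and>
    (PiQ 2 z * (PiQ 3 z)^3
       = PiQ 1 z * PiQ 6 z * (PiQ 2 z - PiQ 6 z)^2) \<and>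
    ((PiQ 1 z)^3 * PiQ 6 z
       = PiQ 2 z * PiQ 3 z * (PiQ 2 z + 3 * PiQ 6 z)^2) \<and>
    ((PiQ 1 z)^2 * PiQ 8 z
       = PiQ 2 z * (PiQ 4 z + 2 * PiQ 8 z)^2) \<and>
    ((PiQ 1 z)^4 * PiQ 4 z * PiQ 8 z * ((PiQ 4 z)^2 + 4 * (PiQ 8 z)^2)
       = (PiQ 2 z)^4 * (PiQ 4 z + 2 * PiQ 8 z)^4) \<and>
    ((PiQ 3 z)^2 + 3 * PiQ 1 z * PiQ 9 z
       = (sqrt_PiQ 1 z * sqrt_PiQ 9 z) * (PiQ 1 z + 3 * PiQ 9 z)) \<and>
    (sqrt_PiQ 9 z * (sqrt_PiQ 1 z - sqrt_PiQ 9 z)^3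
       = (PiQ 3 z)^2 - (PiQ 9 z)^2) \<and>
    ((PiQ 9 z)^2 * ((PiQ 1 z)^2 - (PiQ 3 z)^2)^3
       = ((PiQ 3 z)^2 - (PiQ 9 z)^2) * ((PiQ 3 z)^2 + 3 * PiQ 1 z * PiQ 9 z)^3) \<and>
    (PiQ 9 z * ((PiQ 1 z)^2 - (PiQ 3 z)^2)^6
       = (PiQ 1 z)^3 * ((PiQ 3 z)^2 - (PiQ 9 z)^2)^2 * (PiQ 1 z + 3 * PiQ 9 z)^6) \<and>
    (6 * (PiQ 1 z / PiQ 3 z) + 3 * (PiQ 3 z / PiQ 1 z) - (PiQ 1 z)^3 / (PiQ 3 z)^3
       = 27 * ((PiQ 9 z)^3 / (PiQ 3 z)^3) - 18 * (PiQ 9 z / PiQ 3 z) - PiQ 3 z / PiQ 9 z) \<and>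
    (PiQ 2 z * (PiQ 5 z)^4 * (16 * (PiQ 10 z)^4 - (PiQ 5 z)^4)
       = (PiQ 10 z)^3 * (5 * PiQ 10 z - PiQ 2 z) * (PiQ 2 z - PiQ 10 z)^5) \<and>
    (PiQ 10 z * (PiQ 1 z)^4 * (16 * (PiQ 2 z)^4 - (PiQ 1 z)^4)
       = (PiQ 2 z)^3 * (5 * PiQ 10 z - PiQ 2 z)^5 * (PiQ 2 z - PiQ 10 z)) \<and>
    (PiQ 1 z * PiQ 5 z * (16 * (PiQ 2 z)^4 - (PiQ 1 z)^4)^2
       = (PiQ 2 z)^4 * (5 * PiQ 5 z - PiQ 1 z)^5 * (PiQ 5 z - PiQ 1 z)) \<and>
    (PiQ 1 z * PiQ 5 z * (16 * (PiQ 10 z)^4 - (PiQ 5 z)^4)^2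
       = (PiQ 10 z)^4 * (5 * PiQ 5 z - PiQ 1 z) * (PiQ 5 z - PiQ 1 z)^5) \<and>
    (PiQ 2 z * PiQ 10 z * (PiQ 5 z - PiQ 1 z) * (5 * PiQ 5 z - PiQ 1 z)
       = (PiQ 1 z * PiQ 10 z - PiQ 2 z * PiQ 5 z)^2)"
proof -
  define t q where "t = qpow (1/8) z" and "q = qpow 1 z"
  define S where "S n = sqrt_PiQ n z" for n
  have q: "norm q < 1" "q \<noteq> 0"
    using norm_qpow_less_one[OF assms, of 1] by (simp_all add: q_def qpow_def)
  have t0: "t \<noteq> 0" by (simp add: t_def qpow_def)
  have tq: "t ^ 8 = q" by (simp add: t_def q_def qpow_power)
  have qn: "norm (q ^ n) < 1" "q ^ n \<noteq> 0" if "n > 0" for n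
    using norm_power_less_one[OF q(1) that] q(2) by auto
  have S: "S n = t ^ n * psi (q ^ n)" for n
    by (simp add: S_def sqrt_PiQ_def t_def q_def qpow_power)
  have P: "PiQ n z = (S n)\<^sup>2" if "n > 0" for n
    using PiQ_eq[OF assms that] by (simp add: S_def)
  have S0: "S n \<noteq> 0" if "n > 0" for n
    using psi_nonzero[OF qn(1)[OF that]] t0 by (simp add: S)
  note S0s = S0[of 1] S0[of 2] S0[of 3] S0[of 4] S0[of 5] S0[of 6] S0[of 8] S0[of 9] S0[of 10]

  \<comment> \<open>Used at \<open>n = 1\<close> for level 8 and at \<open>n = 2\<close> for the
    second identity of level 16.\<close>
  have l8: "(S n)\<^sup>2 * (S n)\<^sup>2 * (S (4 * n))\<^sup>2 = (S (2 * n))\<^sup>2 * ((S (2 * n)) ^ 4 + 4 * (S (4 * n)) ^ 4)"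
    if n: "n > 0" for n
  proof -
    define r u where "r = q ^ n" and "u = t ^ n"
    have r: "norm r < 1" "r \<noteq> 0" "norm (r ^ 2) < 1" "r ^ 2 \<noteq> 0"
      using qn[OF n] norm_power_less_one[of r 2] by (auto simp: r_def)
    have ur: "u ^ 8 = r" by (simp add: u_def r_def tq[symmetric] power_mult[symmetric] mult.commute)
    have s: "S n = u * psi r" "S (2 * n) = u\<^sup>2 * psi (r ^ 2)" "S (4 * n) = u ^ 4 * psi (r ^ 4)"
      by (simp_all add: S u_def r_def power_mult[symmetric] mult.commute)
    have "(psi r)\<^sup>2 = phi r * psi (r ^ 2)" "(psi (r ^ 2))\<^sup>2 = phi (r ^ 2) * psi (r ^ 4)"
      "(phi r)\<^sup>2 = (phi (r ^ 2))\<^sup>2 + 4 * r * (psi (r ^ 4))\<^sup>2"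
      using psi_square[OF r(1,2)] psi_square[OF r(3,4)] phi_square[OF r(1,2)] by (simp_all add: power_mult[symmetric])
    then show ?thesis unfolding s ur[symmetric] by algebra
  qed
  \<comment> \<open>Multiply the parity dissection of \<open>phi\<close> by
    \<open>psi (q ^ 8)\<close> and apply \<open>psi_square\<close> at \<open>q ^ 4\<close> and at
    \<open>q\<close>.\<close>
  have l16: "(S 1)\<^sup>2 * S 8 = S 2 * ((S 4)\<^sup>2 + 2 * (S 8)\<^sup>2)"
  proof -
    have "(psi q)\<^sup>2 = phi q * psi (q ^ 2)" "(psi (q ^ 4))\<^sup>2 = phi (q ^ 4) * psi (q ^ 8)"
      "phi q = phi (q ^ 4) + 2 * q * psi (q ^ 8)"
      using psi_square[OF q] psi_square[OF qn, of 4] phi_dissect2[OF q] by (simp_all add: power_mult[symmetric])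
    then show ?thesis unfolding S tq[symmetric] by simp algebra
  qed

  have k1: "S 1 * S 6 * ((S 2)\<^sup>2 - (S 6)\<^sup>2) = S 2 * S 3 ^ 3"
    and k2: "S 1 ^ 3 * S 6 = S 2 * S 3 * ((S 2)\<^sup>2 + 3 * (S 6)\<^sup>2)"
  proof -
    have c: "psi q * psi (q ^ 6) * ((psi (q ^ 2))\<^sup>2 - t ^ 8 * (psi (q ^ 6))\<^sup>2) = psi (q ^ 2) * psi (q ^ 3) ^ 3"
      "psi q ^ 3 * psi (q ^ 6) = psi (q ^ 2) * psi (q ^ 3) * ((psi (q ^ 2))\<^sup>2 + 3 * t ^ 8 * (psi (q ^ 6))\<^sup>2)"
      using psi_cubic[OF q(1)] psi_cubic'[OF q] by (simp_all only: tq)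
    have s: "S 1 = t * psi q" "S 2 = t\<^sup>2 * psi (q ^ 2)" "S 3 = t ^ 3 * psi (q ^ 3)" "S 6 = t ^ 6 * psi (q ^ 6)"
      by (simp_all add: S)
    show "S 1 * S 6 * ((S 2)\<^sup>2 - (S 6)\<^sup>2) = S 2 * S 3 ^ 3" unfolding s using c(1) by algebra
    show "S 1 ^ 3 * S 6 = S 2 * S 3 * ((S 2)\<^sup>2 + 3 * (S 6)\<^sup>2)" unfolding s using c(2) by algebra
  qed
  \<comment> \<open>A square root of \<Pi>_1 \<Pi>_3 / (\<Pi>_2 \<Pi>_6) with its branch fixed by
    \<open>S\<close>. Identity (L12-3) is linear in it, so knowing \<open>k\<^sup>2\<close> alone
    would leave a sign open.\<close>
  define k where "k = S 1 * S 3 / (S 2 * S 6)"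
  have kS: "S 1 * S 3 = k * (S 2 * S 6)" using S0s by (simp add: k_def)
  have k0: "k \<noteq> 0" using S0s by (simp add: k_def)
  have a2: "((S 1)\<^sup>2)\<^sup>2 = k * (S 2)\<^sup>2 * ((S 2)\<^sup>2 + 3 * (S 6)\<^sup>2)"
  proof -
    have "S 6 * ((S 1)\<^sup>2)\<^sup>2 = S 6 * (k * (S 2)\<^sup>2 * ((S 2)\<^sup>2 + 3 * (S 6)\<^sup>2))" using k2 kS by algebra
    then show ?thesis using S0s by simp
  qed
  have b2: "((S 3)\<^sup>2)\<^sup>2 = k * (S 6)\<^sup>2 * ((S 2)\<^sup>2 - (S 6)\<^sup>2)"
  proof -
    have "S 2 * ((S 3)\<^sup>2)\<^sup>2 = S 2 * (k * (S 6)\<^sup>2 * ((S 2)\<^sup>2 - (S 6)\<^sup>2))" using k1 kS by algebra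
    then show ?thesis using S0s by simp
  qed
  have ab: "(S 1)\<^sup>2 * (S 3)\<^sup>2 = k\<^sup>2 * (S 2)\<^sup>2 * (S 6)\<^sup>2" using kS by algebra
  \<comment> \<open>The product of \<open>k1\<close> and \<open>k2\<close>, divided by the nonzero
    values of \<open>S\<close>.\<close>
  have kk: "k\<^sup>2 * (S 2)\<^sup>2 * (S 6)\<^sup>2 = ((S 2)\<^sup>2 - (S 6)\<^sup>2) * ((S 2)\<^sup>2 + 3 * (S 6)\<^sup>2)"
  proof -
    have "(S 1 * S 6 * S 2 * S 3) * (((S 2)\<^sup>2 - (S 6)\<^sup>2) * ((S 2)\<^sup>2 + 3 * (S 6)\<^sup>2)) = (S 1 * S 6 * S 2 * S 3) * ((S 1)\<^sup>2 * (S 3)\<^sup>2)"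
      using k1 k2 by algebra
    then show ?thesis using S0s ab by simp
  qed
  have nz12: "(S 1)\<^sup>2 \<noteq> 0" "(S 3)\<^sup>2 \<noteq> 0" "k \<noteq> 0" "(S 2)\<^sup>2 \<noteq> 0" "(S 6)\<^sup>2 \<noteq> 0" using S0s k0 by simp_all
  note L12 = level12_algebra[OF nz12 a2 b2 ab kk]
  have L12_3: "S 2 * S 6 * (((S 1)\<^sup>2)\<^sup>2 - 3 * ((S 3)\<^sup>2)\<^sup>2) = S 1 * S 3 * (((S 2)\<^sup>2)\<^sup>2 + 3 * ((S 6)\<^sup>2)\<^sup>2)"
    unfolding a2 b2 kS by algebra

  \<comment> \<open>\<open>psi_A (q ^ 3)\<close> occurs linearly in the dissection at
    \<open>q\<close> and as a cube in the quartic relation at \<open>q ^ 3\<close>; eliminating it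
    leaves a relation between values of \<open>psi\<close> alone.\<close>
  have cubic18: "S 9 * (S 1 - S 9) ^ 3 = ((S 3)\<^sup>2)\<^sup>2 - ((S 9)\<^sup>2)\<^sup>2"
  proof -
    have "psi q = psi_A (q ^ 3) + t ^ 8 * psi (q ^ 9)"
      "psi (q ^ 3) ^ 4 = psi (q ^ 9) * psi_A (q ^ 3) ^ 3 + t ^ 24 * psi (q ^ 9) ^ 4"
      using psi_dissect3[OF q] psi_quartic[OF qn, of 3] by (simp_all add: power_mult[symmetric] tq[symmetric])
    moreover have "S 1 = t * psi q" "S 3 = t ^ 3 * psi (q ^ 3)" "S 9 = t ^ 9 * psi (q ^ 9)" by (simp_all add: S)
    ultimately show ?thesis by algebra
  qed
  have nz18: "S 1 \<noteq> 0" "S 9 \<noteq> 0" "(S 3)\<^sup>2 \<noteq> 0" using S0s by simp_all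
  note L18 = level18_algebra[OF nz18 cubic18]

  define e where "e n = euler (q ^ n)" for n
  have e0: "e n \<noteq> 0" if "n > 0" for n using euler_power_nonzero[OF q(1) that] by (simp add: e_def)
  have Se: "(S n)\<^sup>2 = (t\<^sup>2) ^ n * ((e (2 * n))\<^sup>2 / e n)\<^sup>2" if "n > 0" for n
  proof -
    have "psi (q ^ n) = (e (2 * n))\<^sup>2 / e n"
      using psi_euler[OF qn[OF that]] by (simp add: e_def power_mult[symmetric] mult.commute)
    then show ?thesis
      unfolding S by (simp only: power_mult_distrib power_mult[symmetric] mult.commute[of n 2])
  qed
  have f1: "(S n)\<^sup>2 - (S (5 * n))\<^sup>2 = (t\<^sup>2) ^ n * (e (2 * n) * e (5 * n) ^ 3 / (e n * e (10 * n)))"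
    and f5: "(S n)\<^sup>2 - 5 * (S (5 * n))\<^sup>2 = (t\<^sup>2) ^ n * (e n ^ 3 * e (10 * n) / (e (2 * n) * e (5 * n)))"
    and f8: "((S n)\<^sup>2) ^ 4 - 16 * ((S (2 * n))\<^sup>2) ^ 4 = ((S (2 * n))\<^sup>2)\<^sup>2 * (e n ^ 8 / e (2 * n) ^ 4)"
    if n: "n > 0" for n
  proof -
    define r u where "r = q ^ n" and "u = t ^ n"
    have r: "norm r < 1" "r \<noteq> 0" using qn[OF n] by (simp_all add: r_def)
    have ur: "u ^ 8 = r" by (simp add: u_def r_def tq[symmetric] power_mult[symmetric] mult.commute)
    have s: "S n = u * psi r" "S (2 * n) = u\<^sup>2 * psi (r ^ 2)" "S (5 * n) = u ^ 5 * psi (r ^ 5)"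
      by (simp_all add: S u_def r_def power_mult[symmetric] mult.commute)
    have es: "e n = euler r" "e (2 * n) = euler (r ^ 2)" "e (5 * n) = euler (r ^ 5)" "e (10 * n) = euler (r ^ 10)"
      by (simp_all add: e_def r_def power_mult[symmetric] mult.commute)
    have tu: "(t\<^sup>2) ^ n = u\<^sup>2" by (simp add: u_def power_mult[symmetric] mult.commute)
    have a: "(psi r)\<^sup>2 = u ^ 8 * (psi (r ^ 5))\<^sup>2 + v \<Longrightarrow> (u * psi r)\<^sup>2 - (u ^ 5 * psi (r ^ 5))\<^sup>2 = u\<^sup>2 * v" for v
      by algebra
    have b: "(psi r)\<^sup>2 = 5 * u ^ 8 * (psi (r ^ 5))\<^sup>2 + v \<Longrightarrow> (u * psi r)\<^sup>2 - 5 * (u ^ 5 * psi (r ^ 5))\<^sup>2 = u\<^sup>2 * v" for v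
      by algebra
    have c: "psi r ^ 8 - 16 * u ^ 8 * psi (r ^ 2) ^ 8 = psi (r ^ 2) ^ 4 * v \<Longrightarrow>
       ((u * psi r)\<^sup>2) ^ 4 - 16 * ((u\<^sup>2 * psi (r ^ 2))\<^sup>2) ^ 4 = ((u\<^sup>2 * psi (r ^ 2))\<^sup>2)\<^sup>2 * v" for v
      by algebra
    show "(S n)\<^sup>2 - (S (5 * n))\<^sup>2 = (t\<^sup>2) ^ n * (e (2 * n) * e (5 * n) ^ 3 / (e n * e (10 * n)))"
      unfolding s es tu by (rule a) (simp only: ur psi_quintic[OF r])
    show "(S n)\<^sup>2 - 5 * (S (5 * n))\<^sup>2 = (t\<^sup>2) ^ n * (e n ^ 3 * e (10 * n) / (e (2 * n) * e (5 * n)))"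
      unfolding s es tu by (rule b) (simp only: ur psi_quintic'(1)[OF r])
    show "((S n)\<^sup>2) ^ 4 - 16 * ((S (2 * n))\<^sup>2) ^ 4 = ((S (2 * n))\<^sup>2)\<^sup>2 * (e n ^ 8 / e (2 * n) ^ 4)"
      unfolding s es by (rule c) (simp only: ur psi_eighth[OF r])
  qed
  have e0s: "e 1 \<noteq> 0" "e 2 \<noteq> 0" "e 4 \<noteq> 0" "e 5 \<noteq> 0" "e 10 \<noteq> 0" "e 20 \<noteq> 0" using e0 by simp_all
  have Ses: "(S 1)\<^sup>2 = t\<^sup>2 * ((e 2)\<^sup>2 / e 1)\<^sup>2" "(S 2)\<^sup>2 = (t\<^sup>2)\<^sup>2 * ((e 4)\<^sup>2 / e 2)\<^sup>2"
    "(S 5)\<^sup>2 = (t\<^sup>2) ^ 5 * ((e 10)\<^sup>2 / e 5)\<^sup>2" "(S 10)\<^sup>2 = (t\<^sup>2) ^ 10 * ((e 20)\<^sup>2 / e 10)\<^sup>2"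
    using Se[of 1] Se[of 2] Se[of 5] Se[of 10] by simp_all
  have fs: "(S 1)\<^sup>2 - (S 5)\<^sup>2 = t\<^sup>2 * (e 2 * e 5 ^ 3 / (e 1 * e 10))"
     "(S 1)\<^sup>2 - 5 * (S 5)\<^sup>2 = t\<^sup>2 * (e 1 ^ 3 * e 10 / (e 2 * e 5))"
     "(S 2)\<^sup>2 - (S 10)\<^sup>2 = (t\<^sup>2)\<^sup>2 * (e 4 * e 10 ^ 3 / (e 2 * e 20))"
     "(S 2)\<^sup>2 - 5 * (S 10)\<^sup>2 = (t\<^sup>2)\<^sup>2 * (e 2 ^ 3 * e 20 / (e 4 * e 10))"
     "((S 1)\<^sup>2) ^ 4 - 16 * ((S 2)\<^sup>2) ^ 4 = ((S 2)\<^sup>2)\<^sup>2 * (e 1 ^ 8 / e 2 ^ 4)"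
     "((S 5)\<^sup>2) ^ 4 - 16 * ((S 10)\<^sup>2) ^ 4 = ((S 10)\<^sup>2)\<^sup>2 * (e 5 ^ 8 / e 10 ^ 4)"
    using f1[of 1] f5[of 1] f1[of 2] f5[of 2] f8[of 1] f8[of 5] by simp_all
  note L20 = level20_algebra[OF e0s Ses fs]
  have L20_5: "(S 2)\<^sup>2 * (S 10)\<^sup>2 * ((S 5)\<^sup>2 - (S 1)\<^sup>2) * (5 * (S 5)\<^sup>2 - (S 1)\<^sup>2) = ((S 1)\<^sup>2 * (S 10)\<^sup>2 - (S 2)\<^sup>2 * (S 5)\<^sup>2)\<^sup>2"
  proof -
    have "((psi q)\<^sup>2 - t ^ 8 * (psi (q ^ 5))\<^sup>2) * ((psi q)\<^sup>2 - 5 * t ^ 8 * (psi (q ^ 5))\<^sup>2) * (psi (q ^ 2))\<^sup>2 * (psi (q ^ 10))\<^sup>2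
      = ((psi (q ^ 5))\<^sup>2 * (psi (q ^ 2))\<^sup>2 - t ^ 8 * (psi q)\<^sup>2 * (psi (q ^ 10))\<^sup>2)\<^sup>2"
      using psi_quintic'(2)[OF q] by (simp only: tq)
    moreover have s: "S 1 = t * psi q" "S 2 = t\<^sup>2 * psi (q ^ 2)" "S 5 = t ^ 5 * psi (q ^ 5)" "S 10 = t ^ 10 * psi (q ^ 10)"
      by (simp_all add: S)
    \<comment> \<open>Both sides carry the weight \<open>t ^ 28\<close>; pulling it out reduces the
      claim to the relation for \<open>psi\<close>.\<close>
    have "(t\<^sup>2 * c)\<^sup>2 * (t ^ 10 * d)\<^sup>2 * ((t ^ 5 * b)\<^sup>2 - (t * a)\<^sup>2) * (5 * (t ^ 5 * b)\<^sup>2 - (t * a)\<^sup>2)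
        = t ^ 28 * ((a\<^sup>2 - t ^ 8 * b\<^sup>2) * (a\<^sup>2 - 5 * t ^ 8 * b\<^sup>2) * c\<^sup>2 * d\<^sup>2)"
      and "((t * a)\<^sup>2 * (t ^ 10 * d)\<^sup>2 - (t\<^sup>2 * c)\<^sup>2 * (t ^ 5 * b)\<^sup>2)\<^sup>2
        = t ^ 28 * (b\<^sup>2 * c\<^sup>2 - t ^ 8 * a\<^sup>2 * d\<^sup>2)\<^sup>2" for a b c d :: complex
      by algebra+
    ultimately show ?thesis unfolding s by (simp only:)
  qed

  have L8: "((S 1)\<^sup>2)\<^sup>2 / ((S 2)\<^sup>2 * (S 4)\<^sup>2) - ((S 2)\<^sup>2)\<^sup>2 / ((S 4)\<^sup>2)\<^sup>2 = 4"
  proof -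
    have eq: "((S 1)\<^sup>2)\<^sup>2 * (S 4)\<^sup>2 = (S 2)\<^sup>2 * (((S 2)\<^sup>2)\<^sup>2 + 4 * ((S 4)\<^sup>2)\<^sup>2)"
      using l8[of 1] by simp
    have "a\<^sup>2 / (x * c) - x\<^sup>2 / c\<^sup>2 = 4" if "a\<^sup>2 * c = x * (x\<^sup>2 + 4 * c\<^sup>2)" "x \<noteq> 0" "c \<noteq> 0" for a x c :: complex
    proof -
      have "a\<^sup>2 * c\<^sup>2 = (x\<^sup>2 + 4 * c\<^sup>2) * (x * c)" using that(1) by algebra
      then have "a\<^sup>2 / (x * c) = (x\<^sup>2 + 4 * c\<^sup>2) / c\<^sup>2" using that(2,3) by (subst frac_eq_eq) simp_all
      then show ?thesis using that by (simp add: add_divide_distrib)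
    qed
    from this[OF eq] show ?thesis using S0s by simp
  qed
  have L16: "((S 1)\<^sup>2)\<^sup>2 * (S 8)\<^sup>2 = (S 2)\<^sup>2 * ((S 4)\<^sup>2 + 2 * (S 8)\<^sup>2)\<^sup>2"
    "((S 1)\<^sup>2) ^ 4 * (S 4)\<^sup>2 * (S 8)\<^sup>2 * (((S 4)\<^sup>2)\<^sup>2 + 4 * ((S 8)\<^sup>2)\<^sup>2) = ((S 2)\<^sup>2) ^ 4 * ((S 4)\<^sup>2 + 2 * (S 8)\<^sup>2) ^ 4"
  proof -
    show 1: "((S 1)\<^sup>2)\<^sup>2 * (S 8)\<^sup>2 = (S 2)\<^sup>2 * ((S 4)\<^sup>2 + 2 * (S 8)\<^sup>2)\<^sup>2" using l16 by algebra
    \<comment> \<open>The level 8 relation at the doubled argument turns the factor \<Pi>_4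
      (\<Pi>_4^2 + 4 \<Pi>_8^2) into \<Pi>_2^2 \<Pi>_8, so the claim is the square of
      \<open>1\<close> times \<Pi>_2^2.\<close>
    have "((S 2)\<^sup>2)\<^sup>2 * (S 8)\<^sup>2 = (S 4)\<^sup>2 * (((S 4)\<^sup>2)\<^sup>2 + 4 * ((S 8)\<^sup>2)\<^sup>2)"
      using l8[of 2] by simp
    then show "((S 1)\<^sup>2) ^ 4 * (S 4)\<^sup>2 * (S 8)\<^sup>2 * (((S 4)\<^sup>2)\<^sup>2 + 4 * ((S 8)\<^sup>2)\<^sup>2) = ((S 2)\<^sup>2) ^ 4 * ((S 4)\<^sup>2 + 2 * (S 8)\<^sup>2) ^ 4"
      using 1 by algebra
  qed
  have Ps: "PiQ 1 z = (S 1)\<^sup>2" "PiQ 2 z = (S 2)\<^sup>2" "PiQ 3 z = (S 3)\<^sup>2" "PiQ 4 z = (S 4)\<^sup>2" "PiQ 5 z = (S 5)\<^sup>2"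
    "PiQ 6 z = (S 6)\<^sup>2" "PiQ 8 z = (S 8)\<^sup>2" "PiQ 9 z = (S 9)\<^sup>2" "PiQ 10 z = (S 10)\<^sup>2"
    by (rule P; simp)+
  show ?thesis
    unfolding Ps S_def[symmetric]
    by (intro conjI L8 L12 L12_3 L16 L18 cubic18 L20 L20_5)
qed

end
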